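(* Assume that $\mathcal{M}_{\mathcal{P}}$ and $\mathcal{M}_{\mathcal{P}'}$ are homeomorphic solenoidal manifolds, defined by presentations $\mathcal{P}$ and $\mathcal{P}'$. Then the typesets $\Xi[\mathcal{P}]$ and $\Xi[\mathcal{P}']$ are commensurable.
   Context: Solenoidal manifolds. A presentation is a sequence of proper finite covering maps $\mathcal{P}=\{q_\ell\colon M_\ell\to M_{\ell-1}\mid\ell\ge1\}$, where each $M_\ell$ is a compact connected manifold without boundary of dimension $n$ (proper meaning covering degree greater than one). The associated solenoidal manifold is the inverse limit $\mathcal{M}_{\mathcal{P}}=\varprojlim\{q_\ell\colon M_\ell\to M_{\ell-1}\}\subset\prod_{\ell\ge0}M_\ell$ with the topology induced from the product topology. Choose a basepoint $x_\infty=(x_0,x_1,\ldots)\in\mathcal{M}_{\mathcal{P}}$, let $\Gamma=\pi_1(M_0,x_0)$, and let $\Gamma_\ell\subset\Gamma$ be the image of $\pi_1(M_\ell,x_\ell)$ under the homomorphism induced by the covering map $M_\ell\to M_0$ obtained by composing $q_\ell,\ldots,q_1$. This gives a group chain $\mathcal{G}_{\mathcal{P}}=\{\Gamma=\Gamma_0\supset\Gamma_1\supset\cdots\}$ (a descending chain of finite index subgroups), whose associated odometer $X_\infty=\varprojlim\Gamma/\Gamma_\ell$, with $\Gamma$ acting by left multiplication, is the monodromy action of the projection $\mathcal{M}_{\mathcal{P}}\to M_0$. Types and typesets. A Steinitz number is a formal product $\xi=\prod_{p}p^{\chi_\xi(p)}$ over all primes $p$, with $\chi_\xi(p)\in\{0,1,\ldots,\infty\}$;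 the least common multiple of a collection of positive integers is a Steinitz number, with exponent at $p$ the supremum of the exponents. $\xi,\xi'$ are asymptotically equivalent if $m\cdot\xi=m'\cdot\xi'$ for some integers $m,m'\ge1$; the equivalence class of $\xi$ is its type $\tau[\xi]$. For a group chain $\mathcal{G}=\{\Gamma=\Gamma_0\supset\Gamma_1\supset\cdots\}$ and a finite index subgroup $H\subset\Gamma$ with $\Gamma_\ell\subset H$ for some $\ell\geq1$ (after omitting initial terms of the chain one may take $\Gamma_1\subset H$), set $C^H_\ell=\bigcap_{\delta\in H}\delta\Gamma_\ell\delta^{-1}$, and for $\gamma\in\Gamma$ set $C^H_{\gamma,\ell}=\langle\gamma\rangle\cap C^H_\ell$ and $\xi^H(\gamma)=\mathrm{lcm}\{\#(\langle\gamma\rangle/C^H_{\gamma,\ell})\mid\ell>0\}$. The $H$-restricted typeset is $\Xi_H[\mathcal{G}]=\{\tau[\xi^H(\gamma)]\mid\gamma\in\Gamma\}$, and the typeset is $\Xi[\mathcal{G}]=\Xi_\Gamma[\mathcal{G}]$. The typeset of $\mathcal{P}$ is $\Xi[\mathcal{P}]=\Xi[\mathcal{G}_{\mathcal{P}}]$. Commensurability. For group chains $\mathcal{G}$ in $\Gamma$ and $\mathcal{G}'$ in $\Gamma'$, the typesets $\Xi[\mathcal{G}]$ and $\Xi[\mathcal{G}']$ are commensurable if there exist a finite index subgroup $H\subset\Gamma$ with $\Gamma_\ell\subset H$ for some $\ell\ge1$, and a finite index subgroup $H'\subset\Gamma'$ with $\Gamma'_{\ell'}\subset H'$ for some $\ell'\ge1$,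 such that $\Xi_H[\mathcal{G}]=\Xi_{H'}[\mathcal{G}']$. The typesets $\Xi[\mathcal{P}],\Xi[\mathcal{P}']$ are commensurable if this holds for the group chains $\mathcal{G}_{\mathcal{P}},\mathcal{G}_{\mathcal{P}'}$. *)

theory Defs
  imports
    "HOL-Analysis.Analysis"
    "HOL-Computational_Algebra.Primes"
    "HOL-Algebra.Coset"
    "HOL-Algebra.Generated_Groups"
begin

section \<open>Presentations and solenoidal manifolds\<close>

text \<open>
  The spaces \<open>M \<ell>\<close> of a presentation are subspaces of one ambient topological space, which is
  an arbitrary type of class \<^class>\<open>topological_space\<close>.  This is no restriction: any sequence of
  compact manifolds embeds in the type \<open>nat \<Rightarrow> real\<close> with its product topology.
\<close>

definition closed_manifold :: "nat \<Rightarrow> 'a::topological_space set \<Rightarrow> bool" where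
  "closed_manifold n M \<longleftrightarrow>
     compact M \<and> connected M \<and>
     Hausdorff_space (top_of_set M) \<and> second_countable (top_of_set M) \<and>
     (\<forall>x\<in>M. \<exists>U V. x \<in> U \<and> openin (top_of_set M) U \<and> openin (Euclidean_space n) V \<and>
        top_of_set U homeomorphic_space subtopology (Euclidean_space n) V)"

definition proper_finite_covering ::
    "'a::topological_space set \<Rightarrow> ('a \<Rightarrow> 'b) \<Rightarrow> 'b::topological_space set \<Rightarrow> bool" where
  "proper_finite_covering N q M \<longleftrightarrow>
     covering_space N q M \<and> (\<exists>d>1. \<forall>y\<in>M. card {x \<in> N. q x = y} = d)"

text \<open>The value \<open>q 0\<close> is not used; for \<open>\<ell> \<ge> 1\<close> the map \<open>q \<ell>\<close> goes from \<open>M \<ell>\<close> to \<open>M (\<ell> - 1)\<close>.\<close>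

definition presentation ::
    "nat \<Rightarrow> (nat \<Rightarrow> 'a::topological_space set) \<Rightarrow> (nat \<Rightarrow> 'a \<Rightarrow> 'a) \<Rightarrow> bool" where
  "presentation n M q \<longleftrightarrow>
     (\<forall>l. closed_manifold n (M l)) \<and>
     (\<forall>l\<ge>1. proper_finite_covering (M l) (q l) (M (l - 1)))"

text \<open>The function type carries the product topology (\<open>HOL-Analysis.Function_Topology\<close>).\<close>

definition solenoidal_manifold ::
    "(nat \<Rightarrow> 'a::topological_space set) \<Rightarrow> (nat \<Rightarrow> 'a \<Rightarrow> 'a) \<Rightarrow> (nat \<Rightarrow> 'a) set" where
  "solenoidal_manifold M q =
     {x. (\<forall>l. x l \<in> M l) \<and> (\<forall>l\<ge>1. q l (x l) = x (l - 1))}"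

primrec bonding_map :: "(nat \<Rightarrow> 'a \<Rightarrow> 'a) \<Rightarrow> nat \<Rightarrow> 'a \<Rightarrow> 'a" where
  "bonding_map q 0 = id"
| "bonding_map q (Suc l) = bonding_map q l \<circ> q (Suc l)"


section \<open>The fundamental group\<close>

definition loops_at :: "'a::topological_space set \<Rightarrow> 'a \<Rightarrow> (real \<Rightarrow> 'a) set" where
  "loops_at S x = {p. path p \<and> path_image p \<subseteq> S \<and> pathstart p = x \<and> pathfinish p = x}"

definition path_class :: "'a::topological_space set \<Rightarrow> (real \<Rightarrow> 'a) \<Rightarrow> (real \<Rightarrow> 'a) set" where
  "path_class S p = {r. homotopic_paths S p r}"

definition fundamental_group ::
    "'a::topological_space set \<Rightarrow> 'a \<Rightarrow> (real \<Rightarrow> 'a) set monoid" where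
  "fundamental_group S x =
     \<lparr>carrier = path_class S ` loops_at S x,
      mult = (\<lambda>A B. \<Union>p\<in>A. \<Union>r\<in>B. path_class S (p +++ r)),
      one = path_class S (\<lambda>_. x)\<rparr>"

definition induced_hom ::
    "'b::topological_space set \<Rightarrow> ('a \<Rightarrow> 'b) \<Rightarrow> (real \<Rightarrow> 'a) set \<Rightarrow> (real \<Rightarrow> 'b) set" where
  "induced_hom T f A = (\<Union>p\<in>A. path_class T (f \<circ> p))"

definition presentation_chain ::
    "(nat \<Rightarrow> 'a::topological_space set) \<Rightarrow> (nat \<Rightarrow> 'a \<Rightarrow> 'a) \<Rightarrow> (nat \<Rightarrow> 'a) \<Rightarrow>
     nat \<Rightarrow> (real \<Rightarrow> 'a) set set" where
  "presentation_chain M q x l =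
     induced_hom (M 0) (bonding_map q l) ` carrier (fundamental_group (M l) (x l))"


section \<open>Steinitz numbers and types\<close>

text \<open>A Steinitz number is given by its exponents; exponents at non-primes are set to \<open>0\<close>.\<close>

typedef steinitz = "{e :: nat \<Rightarrow> enat. \<forall>p. \<not> prime p \<longrightarrow> e p = 0}"
  morphisms exponent Steinitz
  by (rule exI[of _ "\<lambda>_. 0"]) simp

definition steinitz_lcm :: "nat set \<Rightarrow> steinitz" where
  "steinitz_lcm A =
     Steinitz (\<lambda>p. if prime p then (SUP a\<in>A. enat (multiplicity p a)) else 0)"

definition steinitz_scale :: "nat \<Rightarrow> steinitz \<Rightarrow> steinitz" where
  "steinitz_scale m \<xi> =
     Steinitz (\<lambda>p. if prime p then enat (multiplicity p m) + exponent \<xi> p else 0)"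

definition asymptotically_equivalent :: "steinitz \<Rightarrow> steinitz \<Rightarrow> bool" where
  "asymptotically_equivalent \<xi> \<xi>' \<longleftrightarrow>
     (\<exists>m\<ge>1. \<exists>m'\<ge>1. steinitz_scale m \<xi> = steinitz_scale m' \<xi>')"

definition steinitz_type :: "steinitz \<Rightarrow> steinitz set" where
  "steinitz_type \<xi> = {\<xi>'. asymptotically_equivalent \<xi> \<xi>'}"


section \<open>Typesets of group chains\<close>

definition restricted_core ::
    "('g, 'b) monoid_scheme \<Rightarrow> (nat \<Rightarrow> 'g set) \<Rightarrow> 'g set \<Rightarrow> nat \<Rightarrow> 'g set" where
  "restricted_core G C H l =
     (\<Inter>\<delta>\<in>H. (\<lambda>g. \<delta> \<otimes>\<^bsub>G\<^esub> g \<otimes>\<^bsub>G\<^esub> inv\<^bsub>G\<^esub> \<delta>) ` C l)"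

definition restricted_steinitz_order ::
    "('g, 'b) monoid_scheme \<Rightarrow> (nat \<Rightarrow> 'g set) \<Rightarrow> 'g set \<Rightarrow> 'g \<Rightarrow> steinitz" where
  "restricted_steinitz_order G C H \<gamma> =
     steinitz_lcm
       ((\<lambda>l. card (rcosets\<^bsub>G\<lparr>carrier := generate G {\<gamma>}\<rparr>\<^esub>
                    (generate G {\<gamma>} \<inter> restricted_core G C H l))) ` {l. l > 0})"

definition restricted_typeset ::
    "('g, 'b) monoid_scheme \<Rightarrow> (nat \<Rightarrow> 'g set) \<Rightarrow> 'g set \<Rightarrow> steinitz set set" where
  "restricted_typeset G C H =
     {steinitz_type (restricted_steinitz_order G C H \<gamma>) | \<gamma>. \<gamma> \<in> carrier G}"

definition typeset ::
    "('g, 'b) monoid_scheme \<Rightarrow> (nat \<Rightarrow> 'g set) \<Rightarrow> steinitz set set" where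
  "typeset G C = restricted_typeset G C (carrier G)"

text \<open>
  Commensurability of \<^term>\<open>typeset G C\<close> and \<^term>\<open>typeset G' C'\<close> refers to restricted typesets
  and is therefore a relation between the chains, not between the two sets.
\<close>

definition typesets_commensurable ::
    "('g, 'b) monoid_scheme \<Rightarrow> (nat \<Rightarrow> 'g set) \<Rightarrow>
     ('h, 'c) monoid_scheme \<Rightarrow> (nat \<Rightarrow> 'h set) \<Rightarrow> bool" where
  "typesets_commensurable G C G' C' \<longleftrightarrow>
     (\<exists>H H'. subgroup H G \<and> finite (rcosets\<^bsub>G\<^esub> H) \<and> (\<exists>l\<ge>1. C l \<subseteq> H) \<and>
             subgroup H' G' \<and> finite (rcosets\<^bsub>G'\<^esub> H') \<and> (\<exists>l\<ge>1. C' l \<subseteq> H') \<and>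
             restricted_typeset G C H = restricted_typeset G' C' H')"

end

(* Loops in M 0 act on the fibre of the solenoidal manifold by path lifting, and the chain consists
   of the stabilizers of the coordinates of x.  For a suitable level k, the fibre F over x k is a clopen
   subset of this fibre, and the restricted Steinitz orders for H = {g. g F = F} only record how powers
   of g move the level coordinates of the points of F.

   Let h be the homeomorphism.  Compactness gives a level j and a cover of M' j by small path-connected
   sets such that two intersecting ones lie in a common set whose loops are null-homotopic, and then a
   level k such that the j-th coordinate of h varies within one set of the cover on every fibre over M k.
   So the h-images of F can be slid along plaques into one fibre, and further along a path to the fibre
   of x'; this embeds F as a clopen set F'.  Lifts of one path of M k stay plaque-close after applying h,
   hence the embedding transports the action of H on F to that of H' = {g'. g' F' = F'} on F'.  Plaques
   being small for h^-1 as well, levels correspond in both directions, so that the restricted Steinitz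
   orders agree. *)

theory Submission
  imports Defs
begin

section \<open>Types and commensurability of group chains\<close>

text \<open>Loops are composed from left to right, so monodromy is a right action, and conjugating
  the chain by \<open>\<delta>\<close> yields stabilizers at \<open>act (inv \<delta>) x\<close>. A
  homeomorphism need not send fibres to fibres, nor respect the given basepoints; hence the
  embedding \<open>s\<close> of the fibre is not a restriction of \<open>h\<close>, and the point
  that it sends to \<open>x'\<close> is some \<open>x1\<close> other than \<open>x\<close> in
  general. No homomorphism between \<open>H\<close> and \<open>H'\<close> is built. For each element
  of one group some element of the other with the same action on the embedded fibre is found, which
  suffices because orders depend on the action alone. Matched elements have equal Steinitz orders:
  levels refine each other in both directions, and a least common multiple does not see how its
  terms are indexed. The integers allowed by asymptotic equivalence are spent elsewhere, on
  replacing an arbitrary element of the group by a power lying in \<open>H\<close>. The constants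
  are nested: inessential sets of \<open>M 0\<close> determine \<open>j\<close>, then the cover
  \<open>\<Q>\<close> of \<open>M' j\<close> is chosen, and \<open>\<Q>\<close> determines
  \<open>k\<close>.\<close>

lemma exponent_steinitz_lcm:
  "exponent (steinitz_lcm A) p = (if prime p then (SUP a\<in>A. enat (multiplicity p a)) else 0)"
  unfolding steinitz_lcm_def by (subst Steinitz_inverse) auto

lemma exponent_steinitz_scale:
  "exponent (steinitz_scale m \<xi>) p = (if prime p then enat (multiplicity p m) + exponent \<xi> p else 0)"
  unfolding steinitz_scale_def by (subst Steinitz_inverse) auto

lemma exponent_nonprime: "\<not> prime p \<Longrightarrow> exponent \<xi> p = 0"
  using exponent[of \<xi>] by auto

lemma steinitz_eqI: "(\<And>p. prime p \<Longrightarrow> exponent \<xi> p = exponent \<zeta> p) \<Longrightarrow> \<xi> = \<zeta>"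
  by (metis exponent_inject exponent_nonprime ext)

lemma steinitz_scale_scale:
  assumes "m \<ge> 1" "m' \<ge> 1"
  shows "steinitz_scale m (steinitz_scale m' \<xi>) = steinitz_scale (m * m') \<xi>"
proof (rule steinitz_eqI)
  fix p :: nat assume "prime p"
  then show "exponent (steinitz_scale m (steinitz_scale m' \<xi>)) p = exponent (steinitz_scale (m * m') \<xi>) p"
    using assms by (simp add: exponent_steinitz_scale prime_elem_multiplicity_mult_distrib
        flip: add.assoc)
qed

lemma asymptotically_equivalent_trans:
  assumes "asymptotically_equivalent \<xi> \<zeta>" "asymptotically_equivalent \<zeta> \<eta>"
  shows "asymptotically_equivalent \<xi> \<eta>"
proof -
  obtain a b c d where *: "a \<ge> 1" "b \<ge> 1" "c \<ge> 1" "d \<ge> 1"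
    "steinitz_scale a \<xi> = steinitz_scale b \<zeta>" "steinitz_scale c \<zeta> = steinitz_scale d \<eta>"
    using assms unfolding asymptotically_equivalent_def by blast
  have "steinitz_scale (c * a) \<xi> = steinitz_scale (b * d) \<eta>"
    using * by (metis steinitz_scale_scale mult.commute)
  moreover have "c * a \<ge> 1" "b * d \<ge> 1"
    using * by simp_all
  ultimately show ?thesis
    unfolding asymptotically_equivalent_def by blast
qed

lemma asymptotically_equivalent_sym:
  "asymptotically_equivalent \<xi> \<zeta> \<Longrightarrow> asymptotically_equivalent \<zeta> \<xi>"
  unfolding asymptotically_equivalent_def by metis

lemma steinitz_type_eqI:
  "asymptotically_equivalent \<xi> \<zeta> \<Longrightarrow> steinitz_type \<xi> = steinitz_type \<zeta>"
  unfolding steinitz_type_def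
  using asymptotically_equivalent_sym asymptotically_equivalent_trans by blast

text \<open>The condition \<open>0 \<notin> B\<close> guards against the convention
  \<open>multiplicity p 0 = 0\<close>: everything divides \<open>0\<close>, yet \<open>0\<close>
  would contribute nothing to the supremum.\<close>

lemma steinitz_lcm_mono:
  assumes "\<And>a. a \<in> A \<Longrightarrow> \<exists>b\<in>B. a dvd b" and "0 \<notin> B" and "prime p"
  shows "exponent (steinitz_lcm A) p \<le> exponent (steinitz_lcm B) p"
  unfolding exponent_steinitz_lcm using \<open>prime p\<close>
proof (simp, intro SUP_mono)
  fix a assume "a \<in> A"
  then obtain b where b: "b \<in> B" "a dvd b" using assms by blast
  moreover have "b \<noteq> 0" using assms b by metis
  ultimately show "\<exists>m\<in>B. enat (multiplicity p a) \<le> enat (multiplicity p m)"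
    by (auto intro!: bexI[of _ b] dvd_imp_multiplicity_le)
qed

text \<open>The excess of \<open>\<zeta>\<close> over \<open>\<xi>\<close> is bounded by the
  exponents of the single integer \<open>r\<close>, so it vanishes at primes not dividing
  \<open>r\<close> and is itself an integer.\<close>

lemma asymptotically_equivalentI_bounded:
  assumes "r \<ge> 1"
    and le: "\<And>p. prime p \<Longrightarrow> exponent \<xi> p \<le> exponent \<zeta> p"
    and ge: "\<And>p. prime p \<Longrightarrow> exponent \<zeta> p \<le> enat (multiplicity p r) + exponent \<xi> p"
  shows "asymptotically_equivalent \<xi> \<zeta>"
proof -
  have "\<exists>d. d \<le> multiplicity p r \<and> exponent \<zeta> p = enat d + exponent \<xi> p" if "prime p" for p
  proof (cases "exponent \<xi> p")
    case infinity
    \<comment> \<open>An infinite exponent absorbs every factor, so the excess there is set to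
      \<open>0\<close>.\<close>
    then show ?thesis using le[OF that] by (auto intro: exI[of _ 0])
  next
    case (enat a)
    have "exponent \<zeta> p \<noteq> \<infinity>"
      using ge[OF that] enat by (metis infinity_ileE plus_enat_simps(1))
    then obtain b where "exponent \<zeta> p = enat b"
      by (cases "exponent \<zeta> p") auto
    then show ?thesis
      using le[OF that] ge[OF that] enat by (auto intro!: exI[of _ "b - a"])
  qed
  then obtain d where d: "\<And>p. prime p \<Longrightarrow> d p \<le> multiplicity p r"
      "\<And>p. prime p \<Longrightarrow> exponent \<zeta> p = enat (d p) + exponent \<xi> p"
    by metis
  \<comment> \<open>\<open>m\<close> is the integer with \<open>m * \<xi> = \<zeta>\<close>; primes
    outside \<open>prime_factors r\<close> have excess \<open>0\<close>, so the finite product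
    records every \<open>d p\<close>.\<close>
  define m where "m = (\<Prod>p\<in>prime_factors r. p ^ d p)"
  have m: "multiplicity p m = d p" if "prime p" for p
  proof (cases "p \<in> prime_factors r")
    case True
    then show ?thesis
      unfolding m_def by (subst multiplicity_prod_prime_powers) (use that in auto)
  next
    case False
    then have "multiplicity p r = 0"
      using that \<open>r \<ge> 1\<close> by (simp add: in_prime_factors_iff not_dvd_imp_multiplicity_0)
    then show ?thesis
      unfolding m_def using d(1)[OF that] False
      by (subst multiplicity_prod_prime_powers) (use that in auto)
  qed
  have "m > 0" unfolding m_def by (rule prod_pos) (auto simp: in_prime_factors_iff prime_gt_0_nat)
  moreover have "steinitz_scale m \<xi> = steinitz_scale 1 \<zeta>"
    by (rule steinitz_eqI) (simp add: exponent_steinitz_scale m d(2) flip: zero_enat_def)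
  ultimately show ?thesis
    unfolding asymptotically_equivalent_def
    by (metis One_nat_def Suc_leI order_refl)
qed

section \<open>Powers of an element and subgroups of finite index\<close>

context group begin

text \<open>The index of a subgroup of a cyclic group is the least positive exponent
  \<open>d\<close> landing in it. The given \<open>m\<close> rules out infinite index, where
  \<open>card\<close> would return \<open>0\<close>. The index thereby becomes a divisibility test
  on exponents, the form in which orders are compared.\<close>

lemma card_rcosets_cyclic:
  assumes K: "subgroup K G" and \<gamma>: "\<gamma> \<in> carrier G" and m: "m > 0" "\<gamma> [^] (m::nat) \<in> K"
  defines "n \<equiv> card (rcosets\<^bsub>G\<lparr>carrier := generate G {\<gamma>}\<rparr>\<^esub> (generate G {\<gamma>} \<inter> K))"
  shows "n > 0" and "\<gamma> [^] (i::nat) \<in> K \<longleftrightarrow> n dvd i"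
proof -
  let ?Z = "G\<lparr>carrier := generate G {\<gamma>}\<rparr>" and ?K = "generate G {\<gamma>} \<inter> K"
  interpret K: subgroup K G by fact
  define d where "d = (LEAST m::nat. m > 0 \<and> \<gamma> [^] m \<in> K)"
  have d: "d > 0" "\<gamma> [^] d \<in> K" 
    using LeastI[of "\<lambda>m::nat. m > 0 \<and> \<gamma> [^] m \<in> K" m] m unfolding d_def by auto
  have least: "m = 0" if "m < d" "\<gamma> [^] m \<in> K" for m :: nat
    using not_less_Least[of m "\<lambda>m. m > 0 \<and> \<gamma> [^] m \<in> K"] that unfolding d_def by auto
  have dvd: "\<gamma> [^] (i::int) \<in> K \<longleftrightarrow> int d dvd i" for i
  proof -
    have K1: "\<gamma> [^] (int d * k) \<in> K" for k
      using d(2) \<gamma> K by (metis int_pow_int int_pow_pow subgroup_int_pow_closed)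
    have "\<gamma> [^] i = \<gamma> [^] (int d * (i div int d)) \<otimes> \<gamma> [^] (i mod int d)"
      using \<gamma> by (simp flip: int_pow_mult)
    moreover have "\<gamma> [^] (i mod int d) \<in> carrier G" using \<gamma> by simp
    ultimately have "\<gamma> [^] i \<in> K \<longleftrightarrow> \<gamma> [^] (i mod int d) \<in> K"
      using K1[of "i div int d"] by (metis K.m_closed K.m_inv_closed K.mem_carrier inv_solve_left)
    also have "\<dots> \<longleftrightarrow> \<gamma> [^] nat (i mod int d) \<in> K"
      using d(1) by (metis Euclidean_Rings.pos_mod_sign int_nat_eq int_pow_int not_le of_nat_0_less_iff)
    also have "\<dots> \<longleftrightarrow> nat (i mod int d) = 0"
      using least[of "nat (i mod int d)"] d(1) K.one_closed
      by (metis Euclidean_Rings.pos_mod_bound nat_int nat_less_iff nat_pow_0 of_nat_0_less_iff pos_mod_sign)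
    also have "\<dots> \<longleftrightarrow> int d dvd i"
      using d(1) by (metis dvd_eq_mod_eq_0 int_nat_eq nat_0 of_nat_0 of_nat_0_less_iff pos_mod_sign)
    finally show ?thesis .
  qed
  have gen: "generate G {\<gamma>} = {\<gamma> [^] (k::int) | k. True}"
    using generate_pow[OF \<gamma>] by auto
  \<comment> \<open>Cosets are residue classes of exponents modulo \<open>d\<close>; integer
    exponents are needed because \<open>generate G {\<gamma>}\<close> contains inverses.\<close>
  have cos: "?K #>\<^bsub>?Z\<^esub> \<gamma> [^] i = {\<gamma> [^] j | j. int d dvd (j - i)}" for i :: int
  proof -
    have "?K #>\<^bsub>?Z\<^esub> \<gamma> [^] i = {\<gamma> [^] j \<otimes> \<gamma> [^] i | j. \<gamma> [^] (j::int) \<in> K}"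
      unfolding r_coset_def gen by auto
    also have "\<dots> = {\<gamma> [^] (j + i) | j. int d dvd j}"
      using \<gamma> by (simp add: dvd int_pow_mult)
    also have "\<dots> = {\<gamma> [^] j | j. int d dvd (j - i)}"
    proof (intro equalityI subsetI)
      fix y assume "y \<in> {\<gamma> [^] (j + i) | j. int d dvd j}"
      then obtain j where "y = \<gamma> [^] (j + i)" "int d dvd (j + i - i)" by auto
      then show "y \<in> {\<gamma> [^] j | j. int d dvd (j - i)}" by blast
    next
      fix y assume "y \<in> {\<gamma> [^] j | j. int d dvd (j - i)}"
      then obtain j where "y = \<gamma> [^] ((j - i) + i)" "int d dvd (j - i)" by auto
      then show "y \<in> {\<gamma> [^] (j + i) | j. int d dvd j}" by blast
    qed
    finally show ?thesis .
  qed
  have "bij_betw (\<lambda>i. ?K #>\<^bsub>?Z\<^esub> \<gamma> [^] (int i)) {..<d} (rcosets\<^bsub>?Z\<^esub> ?K)"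
  proof (rule bij_betwI')
    fix i j assume ij: "i \<in> {..<d}" "j \<in> {..<d}"
    show "(?K #>\<^bsub>?Z\<^esub> \<gamma> [^] int i = ?K #>\<^bsub>?Z\<^esub> \<gamma> [^] int j) \<longleftrightarrow> i = j"
    proof
      assume "?K #>\<^bsub>?Z\<^esub> \<gamma> [^] int i = ?K #>\<^bsub>?Z\<^esub> \<gamma> [^] int j"
      then have "\<gamma> [^] int i \<in> {\<gamma> [^] l | l. int d dvd (l - int j)}"
        unfolding cos by (metis (mono_tags, lifting) cancel_comm_monoid_add_class.diff_cancel dvd_0_right mem_Collect_eq)
      then obtain l where l: "\<gamma> [^] int i = \<gamma> [^] l" "int d dvd (l - int j)" by auto
      \<comment> \<open>\<open>\<gamma>\<close> may have finite order, so equal powers need not have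
        equal exponents. Their difference is an exponent of the identity, which lies in
        \<open>K\<close>, and is therefore a multiple of \<open>d\<close>.\<close>
      have "\<gamma> [^] (int i - l) = \<gamma> [^] int i \<otimes> inv (\<gamma> [^] l)"
        using \<gamma> by (simp add: int_pow_diff)
      also have "\<dots> = \<one>" using l \<gamma> by simp
      finally have "int d dvd (int i - l)"
        using dvd K.one_closed by metis
      then have "int d dvd (int i - int j)"
        using l(2) by (metis diff_add_cancel diff_diff_eq2 dvd_add group_cancel.sub1)
      then have "int i mod int d = int j mod int d"
        by (simp add: mod_eq_dvd_iff)
      then show "i = j" using ij by simp
    qed simp
  next
    fix i assume "i \<in> {..<d}"
    show "?K #>\<^bsub>?Z\<^esub> \<gamma> [^] int i \<in> rcosets\<^bsub>?Z\<^esub> ?K"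
      unfolding RCOSETS_def using gen by auto
  next
    fix A assume "A \<in> rcosets\<^bsub>?Z\<^esub> ?K"
    then obtain z :: int where z: "A = ?K #>\<^bsub>?Z\<^esub> \<gamma> [^] z"
      unfolding RCOSETS_def using gen by auto
    have "A = ?K #>\<^bsub>?Z\<^esub> \<gamma> [^] (z mod int d)"
      unfolding z cos
      by (rule Collect_cong)
        (metis (no_types, lifting) mod_diff_right_eq dvd_eq_mod_eq_0)
    then show "\<exists>i\<in>{..<d}. A = ?K #>\<^bsub>?Z\<^esub> \<gamma> [^] int i"
      using d(1) by (intro bexI[of _ "nat (z mod int d)"]) (auto simp: nat_less_iff)
  qed
  then have "n = d"
    unfolding n_def by (metis bij_betw_same_card card_lessThan)
  then show "n > 0" using d by simp
  show "\<gamma> [^] (i::nat) \<in> K \<longleftrightarrow> n dvd i"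
    using dvd[of "int i"] \<open>n = d\<close> by (simp add: int_pow_int)
qed

text \<open>Pigeonhole on the cosets of the powers of \<open>\<gamma>\<close>: two coinciding cosets
  differ by a positive power in \<open>K\<close>.\<close>

lemma ex_pow_in_finite_index:
  assumes K: "subgroup K G" and fin: "finite (rcosets K)" and \<gamma>: "\<gamma> \<in> carrier G"
  shows "\<exists>m>0. \<gamma> [^] (m::nat) \<in> K"
proof -
  have "(\<lambda>i::nat. K #> \<gamma> [^] i) ` UNIV \<subseteq> rcosets K"
    using \<gamma> by (auto simp: RCOSETS_def)
  then have "\<not> inj (\<lambda>i::nat. K #> \<gamma> [^] i)"
    using fin finite_imageD finite_subset infinite_UNIV_nat by blast
  then obtain i j :: nat where ij: "i < j" "K #> \<gamma> [^] i = K #> \<gamma> [^] j"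
    unfolding inj_def by (metis linorder_neqE_nat)
  have eq: "\<gamma> [^] j = \<gamma> [^] (j - i) \<otimes> \<gamma> [^] i"
    using ij \<gamma> by (simp add: nat_pow_mult)
  have "\<gamma> [^] j \<in> K #> \<gamma> [^] i"
    using ij K \<gamma> by (metis nat_pow_closed rcos_self)
  then obtain k where k: "k \<in> K" "\<gamma> [^] j = k \<otimes> \<gamma> [^] i"
    unfolding r_coset_def by blast
  then have "k = \<gamma> [^] (j - i)"
    using eq \<gamma> K by (metis nat_pow_closed right_cancel subgroup.mem_carrier)
  then show ?thesis
    using k ij by (intro exI[of _ "j - i"]) simp
qed

end

section \<open>Actions on sequences and stabilizers of coordinates\<close>

text \<open>An odometer seen as a right action on a set of sequences. By \<open>act_level\<close> an
  element permutes the coordinates at each level separately, as an automorphism of a rooted tree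
  permutes vertices; \<open>C l\<close> is the stabilizer of the vertex of \<open>x\<close> at level
  \<open>l\<close>.\<close>

locale chain_action = group G for G :: "('g, 'b) monoid_scheme" (structure) +
  fixes C :: "nat \<Rightarrow> 'g set" and \<Phi> :: "(nat \<Rightarrow> 'c) set" and act :: "'g \<Rightarrow> (nat \<Rightarrow> 'c) \<Rightarrow> nat \<Rightarrow> 'c"
    and x :: "nat \<Rightarrow> 'c"
  assumes act_closed: "g \<in> carrier G \<Longrightarrow> z \<in> \<Phi> \<Longrightarrow> act g z \<in> \<Phi>"
    and act_mult: "g \<in> carrier G \<Longrightarrow> h \<in> carrier G \<Longrightarrow> z \<in> \<Phi> \<Longrightarrow> act (g \<otimes> h) z = act h (act g z)"
    and act_one: "z \<in> \<Phi> \<Longrightarrow> act \<one> z = z"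
    and act_level: "g \<in> carrier G \<Longrightarrow> z \<in> \<Phi> \<Longrightarrow> w \<in> \<Phi> \<Longrightarrow> z l = w l \<Longrightarrow> act g z l = act g w l"
    and level_antimono: "z \<in> \<Phi> \<Longrightarrow> w \<in> \<Phi> \<Longrightarrow> l \<le> m \<Longrightarrow> z m = w m \<Longrightarrow> z l = w l"
    and finite_level: "finite ((\<lambda>z. z l) ` \<Phi>)"
    and base: "x \<in> \<Phi>"
    and chain: "C l = {g \<in> carrier G. act g x l = x l}"
begin

lemma act_inv: "g \<in> carrier G \<Longrightarrow> z \<in> \<Phi> \<Longrightarrow> act (inv g) (act g z) = z"
  using act_mult[of g "inv g" z] act_one by simp

lemma act_inv': "g \<in> carrier G \<Longrightarrow> z \<in> \<Phi> \<Longrightarrow> act g (act (inv g) z) = z"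
  using act_inv[of "inv g" z] by simp

lemma act_level_iff:
  assumes "g \<in> carrier G" "z \<in> \<Phi>" "w \<in> \<Phi>"
  shows "act g z l = act g w l \<longleftrightarrow> z l = w l"
  using assms act_level[of "inv g" "act g z" "act g w" l] act_level[of g z w l]
  by (auto simp: act_inv act_closed)

definition pointwise_stabilizer :: "(nat \<Rightarrow> 'c) set \<Rightarrow> nat \<Rightarrow> 'g set" where
  "pointwise_stabilizer V l = {g \<in> carrier G. \<forall>v\<in>V. act g v l = v l}"

lemma subgroup_pointwise_stabilizer:
  assumes "V \<subseteq> \<Phi>"
  shows "subgroup (pointwise_stabilizer V l) G"
proof (rule subgroupI)
  show "pointwise_stabilizer V l \<subseteq> carrier G"
    by (auto simp: pointwise_stabilizer_def)
  have "\<one> \<in> pointwise_stabilizer V l"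
    using assms act_one by (auto simp: pointwise_stabilizer_def)
  then show "pointwise_stabilizer V l \<noteq> {}" by blast
next
  fix g assume g: "g \<in> pointwise_stabilizer V l"
  have "act (inv g) v l = v l" if "v \<in> V" for v
  proof -
    have "v \<in> \<Phi>" "g \<in> carrier G" "act g v l = v l"
      using that g assms by (auto simp: pointwise_stabilizer_def)
    then show ?thesis
      using act_level_iff[of g "act (inv g) v" v l] by (simp add: act_inv' act_closed)
  qed
  then show "inv g \<in> pointwise_stabilizer V l"
    using g by (simp add: pointwise_stabilizer_def)
next
  fix g h assume gh: "g \<in> pointwise_stabilizer V l" "h \<in> pointwise_stabilizer V l"
  have "act (g \<otimes> h) v l = v l" if "v \<in> V" for v
  proof -
    have v: "v \<in> \<Phi>" "g \<in> carrier G" "h \<in> carrier G" "act g v l = v l" "act h v l = v l"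
      using that gh assms by (auto simp: pointwise_stabilizer_def)
    then show ?thesis
      using act_level_iff[of h "act g v" v l] by (simp add: act_mult act_closed)
  qed
  then show "g \<otimes> h \<in> pointwise_stabilizer V l"
    using gh by (simp add: pointwise_stabilizer_def)
qed

text \<open>If \<open>g\<close> and \<open>g'\<close> move \<open>x\<close> to points with the same
  coordinate at level \<open>l\<close>, then \<open>g \<otimes> inv g'\<close> lies in
  \<open>C l\<close>, hence in \<open>H\<close>. So a right coset of \<open>H\<close> is determined
  by a coordinate with finitely many values.\<close>

lemma finite_rcosets_chain_supergroup:
  assumes H: "subgroup H G" and "C l \<subseteq> H"
  shows "finite (rcosets H)"
proof -
  define f where "f y = H #> (SOME g. g \<in> carrier G \<and> act g x l = y)" for y
  have "rcosets H \<subseteq> f ` ((\<lambda>z. z l) ` \<Phi>)"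
  proof
    fix A assume "A \<in> rcosets H"
    then obtain g where g: "g \<in> carrier G" "A = H #> g"
      unfolding RCOSETS_def by auto
    define g' where "g' = (SOME g'. g' \<in> carrier G \<and> act g' x l = act g x l)"
    have g': "g' \<in> carrier G \<and> act g' x l = act g x l"
      unfolding g'_def by (rule someI[of _ g]) (use g in simp)
    have "act (g \<otimes> inv g') x l = x l"
      using act_level[of "inv g'" "act g x" "act g' x" l] g g' base
      by (simp add: act_mult act_closed act_inv)
    then have "g \<otimes> inv g' \<in> H"
      using assms(2) g g' by (auto simp: chain)
    then have "H #> g = H #> g'"
      using H g g' by (metis coset_join2 coset_mult_inv1 inv_closed m_closed subgroup.subset coset_mult_inv2)
    then have "A = f (act g x l)"
      by (simp add: f_def g g'_def)
    moreover have "act g x \<in> \<Phi>" using g base act_closed by blast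
    ultimately show "A \<in> f ` ((\<lambda>z. z l) ` \<Phi>)" by blast
  qed
  then show ?thesis
    using finite_level finite_subset by blast
qed

end

section \<open>Adapted sets and restricted Steinitz orders\<close>

text \<open>A group element maps either all of \<open>V\<close> into \<open>V\<close> or no point of
  it, so the elements returning \<open>x\<close> to \<open>V\<close> form a subgroup that acts on
  \<open>V\<close>. Openness at \<open>x\<close> puts a member of the chain into this subgroup, and
  \<open>V_transitive\<close> says that the orbit of \<open>x\<close> is dense in
  \<open>V\<close>.\<close>

locale adapted_action = chain_action +
  fixes V :: "(nat \<Rightarrow> 'c) set"
  assumes V_subset: "V \<subseteq> \<Phi>"
    and V_base: "x \<in> V"
    and V_open: "\<exists>l. \<forall>z\<in>\<Phi>. z l = x l \<longrightarrow> z \<in> V"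
    and V_adapted: "g \<in> carrier G \<Longrightarrow> v \<in> V \<Longrightarrow> w \<in> V \<Longrightarrow> act g v \<in> V \<Longrightarrow> act g w \<in> V"
    and V_transitive: "v \<in> V \<Longrightarrow> \<exists>g\<in>carrier G. act g x \<in> V \<and> act g x l = v l"
begin

definition H :: "'a set" where
  "H = {g \<in> carrier G. act g x \<in> V}"

lemma act_V: "g \<in> H \<Longrightarrow> v \<in> V \<Longrightarrow> act g v \<in> V"
  using V_adapted V_base unfolding H_def by blast

lemma subgroup_H: "subgroup H G"
proof (rule subgroupI)
  show "H \<subseteq> carrier G"
    by (auto simp: H_def)
  show "H \<noteq> {}"
    using act_one base V_base by (auto simp: H_def intro!: exI[of _ \<one>])
next
  fix g assume g: "g \<in> H"
  then have "act (inv g) (act g x) \<in> V"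
    using act_inv base V_base by (auto simp: H_def)
  then have "act (inv g) x \<in> V"
    using V_adapted[of "inv g" "act g x" x] g V_base by (auto simp: H_def)
  then show "inv g \<in> H"
    using g by (auto simp: H_def)
next
  fix g h assume "g \<in> H" "h \<in> H"
  then show "g \<otimes> h \<in> H"
    using act_V[of h "act g x"] base by (auto simp: H_def act_mult)
qed

lemma ex_chain_subset_H: "\<exists>l\<ge>1. C l \<subseteq> H"
proof -
  obtain l where l: "\<forall>z\<in>\<Phi>. z l = x l \<longrightarrow> z \<in> V"
    using V_open by blast
  \<comment> \<open>The maximum with \<open>1\<close> is taken because commensurability asks for a
    level of at least \<open>1\<close>.\<close>
  have "C (max l 1) \<subseteq> H"
  proof
    fix g assume "g \<in> C (max l 1)"
    then have g: "g \<in> carrier G" "act g x (max l 1) = x (max l 1)"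
      by (auto simp: chain)
    then have "act g x l = x l"
      using level_antimono[of "act g x" x l "max l 1"] act_closed base by simp
    then show "g \<in> H"
      using g l act_closed base by (auto simp: H_def)
  qed
  then show ?thesis by (intro exI[of _ "max l 1"]) simp
qed

lemma finite_rcosets_H: "finite (rcosets H)"
  using ex_chain_subset_H finite_rcosets_chain_supergroup subgroup_H by blast

text \<open>The conjugate of \<open>C l\<close> by \<open>\<delta>\<close> is the stabilizer of
  coordinate \<open>l\<close> of \<open>act (inv \<delta>) x\<close>. For \<open>\<delta>\<close> in
  \<open>H\<close> these points lie in \<open>V\<close>, and by \<open>V_transitive\<close> they
  exhibit every coordinate that points of \<open>V\<close> have at level \<open>l\<close>.\<close>

lemma restricted_core_eq: "restricted_core G C H l = pointwise_stabilizer V l"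
proof (intro equalityI subsetI)
  fix g assume g: "g \<in> restricted_core G C H l"
  have H1: "\<one> \<in> H"
    using subgroup_H subgroup.one_closed by blast
  have *: "g \<in> carrier G \<and> act g (act (inv \<delta>) x) l = act (inv \<delta>) x l" if d: "\<delta> \<in> H" for \<delta>
  proof -
    obtain c where c: "c \<in> C l" "g = \<delta> \<otimes> c \<otimes> inv \<delta>"
      using g d unfolding restricted_core_def by blast
    have \<delta>: "\<delta> \<in> carrier G" "c \<in> carrier G" "act c x l = x l"
      using d c by (auto simp: H_def chain)
    then have "act g (act (inv \<delta>) x) = act (inv \<delta>) (act c x)"
      using c base by (simp add: act_mult act_closed act_inv')
    then show ?thesis
      using \<delta> c base act_level[of "inv \<delta>" "act c x" x l] act_closed by simp
  qed
  have gG: "g \<in> carrier G" using *[OF H1] by simp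
  have "act g v l = v l" if v: "v \<in> V" for v
  proof -
    obtain \<delta> where \<delta>: "\<delta> \<in> carrier G" "act \<delta> x \<in> V" "act \<delta> x l = v l"
      using V_transitive[OF v] by blast
    then have "\<delta> \<in> H" by (simp add: H_def)
    then have "inv \<delta> \<in> H"
      using subgroup_H subgroup.m_inv_closed by metis
    then have "act g (act \<delta> x) l = act \<delta> x l"
      using *[of "inv \<delta>"] \<delta> by simp
    then show ?thesis
      using act_level[of g "act \<delta> x" v l] gG \<delta> v V_subset act_closed base by auto
  qed
  then show "g \<in> pointwise_stabilizer V l"
    using gG by (simp add: pointwise_stabilizer_def)
next
  fix g assume g: "g \<in> pointwise_stabilizer V l"
  then have gG: "g \<in> carrier G" by (simp add: pointwise_stabilizer_def)
  have "g \<in> (\<lambda>c. \<delta> \<otimes> c \<otimes> inv \<delta>) ` C l" if \<delta>: "\<delta> \<in> H" for \<delta>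
  proof -
    have \<delta>G: "\<delta> \<in> carrier G" "inv \<delta> \<in> H"
      using \<delta> subgroup.m_inv_closed[OF subgroup_H] unfolding H_def by blast+
    then have "act g (act (inv \<delta>) x) l = act (inv \<delta>) x l"
      using g act_V[of "inv \<delta>" x] V_base by (simp add: pointwise_stabilizer_def)
    then have "act \<delta> (act g (act (inv \<delta>) x)) l = x l"
      using act_level[of \<delta> "act g (act (inv \<delta>) x)" "act (inv \<delta>) x" l] \<delta>G gG base
      by (simp add: act_closed act_inv')
    then have "inv \<delta> \<otimes> g \<otimes> \<delta> \<in> C l"
      using \<delta>G gG base by (simp add: chain act_mult act_closed)
    moreover have "g = \<delta> \<otimes> (inv \<delta> \<otimes> g \<otimes> \<delta>) \<otimes> inv \<delta>"
      using \<delta>G gG by (simp add: m_assoc) (simp flip: m_assoc)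
    ultimately show ?thesis by blast
  qed
  then show "g \<in> restricted_core G C H l"
    unfolding restricted_core_def by blast
qed

text \<open>This is the least positive exponent whose power of \<open>\<gamma>\<close> fixes
  coordinate \<open>l\<close> of all points of \<open>V\<close>; it makes sense for elements outside
  \<open>H\<close> too.\<close>

definition orbit_order :: "'a \<Rightarrow> nat \<Rightarrow> nat" where
  "orbit_order \<gamma> l = card (rcosets\<^bsub>G\<lparr>carrier := generate G {\<gamma>}\<rparr>\<^esub>
      (generate G {\<gamma>} \<inter> pointwise_stabilizer V l))"

lemma restricted_steinitz_order_eq:
  "restricted_steinitz_order G C H \<gamma> = steinitz_lcm (orbit_order \<gamma> ` {l. l > 0})"
  unfolding restricted_steinitz_order_def restricted_core_eq orbit_order_def ..

lemma ex_pow_pointwise_stabilizer: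
  assumes \<gamma>: "\<gamma> \<in> carrier G"
  shows "\<exists>m>0. \<gamma> [^] (m::nat) \<in> pointwise_stabilizer V l"
proof -
  \<comment> \<open>\<open>V\<close> need not be invariant under \<open>\<gamma>\<close>, so the pigeonhole argument runs on all of \<open>\<Phi>\<close>.\<close>
  let ?F = "(\<lambda>z. z l) ` \<Phi>"
  define \<pi> where "\<pi> i = (\<lambda>y\<in>?F. act (\<gamma> [^] (i::nat)) (SOME z. z \<in> \<Phi> \<and> z l = y) l)" for i
  have \<pi>: "\<pi> i (z l) = act (\<gamma> [^] i) z l" if "z \<in> \<Phi>" for i z
  proof -
    define w where "w = (SOME w. w \<in> \<Phi> \<and> w l = z l)"
    have "w \<in> \<Phi> \<and> w l = z l"
      unfolding w_def by (rule someI[of _ z]) (use that in simp)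
    then show ?thesis
      unfolding \<pi>_def using that act_level[of "\<gamma> [^] i" w z l] \<gamma> by (simp flip: w_def)
  qed
  have "range \<pi> \<subseteq> ?F \<rightarrow>\<^sub>E ?F"
  proof (intro image_subsetI PiE_I)
    fix i y assume "y \<in> ?F"
    then obtain z where "z \<in> \<Phi>" "y = z l" by blast
    then show "\<pi> i y \<in> ?F"
      using \<pi>[of z i] act_closed[of "\<gamma> [^] i" z] \<gamma> by auto
  qed (simp add: \<pi>_def)
  moreover have "finite (?F \<rightarrow>\<^sub>E ?F)"
    using finite_level by (intro finite_PiE) auto
  ultimately have "\<not> inj \<pi>"
    using finite_imageD finite_subset infinite_UNIV_nat by blast
  then obtain i j :: nat where ij: "i < j" "\<pi> i = \<pi> j"
    unfolding inj_def by (metis linorder_neqE_nat)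
  have "\<gamma> [^] (j - i) \<in> pointwise_stabilizer V l"
    unfolding pointwise_stabilizer_def
  proof (intro CollectI conjI ballI)
    fix v assume "v \<in> V"
    then have v: "v \<in> \<Phi>" using V_subset by blast
    \<comment> \<open>\<open>\<gamma> [^] i\<close> is injective on coordinates at level
      \<open>l\<close>. Cancelling it turns the coincidence of two powers into one power that fixes
      these coordinates.\<close>
    have "act (\<gamma> [^] i) (act (\<gamma> [^] (j - i)) v) = act (\<gamma> [^] j) v"
      using ij \<gamma> v by (simp flip: act_mult add: nat_pow_mult)
    then have "act (\<gamma> [^] i) (act (\<gamma> [^] (j - i)) v) l = act (\<gamma> [^] i) v l"
      using \<pi>[OF v] ij by metis
    then show "act (\<gamma> [^] (j - i)) v l = v l"
      using act_level_iff[of "\<gamma> [^] i" "act (\<gamma> [^] (j - i)) v" v l] v \<gamma> act_closed by simp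
  qed (use \<gamma> in simp)
  then show ?thesis using ij by (intro exI[of _ "j - i"]) simp
qed

lemma orbit_order_pos: "\<gamma> \<in> carrier G \<Longrightarrow> orbit_order \<gamma> l > 0"
  and pow_pointwise_stabilizer_iff: "\<gamma> \<in> carrier G \<Longrightarrow>
      \<gamma> [^] (i::nat) \<in> pointwise_stabilizer V l \<longleftrightarrow> orbit_order \<gamma> l dvd i"
proof -
  assume \<gamma>: "\<gamma> \<in> carrier G"
  then obtain m :: nat where m: "m > 0" "\<gamma> [^] m \<in> pointwise_stabilizer V l"
    using ex_pow_pointwise_stabilizer by blast
  note * = card_rcosets_cyclic[OF subgroup_pointwise_stabilizer[OF V_subset] \<gamma> m, folded orbit_order_def]
  show "orbit_order \<gamma> l > 0"
    by (rule *(1))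
  show "\<gamma> [^] (i::nat) \<in> pointwise_stabilizer V l \<longleftrightarrow> orbit_order \<gamma> l dvd i"
    by (rule *(2))
qed

lemma zero_notin_orbit_orders: "\<gamma> \<in> carrier G \<Longrightarrow> 0 \<notin> orbit_order \<gamma> ` L"
  using orbit_order_pos by (metis imageE less_irrefl)

text \<open>Deeper coordinates determine shallower ones, so stabilizers shrink with the level. A
  level can thus be replaced by a larger one, in particular by a positive one, as the least common
  multiple runs over \<open>l > 0\<close>.\<close>

lemma orbit_order_mono:
  assumes "\<gamma> \<in> carrier G" "l \<le> m"
  shows "orbit_order \<gamma> l dvd orbit_order \<gamma> m"
proof -
  have "\<gamma> [^] orbit_order \<gamma> m \<in> pointwise_stabilizer V m"
    using assms by (simp add: pow_pointwise_stabilizer_iff)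
  then have "\<gamma> [^] orbit_order \<gamma> m \<in> pointwise_stabilizer V l"
    using level_antimono[OF _ _ \<open>l \<le> m\<close>] V_subset act_closed
    unfolding pointwise_stabilizer_def by blast
  then show ?thesis
    using assms by (simp add: pow_pointwise_stabilizer_iff)
qed

text \<open>At each level the order of \<open>\<gamma> [^] r\<close> divides that of
  \<open>\<gamma>\<close>, which divides \<open>r\<close> times the order of
  \<open>\<gamma> [^] r\<close>. The factor \<open>r\<close> does not depend on the level, so it
  survives the least common multiple as one integer.\<close>

lemma steinitz_type_pow:
  assumes \<gamma>: "\<gamma> \<in> carrier G" and r: "r > 0"
  shows "steinitz_type (restricted_steinitz_order G C H (\<gamma> [^] (r::nat))) =
    steinitz_type (restricted_steinitz_order G C H \<gamma>)"
proof (rule steinitz_type_eqI, rule asymptotically_equivalentI_bounded[of r])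
  have \<gamma>r: "\<gamma> [^] r \<in> carrier G" using \<gamma> by simp
  have 1: "orbit_order (\<gamma> [^] r) l dvd orbit_order \<gamma> l" for l
  proof -
    have "\<gamma> [^] (r * orbit_order \<gamma> l) \<in> pointwise_stabilizer V l"
      using \<gamma> by (simp add: pow_pointwise_stabilizer_iff)
    then show ?thesis
      using \<gamma> \<gamma>r pow_pointwise_stabilizer_iff[OF \<gamma>r] by (simp add: nat_pow_pow)
  qed
  have 2: "orbit_order \<gamma> l dvd r * orbit_order (\<gamma> [^] r) l" for l
  proof -
    have "(\<gamma> [^] r) [^] orbit_order (\<gamma> [^] r) l \<in> pointwise_stabilizer V l"
      using \<gamma>r by (simp add: pow_pointwise_stabilizer_iff)
    then show ?thesis
      using \<gamma> pow_pointwise_stabilizer_iff[OF \<gamma>] by (simp add: nat_pow_pow)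
  qed
  fix p :: nat assume p: "prime p"
  show "exponent (restricted_steinitz_order G C H (\<gamma> [^] r)) p
      \<le> exponent (restricted_steinitz_order G C H \<gamma>) p"
    unfolding restricted_steinitz_order_eq
    by (rule steinitz_lcm_mono) (use 1 p zero_notin_orbit_orders[OF \<gamma>] in auto)
  show "exponent (restricted_steinitz_order G C H \<gamma>) p
      \<le> enat (multiplicity p r) + exponent (restricted_steinitz_order G C H (\<gamma> [^] r)) p"
    unfolding restricted_steinitz_order_eq exponent_steinitz_lcm using p
  proof (simp add: image_image, intro SUP_least)
    fix l :: nat assume l: "l \<in> {l. 0 < l}"
    have "multiplicity p (orbit_order \<gamma> l) \<le> multiplicity p (r * orbit_order (\<gamma> [^] r) l)"
      using 2 r orbit_order_pos[OF \<gamma>r] by (intro dvd_imp_multiplicity_le) auto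
    also have "\<dots> = multiplicity p r + multiplicity p (orbit_order (\<gamma> [^] r) l)"
      using p r orbit_order_pos[OF \<gamma>r, of l] by (subst prime_elem_multiplicity_mult_distrib) auto
    finally have "enat (multiplicity p (orbit_order \<gamma> l))
        \<le> enat (multiplicity p r) + enat (multiplicity p (orbit_order (\<gamma> [^] r) l))"
      by simp
    also have "\<dots> \<le> enat (multiplicity p r) +
        (SUP l\<in>{l. 0 < l}. enat (multiplicity p (orbit_order (\<gamma> [^] r) l)))"
      using l by (intro add_left_mono SUP_upper) auto
    finally show "enat (multiplicity p (orbit_order \<gamma> l)) \<le> enat (multiplicity p r) +
        (SUP l\<in>{l. 0 < l}. enat (multiplicity p (orbit_order (\<gamma> [^] r) l)))" .
  qed
qed (use r in simp)

text \<open>Every element has a positive power in the finite index subgroup \<open>H\<close>, and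
  this power has the same type. Elements of \<open>H\<close> act on \<open>V\<close>, so they are
  the ones that can be matched with elements of another action.\<close>

lemma restricted_typeset_eq:
  "restricted_typeset G C H = (\<lambda>\<gamma>. steinitz_type (restricted_steinitz_order G C H \<gamma>)) ` H"
proof (intro equalityI subsetI)
  fix t assume "t \<in> restricted_typeset G C H"
  then obtain \<gamma> where \<gamma>: "\<gamma> \<in> carrier G" "t = steinitz_type (restricted_steinitz_order G C H \<gamma>)"
    unfolding restricted_typeset_def by blast
  then obtain r :: nat where "r > 0" "\<gamma> [^] r \<in> H"
    using ex_pow_in_finite_index[OF subgroup_H finite_rcosets_H] by blast
  then show "t \<in> (\<lambda>\<gamma>. steinitz_type (restricted_steinitz_order G C H \<gamma>)) ` H"
    using \<gamma> steinitz_type_pow by (intro image_eqI[of _ _ "\<gamma> [^] r"]) auto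
next
  fix t assume "t \<in> (\<lambda>\<gamma>. steinitz_type (restricted_steinitz_order G C H \<gamma>)) ` H"
  then show "t \<in> restricted_typeset G C H"
    unfolding restricted_typeset_def H_def by blast
qed

end

text \<open>\<open>s\<close> intertwines \<open>\<gamma>\<close> with \<open>\<gamma>'\<close>,
  hence also their powers. If a power of \<open>\<gamma>'\<close> fixes coordinate \<open>l'\<close>
  of every \<open>s a\<close>, the assumption on \<open>l'\<close> brings this back to coordinate
  \<open>l\<close> of \<open>a\<close>.\<close>

lemma (in adapted_action) orbit_order_dvd:
  fixes s :: "(nat \<Rightarrow> 'c) \<Rightarrow> nat \<Rightarrow> 'd"
  assumes A': "adapted_action G' C' \<Phi>' act' x' (s ` V)"
    and l': "\<And>a b. a \<in> V \<Longrightarrow> b \<in> V \<Longrightarrow> s a l' = s b l' \<Longrightarrow> a l = b l"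
    and \<gamma>: "\<gamma> \<in> H" "\<gamma>' \<in> carrier G'"
    and equi: "\<And>a. a \<in> V \<Longrightarrow> s (act \<gamma> a) = act' \<gamma>' (s a)"
  shows "orbit_order \<gamma> l dvd adapted_action.orbit_order G' act' (s ` V) \<gamma>' l'"
proof -
  interpret A': adapted_action G' C' \<Phi>' act' x' "s ` V" by fact
  define n where "n = A'.orbit_order \<gamma>' l'"
  have pow: "\<gamma> [^] (i::nat) \<in> H \<and> (\<forall>a\<in>V. s (act (\<gamma> [^] i) a) = act' (\<gamma>' [^]\<^bsub>G'\<^esub> i) (s a))" for i
  proof (induction i)
    case 0
    then show ?case
      using subgroup.one_closed[OF subgroup_H] V_subset A'.V_subset
      by (auto simp: act_one A'.act_one subset_eq)
  next
    case (Suc i)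
    have "\<gamma> [^] Suc i \<in> H"
      using Suc subgroup.m_closed[OF subgroup_H] \<gamma> by simp
    moreover have "s (act (\<gamma> [^] Suc i) a) = act' (\<gamma>' [^]\<^bsub>G'\<^esub> Suc i) (s a)" if "a \<in> V" for a
    proof -
      have "\<gamma> [^] i \<in> carrier G" "\<gamma> \<in> carrier G"
        using Suc \<gamma> by (auto simp: H_def)
      moreover have "act (\<gamma> [^] i) a \<in> V" using Suc that act_V by blast
      moreover have "s a \<in> \<Phi>'" using A'.V_subset that by blast
      ultimately show ?thesis
        using Suc equi \<gamma> that V_subset by (simp add: act_mult A'.act_mult subset_eq)
    qed
    ultimately show ?case by blast
  qed
  have "\<gamma>' [^]\<^bsub>G'\<^esub> n \<in> A'.pointwise_stabilizer (s ` V) l'"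
    using \<gamma> by (simp add: A'.pow_pointwise_stabilizer_iff n_def)
  then have eq: "s (act (\<gamma> [^] n) a) l' = s a l'" if "a \<in> V" for a
    using pow[of n] that by (simp add: A'.pointwise_stabilizer_def)
  have "act (\<gamma> [^] n) a l = a l" if "a \<in> V" for a
    by (rule l') (use eq[OF that] act_V[of "\<gamma> [^] n" a] pow[of n] that in simp_all)
  then have "\<gamma> [^] n \<in> pointwise_stabilizer V l"
    using pow[of n] by (simp add: pointwise_stabilizer_def H_def)
  then show ?thesis
    using \<gamma> by (simp add: pow_pointwise_stabilizer_iff H_def n_def)
qed


text \<open>The algebraic criterion to be met by the geometry. The two \<open>levels\<close>
  assumptions are uniform continuity of \<open>s\<close> and of its inverse, expressed in
  coordinates.\<close>

theorem typesets_commensurable_of_adapted_actions: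
  fixes G :: "('g, 'b) monoid_scheme" and G' :: "('h, 'd) monoid_scheme"
    and \<Phi> V :: "(nat \<Rightarrow> 'c) set" and \<Phi>' :: "(nat \<Rightarrow> 'e) set"
  assumes A: "adapted_action G C \<Phi> act x V"
    and A': "adapted_action G' C' \<Phi>' act' x' (s ` V)"
    and levels: "\<And>l'. \<exists>l. \<forall>a\<in>V. \<forall>b\<in>V. a l = b l \<longrightarrow> s a l' = s b l'"
    and levels': "\<And>l. \<exists>l'. \<forall>a\<in>V. \<forall>b\<in>V. s a l' = s b l' \<longrightarrow> a l = b l"
    and transfer: "\<And>g. g \<in> carrier G \<Longrightarrow> (\<forall>a\<in>V. act g a \<in> V) \<Longrightarrow>
        \<exists>g'\<in>carrier G'. \<forall>a\<in>V. s (act g a) = act' g' (s a)"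
    and transfer': "\<And>g'. g' \<in> carrier G' \<Longrightarrow> (\<forall>a\<in>V. act' g' (s a) \<in> s ` V) \<Longrightarrow>
        \<exists>g\<in>carrier G. \<forall>a\<in>V. act g a \<in> V \<and> s (act g a) = act' g' (s a)"
  shows "typesets_commensurable G C G' C'"
proof -
  interpret A: adapted_action G C \<Phi> act x V by fact
  interpret A': adapted_action G' C' \<Phi>' act' x' "s ` V" by fact
  have inj: "a = b" if "a \<in> V" "b \<in> V" "s a = s b" for a b
    using levels' that by (metis ext)
  \<comment> \<open>The reverse divisibility is an instance of the same lemma for the inverse of
    \<open>s\<close>, which presents \<open>V\<close> as an image of the second adapted set.\<close>
  define r where "r = inv_into V s"
  have r: "r (s a) = a" if "a \<in> V" for a
    unfolding r_def by (rule inv_into_f_f) (use inj that in \<open>auto simp: inj_on_def\<close>)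
  then have rV: "r ` s ` V = V"
    by (force simp: image_image)
  have types: "steinitz_type (restricted_steinitz_order G C A.H \<gamma>)
      = steinitz_type (restricted_steinitz_order G' C' A'.H \<gamma>')"
    if \<gamma>: "\<gamma> \<in> A.H" "\<gamma>' \<in> A'.H" and equi: "\<And>a. a \<in> V \<Longrightarrow> s (act \<gamma> a) = act' \<gamma>' (s a)"
    for \<gamma> \<gamma>'
  proof -
    have carr: "\<gamma> \<in> carrier G" "\<gamma>' \<in> carrier G'"
      using \<gamma> by (simp_all add: A.H_def A'.H_def)
    have 1: "\<exists>l'>0. A.orbit_order \<gamma> l dvd A'.orbit_order \<gamma>' l'" for l
    proof -
      obtain l' where "\<forall>a\<in>V. \<forall>b\<in>V. s a l' = s b l' \<longrightarrow> a l = b l"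
        using levels' by blast
      then have "A.orbit_order \<gamma> l dvd A'.orbit_order \<gamma>' l'"
        using A.orbit_order_dvd[OF A', of l' l \<gamma> \<gamma>'] \<gamma> carr equi by blast
      \<comment> \<open>\<open>l'\<close> may be \<open>0\<close>, while the least common multiple
        uses positive levels.\<close>
      also have "\<dots> dvd A'.orbit_order \<gamma>' (Suc l')"
        by (rule A'.orbit_order_mono) (use carr in auto)
      finally show ?thesis by blast
    qed
    have 2: "\<exists>l>0. A'.orbit_order \<gamma>' l' dvd A.orbit_order \<gamma> l" for l'
    proof -
      obtain l where l: "\<forall>a\<in>V. \<forall>b\<in>V. a l = b l \<longrightarrow> s a l' = s b l'"
        using levels by blast
      have "A'.orbit_order \<gamma>' l' dvd adapted_action.orbit_order G act (r ` s ` V) \<gamma> l"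
      proof (rule A'.orbit_order_dvd)
        show "adapted_action G C \<Phi> act x (r ` s ` V)"
          using A by (simp only: rV)
        fix b assume "b \<in> s ` V"
        then show "r (act' \<gamma>' b) = act \<gamma> (r b)"
          using r equi A.act_V \<gamma> by (metis imageE)
      next
        fix b c assume "b \<in> s ` V" "c \<in> s ` V" "r b l = r c l"
        moreover from calculation obtain a d where "a \<in> V" "b = s a" "d \<in> V" "c = s d"
          by blast
        ultimately show "b l' = c l'"
          using l r by metis
      qed (use \<gamma> carr in simp_all)
      also have "\<dots> = A.orbit_order \<gamma> l" by (simp only: rV)
      also have "\<dots> dvd A.orbit_order \<gamma> (Suc l)"
        by (rule A.orbit_order_mono) (use carr in auto)
      finally show ?thesis by blast
    qed
    have "restricted_steinitz_order G C A.H \<gamma> = restricted_steinitz_order G' C' A'.H \<gamma>'"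
      unfolding A.restricted_steinitz_order_eq A'.restricted_steinitz_order_eq
    proof (intro steinitz_eqI antisym steinitz_lcm_mono)
      fix a assume "a \<in> A.orbit_order \<gamma> ` {l. 0 < l}"
      then show "\<exists>b\<in>A'.orbit_order \<gamma>' ` {l. 0 < l}. a dvd b"
        using 1 by blast
    next
      fix a assume "a \<in> A'.orbit_order \<gamma>' ` {l. 0 < l}"
      then show "\<exists>b\<in>A.orbit_order \<gamma> ` {l. 0 < l}. a dvd b"
        using 2 by blast
    qed (use carr A.zero_notin_orbit_orders A'.zero_notin_orbit_orders in simp_all)
    then show ?thesis by simp
  qed
  have "restricted_typeset G C A.H = restricted_typeset G' C' A'.H"
    unfolding A.restricted_typeset_eq A'.restricted_typeset_eq
  proof (intro equalityI image_subsetI)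
    fix \<gamma> assume \<gamma>: "\<gamma> \<in> A.H"
    then have V: "\<gamma> \<in> carrier G" "\<forall>a\<in>V. act \<gamma> a \<in> V"
      using A.act_V unfolding A.H_def by blast+
    then obtain \<gamma>' where \<gamma>': "\<gamma>' \<in> carrier G'" "\<forall>a\<in>V. s (act \<gamma> a) = act' \<gamma>' (s a)"
      using transfer by blast
    \<comment> \<open>The point sent to \<open>x'\<close> need not be \<open>x\<close>, so
      membership in \<open>A'.H\<close> is tested through whichever \<open>a\<close> is sent
      there.\<close>
    obtain a where "a \<in> V" "x' = s a"
      using A'.V_base by blast
    then have "act' \<gamma>' x' \<in> s ` V"
      using V(2) \<gamma>'(2) by (metis imageI)
    then have "\<gamma>' \<in> A'.H"
      unfolding A'.H_def using \<gamma>'(1) by blast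
    then show "steinitz_type (restricted_steinitz_order G C A.H \<gamma>)
        \<in> (\<lambda>\<gamma>. steinitz_type (restricted_steinitz_order G' C' A'.H \<gamma>)) ` A'.H"
      by (intro image_eqI[of _ _ \<gamma>'] types) (use \<gamma> \<gamma>' in simp_all)
  next
    fix \<gamma>' assume \<gamma>': "\<gamma>' \<in> A'.H"
    then have "\<gamma>' \<in> carrier G'" "\<forall>a\<in>V. act' \<gamma>' (s a) \<in> s ` V"
      using A'.act_V unfolding A'.H_def by blast+
    then obtain \<gamma> where \<gamma>: "\<gamma> \<in> carrier G" "\<forall>a\<in>V. act \<gamma> a \<in> V \<and> s (act \<gamma> a) = act' \<gamma>' (s a)"
      using transfer' by blast
    then have "\<gamma> \<in> A.H"
      using A.V_base by (simp add: A.H_def)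
    then show "steinitz_type (restricted_steinitz_order G' C' A'.H \<gamma>')
        \<in> (\<lambda>\<gamma>. steinitz_type (restricted_steinitz_order G C A.H \<gamma>)) ` A.H"
      by (intro image_eqI[of _ _ \<gamma>] types[symmetric]) (use \<gamma> \<gamma>' in simp_all)
  qed
  then show ?thesis
    unfolding typesets_commensurable_def
    using A.subgroup_H A.finite_rcosets_H A.ex_chain_subset_H
      A'.subgroup_H A'.finite_rcosets_H A'.ex_chain_subset_H by blast
qed

section \<open>Lifting through covering spaces\<close>

text \<open>The union of the sheets not containing \<open>y\<close> is recorded as open: it
  separates two lifts that disagree, in place of a Hausdorff condition on \<open>N\<close>.\<close>

lemma covering_space_sheet:
  assumes "covering_space N p M" "y \<in> N"
  obtains T U r where "openin (top_of_set M) T" "p y \<in> T" "openin (top_of_set N) U" "y \<in> U"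
    "homeomorphism U T p r"
    "openin (top_of_set N) (N \<inter> p -` T - U)"
proof -
  have "p y \<in> M"
    using assms covering_space_imp_surjective by blast
  then obtain T \<V> where T: "openin (top_of_set M) T" "p y \<in> T" "\<Union>\<V> = N \<inter> p -` T"
    "\<forall>u\<in>\<V>. openin (top_of_set N) u" "pairwise disjnt \<V>" "\<forall>u\<in>\<V>. \<exists>q. homeomorphism u T p q"
    using assms unfolding covering_space_def by metis
  then obtain U where U: "U \<in> \<V>" "y \<in> U"
    using \<open>y \<in> N\<close> by blast
  then obtain r where r: "homeomorphism U T p r" using T by blast
  have "N \<inter> p -` T - U = \<Union>(\<V> - {U})"
  proof -
    have "V \<inter> U = {}" if "V \<in> \<V> - {U}" for V
      using T(5) that U unfolding pairwise_def disjnt_def by blast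
    then have "\<Union>(\<V> - {U}) \<inter> U = {}" by blast
    moreover have "\<Union>\<V> = \<Union>(\<V> - {U}) \<union> U" using U(1) by blast
    ultimately show ?thesis
      unfolding T(3)[symmetric] by blast
  qed
  moreover have "openin (top_of_set N) (\<Union>(\<V> - {U}))"
    using T(4) by (intro openin_Union) blast
  ultimately show ?thesis
    using that[OF T(1,2) _ U(2) r] T(4) U by auto
qed

lemma openin_preimage:
  assumes "continuous_on S f" "f ` S \<subseteq> T" "openin (top_of_set T) U"
  shows "openin (top_of_set S) (S \<inter> f -` U)"
  using assms continuous_on_open_gen[of f S T] by (auto simp: image_subset_iff_funcset)

text \<open>The set of agreement is open because \<open>p\<close> is injective on a sheet. So is its
  complement, because distinct points over one point lie in different sheets, and these are
  disjoint.\<close>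

lemma covering_space_unique_lift:
  fixes f g :: "'c::topological_space \<Rightarrow> 'a::topological_space"
  assumes cov: "covering_space N p M" and "connected S"
    and f: "continuous_on S f" "f ` S \<subseteq> N" and g: "continuous_on S g" "g ` S \<subseteq> N"
    and eq: "\<And>z. z \<in> S \<Longrightarrow> p (f z) = p (g z)"
    and a: "a \<in> S" "f a = g a" and "z \<in> S"
  shows "f z = g z"
proof -
  have op: "openin (top_of_set S) {z \<in> S. f z = g z}"
  proof (subst openin_subopen, intro ballI)
    fix z assume z: "z \<in> {z \<in> S. f z = g z}"
    then have "f z \<in> N" using f by blast
    then obtain T U r where U: "openin (top_of_set N) U" "f z \<in> U" "homeomorphism U T p r"
      using covering_space_sheet[OF cov, of "f z"] by metis
    let ?W = "(S \<inter> f -` U) \<inter> (S \<inter> g -` U)"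
    have "openin (top_of_set S) ?W"
      by (intro openin_Int openin_preimage[OF f U(1)] openin_preimage[OF g U(1)])
    moreover have "?W \<subseteq> {z \<in> S. f z = g z}"
    proof
      fix w assume w: "w \<in> ?W"
      then have "r (p (f w)) = r (p (g w))" using eq by simp
      then show "w \<in> {z \<in> S. f z = g z}"
        using w homeomorphism_apply1[OF U(3)] by auto
    qed
    ultimately show "\<exists>W. openin (top_of_set S) W \<and> z \<in> W \<and> W \<subseteq> {z \<in> S. f z = g z}"
      using z U by (intro exI[of _ ?W]) auto
  qed
  have cl: "openin (top_of_set S) {z \<in> S. f z \<noteq> g z}"
  proof (subst openin_subopen, intro ballI)
    fix z assume z: "z \<in> {z \<in> S. f z \<noteq> g z}"
    then have "f z \<in> N" "g z \<in> N" using f g by blast+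
    then obtain T U r where U: "openin (top_of_set N) U" "f z \<in> U" "homeomorphism U T p r" "p (f z) \<in> T"
        "openin (top_of_set N) (N \<inter> p -` T - U)"
      using covering_space_sheet[OF cov, of "f z"] by metis
    have "g z \<notin> U"
      using z U eq homeomorphism_apply1[OF U(3)] by (metis (mono_tags, lifting) mem_Collect_eq)
    then have "g z \<in> N \<inter> p -` T - U"
      using U z eq \<open>g z \<in> N\<close> by auto
    let ?W = "(S \<inter> f -` U) \<inter> (S \<inter> g -` (N \<inter> p -` T - U))"
    have "openin (top_of_set S) ?W"
      by (intro openin_Int openin_preimage[OF f U(1)] openin_preimage[OF g U(5)])
    then show "\<exists>W. openin (top_of_set S) W \<and> z \<in> W \<and> W \<subseteq> {z \<in> S. f z \<noteq> g z}"
      using z U \<open>g z \<in> N \<inter> p -` T - U\<close> by (intro exI[of _ ?W]) auto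
  qed
  have "S - {z \<in> S. f z = g z} = {z \<in> S. f z \<noteq> g z}" by blast
  then have "closedin (top_of_set S) {z \<in> S. f z = g z}"
    using cl unfolding closedin_def by auto
  then have "{z \<in> S. f z = g z} = {} \<or> {z \<in> S. f z = g z} = S"
    using op \<open>connected S\<close> unfolding connected_clopen by blast
  then show ?thesis using a \<open>z \<in> S\<close> by blast
qed

section \<open>Lifting paths and homotopies\<close>

text \<open>Every admissible value at every point of \<open>R\<close> is allowed as a start, so that
  a lift on one piece can be continued on another from whatever value it has reached.\<close>

definition liftable ::
  "'a::topological_space set \<Rightarrow> ('a \<Rightarrow> 'b) \<Rightarrow> ('c::topological_space \<Rightarrow> 'b) \<Rightarrow> 'c set \<Rightarrow> bool" where
  "liftable N p f R \<longleftrightarrow> (\<forall>z\<in>R. \<forall>y\<in>N. p y = f z \<longrightarrow>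
     (\<exists>g. continuous_on R g \<and> g ` R \<subseteq> N \<and> (\<forall>w\<in>R. p (g w) = f w) \<and> g z = y))"

lemma liftableE:
  assumes "liftable N p f R" "z \<in> R" "y \<in> N" "p y = f z"
  obtains g where "continuous_on R g" "g ` R \<subseteq> N" "\<And>w. w \<in> R \<Longrightarrow> p (g w) = f w" "g z = y"
  using assms unfolding liftable_def by blast

text \<open>The second lift is started at the value of the first at a common point. Uniqueness on
  the connected intersection makes them agree there, and closedness of both pieces makes the pasted
  map continuous.\<close>

lemma liftable_glue:
  assumes cov: "covering_space N p M" and R: "closed R" "closed R'" "connected (R \<inter> R')" "R \<inter> R' \<noteq> {}"
    and lift: "liftable N p f R" "liftable N p f R'"
  shows "liftable N p f (R \<union> R')"
proof -
  have main: "\<exists>g. continuous_on (R \<union> R') g \<and> g ` (R \<union> R') \<subseteq> N \<and> (\<forall>w\<in>R \<union> R'. p (g w) = f w) \<and> g z = y"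
    if R: "closed R" "closed R'" "connected (R \<inter> R')" "R \<inter> R' \<noteq> {}"
    and lift: "liftable N p f R" "liftable N p f R'"
    and z: "z \<in> R" "y \<in> N" "p y = f z" for R R' z y
  proof -
    obtain g where g: "continuous_on R g" "g ` R \<subseteq> N" "\<And>w. w \<in> R \<Longrightarrow> p (g w) = f w" "g z = y"
      by (rule liftableE[OF lift(1) z]) blast
    obtain b where b: "b \<in> R" "b \<in> R'" using R by blast
    have "g b \<in> N" "p (g b) = f b" using b g by auto
    then obtain h where h: "continuous_on R' h" "h ` R' \<subseteq> N" "\<And>w. w \<in> R' \<Longrightarrow> p (h w) = f w" "h b = g b"
      using liftableE[OF lift(2) b(2)] by metis
    have eq: "g w = h w" if "w \<in> R \<inter> R'" for w
    proof (rule covering_space_unique_lift[OF cov, where S = "R \<inter> R'" and a = b])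
      show "continuous_on (R \<inter> R') g" "continuous_on (R \<inter> R') h"
        by (rule continuous_on_subset[OF g(1)], simp) (rule continuous_on_subset[OF h(1)], simp)
      show "g ` (R \<inter> R') \<subseteq> N" "h ` (R \<inter> R') \<subseteq> N" using g(2) h(2) by blast+
      show "p (g z) = p (h z)" if "z \<in> R \<inter> R'" for z using g(3) h(3) that by simp
    qed (use h(4) b that R(3) in simp_all)
    let ?g = "\<lambda>w. if w \<in> R then g w else h w"
    have "continuous_on (R \<union> R') ?g"
      by (rule continuous_on_If) (use R g h eq in auto)
    moreover have "?g ` (R \<union> R') \<subseteq> N"
      using g h by auto
    ultimately show ?thesis
      using g h z by (intro exI[of _ ?g]) auto
  qed
  show ?thesis
    unfolding liftable_def
  proof (intro ballI impI)
    fix z y assume *: "z \<in> R \<union> R'" "y \<in> N" "p y = f z"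
    then consider "z \<in> R" | "z \<in> R'" by blast
    then show "\<exists>g. continuous_on (R \<union> R') g \<and> g ` (R \<union> R') \<subseteq> N \<and> (\<forall>w\<in>R \<union> R'. p (g w) = f w) \<and> g z = y"
    proof cases
      case 1
      show ?thesis by (rule main[OF R lift 1 *(2,3)])
    next
      case 2
      have "connected (R' \<inter> R)" "R' \<inter> R \<noteq> {}" using R(3,4) by (simp_all add: Int_commute)
      from main[OF R(2,1) this lift(2,1) 2 *(2,3)] show ?thesis by (simp only: Un_commute)
    qed
  qed
qed

lemma liftable_sheet:
  assumes f: "continuous_on R f" "f ` R \<subseteq> T"
    and \<V>: "\<Union>\<V> = N \<inter> p -` T" "\<forall>u\<in>\<V>. \<exists>q. homeomorphism u T p q"
  shows "liftable N p f R"
  unfolding liftable_def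
proof (intro ballI impI)
  fix z y assume z: "z \<in> R" "y \<in> N" "p y = f z"
  then have "y \<in> \<Union>\<V>" using f \<V> by auto
  then obtain u q where u: "u \<in> \<V>" "y \<in> u" "homeomorphism u T p q" using \<V> by blast
  have "continuous_on R (q \<circ> f)"
    using f u(3) by (intro continuous_on_compose) (auto simp: homeomorphism_def intro: continuous_on_subset)
  moreover have "q (f w) \<in> N \<and> p (q (f w)) = f w" if "w \<in> R" for w
  proof -
    have "f w \<in> T" using f that by blast
    then show ?thesis
      using u \<V>(1) unfolding homeomorphism_def by blast
  qed
  moreover have "q (f z) = y"
    using u z homeomorphism_apply1 by metis
  ultimately show "\<exists>g. continuous_on R g \<and> g ` R \<subseteq> N \<and> (\<forall>w\<in>R. p (g w) = f w) \<and> g z = y"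
    by (intro exI[of _ "q \<circ> f"]) auto
qed

lemma ex_rectangle_within:
  fixes f :: "real \<times> real \<Rightarrow> 'b::topological_space"
  assumes f: "continuous_on ({0..1} \<times> {0..1}) f" "f ` ({0..1} \<times> {0..1}) \<subseteq> M"
    and st: "s \<in> {0..1}" "t \<in> {0..1}" and T: "openin (top_of_set M) T" "f (s, t) \<in> T"
  obtains d where "d > 0" "\<And>s' t'. s' \<in> {0..1} \<Longrightarrow> t' \<in> {0..1} \<Longrightarrow> \<bar>s' - s\<bar> < d \<Longrightarrow> \<bar>t' - t\<bar> < d \<Longrightarrow> f (s', t') \<in> T"
proof -
  have "openin (top_of_set ({0..1} \<times> {0..1})) (({0..1} \<times> {0..1}) \<inter> f -` T)"
    using openin_preimage[OF f T(1)] .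
  then obtain e where e: "e > 0" "\<And>w. w \<in> {0..1} \<times> {0..1} \<Longrightarrow> dist w (s, t) < e \<Longrightarrow> f w \<in> T"
    using st T(2) unfolding openin_euclidean_subtopology_iff by (metis (no_types, lifting) IntD2 IntI mem_Sigma_iff vimage_eq)
  show ?thesis
  \<comment> \<open>Halving suffices because the distance in the product is at most the sum of the
    coordinate distances.\<close>
  proof (rule that[of "e / 2"])
    fix s' t' assume *: "s' \<in> {0..1}" "t' \<in> {0..1}" "\<bar>s' - s\<bar> < e / 2" "\<bar>t' - t\<bar> < e / 2"
    have "dist (s', t') (s, t) \<le> \<bar>s' - s\<bar> + \<bar>t' - t\<bar>"
      unfolding dist_prod_def dist_real_def using sqrt_sum_squares_le_sum_abs[of "\<bar>s' - s\<bar>" "\<bar>t' - t\<bar>"] by simp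
    then show "f (s', t') \<in> T"
      using * by (intro e(2)) auto
  qed (use e in simp)
qed

text \<open>Bolzano bisection is used twice: in the second coordinate it yields a liftable strip of
  positive width around each \<open>s\<close>, and in the first it joins strips. Neighbouring
  rectangles meet in a segment, hence in a connected set.\<close>

lemma liftable_unit_square:
  fixes f :: "real \<times> real \<Rightarrow> 'b::topological_space"
  assumes cov: "covering_space N p M"
    and f: "continuous_on ({0..1} \<times> {0..1}) f" "f ` ({0..1} \<times> {0..1}) \<subseteq> M"
  shows "liftable N p f ({0..1} \<times> {0..1})"
proof -
  have strip: "\<exists>d>0. \<forall>a b. 0 \<le> a \<and> b \<le> 1 \<and> a \<le> s \<and> s \<le> b \<and> b - a < d \<longrightarrow> liftable N p f ({a..b} \<times> {0..1})"
    if s: "s \<in> {0..1}" for s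
  proof -
    \<comment> \<open>The width \<open>d\<close> is quantified inside the predicate, because gluing
      replaces two widths by their minimum.\<close>
    let ?P = "\<lambda>t t'. 0 \<le> t \<and> t' \<le> 1 \<longrightarrow> (\<exists>d>0. \<forall>a b. 0 \<le> a \<and> b \<le> 1 \<and> a \<le> s \<and> s \<le> b \<and> b - a < d \<longrightarrow> liftable N p f ({a..b} \<times> {t..t'}))"
    have "?P 0 1"
    proof (rule Bolzano[of 0 1 ?P])
      fix t1 t2 t3 :: real assume *: "?P t1 t2" "?P t2 t3" "t1 \<le> t2" "t2 \<le> t3"
      show "?P t1 t3"
      proof
        assume "0 \<le> t1 \<and> t3 \<le> 1"
        then obtain d d' where d: "d > 0" "\<And>a b. 0 \<le> a \<and> b \<le> 1 \<and> a \<le> s \<and> s \<le> b \<and> b - a < d \<Longrightarrow> liftable N p f ({a..b} \<times> {t1..t2})"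
          and d': "d' > 0" "\<And>a b. 0 \<le> a \<and> b \<le> 1 \<and> a \<le> s \<and> s \<le> b \<and> b - a < d' \<Longrightarrow> liftable N p f ({a..b} \<times> {t2..t3})"
          using * by (smt (verit))
        have "liftable N p f ({a..b} \<times> {t1..t3})" if ab: "0 \<le> a \<and> b \<le> 1 \<and> a \<le> s \<and> s \<le> b \<and> b - a < min d d'" for a b
        proof -
          have I: "({a..b} \<times> {t1..t2}) \<inter> ({a..b} \<times> {t2..t3}) = {a..b} \<times> {t2}"
            using * by auto
          have "liftable N p f (({a..b} \<times> {t1..t2}) \<union> ({a..b} \<times> {t2..t3}))"
          proof (rule liftable_glue[OF cov])
            show "closed ({a..b} \<times> {t1..t2})" "closed ({a..b} \<times> {t2..t3})"
              by (intro closed_Times closed_atLeastAtMost)+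
            show "connected ({a..b} \<times> {t1..t2} \<inter> {a..b} \<times> {t2..t3})"
              unfolding I by (intro connected_Times) auto
            show "{a..b} \<times> {t1..t2} \<inter> {a..b} \<times> {t2..t3} \<noteq> {}"
              unfolding I using ab by auto
          qed (use d d' ab in auto)
          moreover have "({a..b} \<times> {t1..t2}) \<union> ({a..b} \<times> {t2..t3}) = {a..b} \<times> {t1..t3}"
            using * by auto
          ultimately show ?thesis by simp
        qed
        then show "\<exists>d>0. \<forall>a b. 0 \<le> a \<and> b \<le> 1 \<and> a \<le> s \<and> s \<le> b \<and> b - a < d \<longrightarrow> liftable N p f ({a..b} \<times> {t1..t3})"
          using d d' by (intro exI[of _ "min d d'"]) auto
      qed
    next
      fix t :: real assume t: "0 \<le> t" "t \<le> 1"
      then have "f (s, t) \<in> M" using f s by auto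
      then obtain T \<V> where T: "openin (top_of_set M) T" "f (s, t) \<in> T" and \<V>: "\<Union>\<V> = N \<inter> p -` T"
          "\<forall>u\<in>\<V>. \<exists>q. homeomorphism u T p q"
        using cov unfolding covering_space_def by metis
      obtain d where d: "d > 0" "\<And>s' t'. s' \<in> {0..1} \<Longrightarrow> t' \<in> {0..1} \<Longrightarrow> \<bar>s' - s\<bar> < d \<Longrightarrow> \<bar>t' - t\<bar> < d \<Longrightarrow> f (s', t') \<in> T"
        using ex_rectangle_within[OF f s _ T] t by (metis atLeastAtMost_iff)
      have "liftable N p f ({a..b} \<times> {t1..t2})"
        if "t1 \<le> t" "t \<le> t2" "t2 - t1 < d" "0 \<le> t1" "t2 \<le> 1" "0 \<le> a" "b \<le> 1" "a \<le> s" "s \<le> b" "b - a < d" for t1 t2 a b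
      proof (rule liftable_sheet[OF _ _ \<V>])
        show "continuous_on ({a..b} \<times> {t1..t2}) f"
          by (rule continuous_on_subset[OF f(1)]) (use that in auto)
        show "f ` ({a..b} \<times> {t1..t2}) \<subseteq> T"
          using that by (auto intro!: d(2))
      qed
      then show "\<exists>d>0. \<forall>t1 t2. t1 \<le> t \<and> t \<le> t2 \<and> t2 - t1 < d \<longrightarrow> ?P t1 t2"
        using d(1) by (intro exI[of _ d]) blast
    qed auto
    then show ?thesis by simp
  qed
  let ?Q = "\<lambda>a b. 0 \<le> a \<and> b \<le> 1 \<longrightarrow> liftable N p f ({a..b} \<times> {0..1})"
  have "?Q 0 1"
  proof (rule Bolzano[of 0 1 ?Q])
    fix a b c :: real assume *: "?Q a b" "?Q b c" "a \<le> b" "b \<le> c"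
    show "?Q a c"
    proof
      assume ac: "0 \<le> a \<and> c \<le> 1"
      have I: "({a..b} \<times> {0..1}) \<inter> ({b..c} \<times> {0..1}) = {b} \<times> {0..1::real}"
        using * by auto
      have "liftable N p f (({a..b} \<times> {0..1}) \<union> ({b..c} \<times> {0..1}))"
      proof (rule liftable_glue[OF cov])
        show "closed ({a..b} \<times> {0..1::real})" "closed ({b..c} \<times> {0..1::real})"
          by (intro closed_Times closed_atLeastAtMost)+
        show "connected ({a..b} \<times> {0..1} \<inter> {b..c} \<times> {0..1::real})"
          unfolding I by (intro connected_Times) auto
        show "{a..b} \<times> {0..1} \<inter> {b..c} \<times> {0..1::real} \<noteq> {}"
          unfolding I by auto
      qed (use * ac in auto)
      moreover have "({a..b} \<times> {0..1::real}) \<union> ({b..c} \<times> {0..1}) = {a..c} \<times> {0..1}"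
        using * by auto
      ultimately show "liftable N p f ({a..c} \<times> {0..1})" by simp
    qed
  next
    fix s :: real assume "0 \<le> s" "s \<le> 1"
    then show "\<exists>d>0. \<forall>a b. a \<le> s \<and> s \<le> b \<and> b - a < d \<longrightarrow> ?Q a b"
      using strip[of s] by (metis atLeastAtMost_iff)
  qed auto
  then show ?thesis by simp
qed

lemma covering_space_path_lift:
  assumes cov: "covering_space N p M" and g: "path g" "path_image g \<subseteq> M"
    and y: "y \<in> N" "p y = pathstart g"
  obtains h where "path h" "path_image h \<subseteq> N" "pathstart h = y" "\<And>t. t \<in> {0..1} \<Longrightarrow> p (h t) = g t"
proof -
  \<comment> \<open>A path is read as a homotopy independent of its first coordinate.\<close>
  have "liftable N p (g \<circ> snd) ({0..1::real} \<times> {0..1::real})"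
  proof (rule liftable_unit_square[OF cov])
    show "continuous_on ({0..1::real} \<times> {0..1::real}) (g \<circ> snd)"
      using g unfolding path_def by (intro continuous_on_compose continuous_intros) (auto elim: continuous_on_subset)
  qed (use g in \<open>auto simp: path_image_def\<close>)
  then obtain k where k: "continuous_on ({0..1::real} \<times> {0..1::real}) k" "k ` ({0..1} \<times> {0..1}) \<subseteq> N"
      "\<And>w. w \<in> {0..1} \<times> {0..1} \<Longrightarrow> p (k w) = (g \<circ> snd) w" "k (0, 0) = y"
    by (rule liftableE[of _ _ _ _ "(0, 0)" y]) (use y in \<open>auto simp: pathstart_def\<close>)
  show ?thesis
  proof (rule that[of "k \<circ> Pair 0"])
    show "path (k \<circ> Pair 0)"
      unfolding path_def by (intro continuous_on_compose continuous_intros continuous_on_subset[OF k(1)]) auto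
  qed (use k in \<open>auto simp: path_image_def pathstart_def\<close>)
qed

text \<open>The conclusion is a homotopy in \<open>N\<close> and not merely equality of end points,
  so that it can serve as the hypothesis for the next covering of a tower.\<close>

lemma covering_space_homotopic_lifts:
  fixes p :: "'a::topological_space \<Rightarrow> 'b::topological_space"
  assumes cov: "covering_space N p M"
    and h: "path h" "path_image h \<subseteq> N" and h': "path h'" "path_image h' \<subseteq> N"
    and start: "pathstart h = pathstart h'"
    and hom: "homotopic_paths M (p \<circ> h) (p \<circ> h')"
  shows "homotopic_paths N h h'"
proof -
  obtain f :: "real \<times> real \<Rightarrow> 'b" where f: "continuous_on ({0..1} \<times> {0..1}) f" "f \<in> {0..1} \<times> {0..1} \<rightarrow> M"
      and f': "\<forall>t\<in>{0..1}. f (0, t) = (p \<circ> h) t" "\<forall>t\<in>{0..1}. f (1, t) = (p \<circ> h') t"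
        "\<forall>s\<in>{0..1}. (f \<circ> Pair s) 0 = (p \<circ> h) 0 \<and> (f \<circ> Pair s) 1 = (p \<circ> h) 1"
    using hom unfolding homotopic_paths pathstart_def pathfinish_def by blast
  note f = f[folded image_subset_iff_funcset]
  have f0: "f (0, t) = p (h t)" and f1: "f (1, t) = p (h' t)" and fs: "f (t, 0) = p (h 0) \<and> f (t, 1) = p (h 1)"
    if "t \<in> {0..1}" for t
    using f' that by simp_all
  have h0: "h 0 \<in> N" "h 1 \<in> N" using h by (auto simp: path_image_def)
  obtain k where k: "continuous_on ({0..1::real} \<times> {0..1::real}) k" "k ` ({0..1} \<times> {0..1}) \<subseteq> N"
      "\<And>w. w \<in> {0..1} \<times> {0..1} \<Longrightarrow> p (k w) = f w" "k (0, 0) = h 0"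
    by (rule liftableE[OF liftable_unit_square[OF cov f], of "(0, 0)" "h 0"]) (use h0 fs[of 0] in auto)
  have cs: "continuous_on {0..1} (\<lambda>t. k (s, t))" if "s \<in> {0..1}" for s
    by (rule continuous_on_compose2[OF k(1)]) (use that in \<open>auto intro!: continuous_intros\<close>)
  have ct: "continuous_on {0..1} (\<lambda>s. k (s, t))" if "t \<in> {0..1}" for t
    by (rule continuous_on_compose2[OF k(1)]) (use that in \<open>auto intro!: continuous_intros\<close>)
  have kN: "k (s, t) \<in> N" if "s \<in> {0..1}" "t \<in> {0..1}" for s t using k(2) that by blast
  \<comment> \<open>The edges of the lifted square are identified by unique lifting, each edge
    supplying initial values for later ones: the edge \<open>s = 0\<close>, the two constant edges,
    the edge \<open>s = 1\<close>.\<close>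
  have k0: "k (0, t) = h t" if "t \<in> {0..1}" for t
    by (rule covering_space_unique_lift[OF cov, of "{0..1}" "\<lambda>t. k (0, t)" h 0])
      (use h k f0 that cs kN in \<open>auto simp: path_def path_image_def\<close>)
  have ks0: "k (s, 0) = h 0" if "s \<in> {0..1}" for s
    by (rule covering_space_unique_lift[OF cov, of "{0..1}" "\<lambda>s. k (s, 0)" "\<lambda>_. h 0" 0])
      (use h0 k fs that ct kN in auto)
  have ks1: "k (s, 1) = h 1" if "s \<in> {0..1}" for s
    by (rule covering_space_unique_lift[OF cov, of "{0..1}" "\<lambda>s. k (s, 1)" "\<lambda>_. h 1" 0])
      (use h0 k fs that ct kN k0[of 1] in auto)
  have k1: "k (1, t) = h' t" if "t \<in> {0..1}" for t
    by (rule covering_space_unique_lift[OF cov, of "{0..1}" "\<lambda>t. k (1, t)" h' 0])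
      (use h' k f1 that cs kN ks0[of 1] start in \<open>auto simp: path_def path_image_def pathstart_def\<close>)
  show ?thesis
    unfolding homotopic_paths pathstart_def pathfinish_def
    using k k0 k1 ks0 ks1 by (intro exI[of _ k]) (auto simp: image_subset_iff_funcset)
qed

section \<open>The fundamental group and closed manifolds\<close>

text \<open>\<open>S\<close> carries no linear structure, so the constant path is a constant
  function. The homotopy is made between line paths in \<open>{0..1}\<close> and composed with
  \<open>p\<close>.\<close>

lemma homotopic_paths_lid_const:
  assumes "path p" "path_image p \<subseteq> S"
  shows "homotopic_paths S ((\<lambda>_. pathstart p) +++ p) p"
proof -
  have "homotopic_paths {0..1} (linepath 0 0 +++ linepath 0 1) (linepath 0 (1::real))"
    using homotopic_paths_lid[of "linepath 0 (1::real)" "{0..1}"] by (simp add: closed_segment_eq_real_ivl)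
  then have "homotopic_paths S (p \<circ> (linepath 0 0 +++ linepath 0 1)) (p \<circ> linepath 0 (1::real))"
    by (rule homotopic_paths_continuous_image) (use assms in \<open>auto simp: path_def path_image_def\<close>)
  moreover have "p \<circ> linepath 0 (1::real) = p" "p \<circ> linepath 0 (0::real) = (\<lambda>_. pathstart p)"
    by (auto simp: linepath_def pathstart_def algebra_simps)
  ultimately show ?thesis by (simp add: path_compose_join)
qed

lemma homotopic_paths_linv_const:
  assumes "path p" "path_image p \<subseteq> S"
  shows "homotopic_paths S (reversepath p +++ p) (\<lambda>_. pathfinish p)"
proof -
  have "homotopic_paths {0..1} (reversepath (linepath 0 1) +++ linepath 0 1) (linepath 1 (1::real))"
    using homotopic_paths_linv[of "linepath 0 (1::real)" "{0..1}"] by (simp add: closed_segment_eq_real_ivl)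
  then have "homotopic_paths S (p \<circ> (reversepath (linepath 0 1) +++ linepath 0 1)) (p \<circ> linepath 1 (1::real))"
    by (rule homotopic_paths_continuous_image) (use assms in \<open>auto simp: path_def path_image_def\<close>)
  moreover have "p \<circ> linepath 0 (1::real) = p" "p \<circ> linepath 1 (1::real) = (\<lambda>_. pathfinish p)"
      "p \<circ> reversepath (linepath 0 (1::real)) = reversepath p"
    by (auto simp: linepath_def reversepath_def pathfinish_def algebra_simps)
  ultimately show ?thesis by (simp add: path_compose_join)
qed

lemma path_class_eqI: "homotopic_paths S p r \<Longrightarrow> path_class S p = path_class S r"
  unfolding path_class_def using homotopic_paths_sym homotopic_paths_trans by blast

lemma mem_path_class_self: "path p \<Longrightarrow> path_image p \<subseteq> S \<Longrightarrow> p \<in> path_class S p"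
  by (simp add: path_class_def)

lemma loops_at_join: "p \<in> loops_at S x \<Longrightarrow> r \<in> loops_at S x \<Longrightarrow> p +++ r \<in> loops_at S x"
  by (auto simp: loops_at_def dest: path_image_join_subset[THEN subsetD])

lemma loops_at_reversepath: "p \<in> loops_at S x \<Longrightarrow> reversepath p \<in> loops_at S x"
  by (auto simp: loops_at_def)

lemma loops_at_const: "x \<in> S \<Longrightarrow> (\<lambda>_. x) \<in> loops_at S x"
  by (auto simp: loops_at_def path_def path_image_def pathstart_def pathfinish_def)

text \<open>The product is a union over all pairs of representatives; it collapses because each pair
  yields the same class.\<close>

lemma fundamental_group_mult:
  assumes "p \<in> loops_at S x" "r \<in> loops_at S x"
  shows "path_class S p \<otimes>\<^bsub>fundamental_group S x\<^esub> path_class S r = path_class S (p +++ r)"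
proof -
  have "path_class S (p' +++ r') = path_class S (p +++ r)"
    if "p' \<in> path_class S p" "r' \<in> path_class S r" for p' r'
  proof (rule path_class_eqI, rule homotopic_paths_sym, rule homotopic_paths_join)
    show "homotopic_paths S p p'" "homotopic_paths S r r'"
      using that by (simp_all add: path_class_def)
    show "pathfinish p = pathstart r"
      using assms by (simp add: loops_at_def)
  qed
  moreover have "p \<in> path_class S p" "r \<in> path_class S r"
    using assms by (auto simp: loops_at_def intro: mem_path_class_self)
  ultimately have "(\<Union>p'\<in>path_class S p. \<Union>r'\<in>path_class S r. path_class S (p' +++ r')) = path_class S (p +++ r)"
    by (metis (no_types, lifting) UN_constant_eq)
  then show ?thesis
    by (simp add: fundamental_group_def)
qed

lemma carrier_fundamental_group: "carrier (fundamental_group S x) = path_class S ` loops_at S x"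
  by (simp add: fundamental_group_def)

lemma one_fundamental_group: "\<one>\<^bsub>fundamental_group S x\<^esub> = path_class S (\<lambda>_. x)"
  by (simp add: fundamental_group_def)

lemma group_fundamental_group:
  assumes "x \<in> S"
  shows "group (fundamental_group S x)"
proof (rule groupI)
  fix a b assume "a \<in> carrier (fundamental_group S x)" "b \<in> carrier (fundamental_group S x)"
  then show "a \<otimes>\<^bsub>fundamental_group S x\<^esub> b \<in> carrier (fundamental_group S x)"
    by (auto simp: carrier_fundamental_group fundamental_group_mult intro: loops_at_join)
next
  show "\<one>\<^bsub>fundamental_group S x\<^esub> \<in> carrier (fundamental_group S x)"
    using loops_at_const[OF assms] by (simp add: carrier_fundamental_group one_fundamental_group)
next
  fix a b c assume "a \<in> carrier (fundamental_group S x)" "b \<in> carrier (fundamental_group S x)"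
    "c \<in> carrier (fundamental_group S x)"
  then obtain p r s where prs: "p \<in> loops_at S x" "r \<in> loops_at S x" "s \<in> loops_at S x"
      and abc: "a = path_class S p" "b = path_class S r" "c = path_class S s"
    by (auto simp: carrier_fundamental_group)
  have "homotopic_paths S (p +++ r +++ s) ((p +++ r) +++ s)"
    using prs by (intro homotopic_paths_assoc) (auto simp: loops_at_def)
  then show "a \<otimes>\<^bsub>fundamental_group S x\<^esub> b \<otimes>\<^bsub>fundamental_group S x\<^esub> c
      = a \<otimes>\<^bsub>fundamental_group S x\<^esub> (b \<otimes>\<^bsub>fundamental_group S x\<^esub> c)"
    using prs by (simp add: abc fundamental_group_mult loops_at_join path_class_eqI)
next
  fix a assume "a \<in> carrier (fundamental_group S x)"
  then obtain p where p: "p \<in> loops_at S x" "a = path_class S p"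
    by (auto simp: carrier_fundamental_group)
  then have pp: "path p" "path_image p \<subseteq> S" "pathstart p = x" "pathfinish p = x"
    by (simp_all add: loops_at_def)
  show "\<one>\<^bsub>fundamental_group S x\<^esub> \<otimes>\<^bsub>fundamental_group S x\<^esub> a = a"
    using p pp homotopic_paths_lid_const[OF pp(1,2)] loops_at_const[OF assms]
    by (simp add: one_fundamental_group fundamental_group_mult path_class_eqI)
  have "path_class S (reversepath p) \<otimes>\<^bsub>fundamental_group S x\<^esub> a = \<one>\<^bsub>fundamental_group S x\<^esub>"
    using p pp homotopic_paths_linv_const[OF pp(1,2)] loops_at_reversepath[OF p(1)]
    by (simp add: one_fundamental_group fundamental_group_mult path_class_eqI)
  then show "\<exists>b\<in>carrier (fundamental_group S x). b \<otimes>\<^bsub>fundamental_group S x\<^esub> a = \<one>\<^bsub>fundamental_group S x\<^esub>"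
    using p loops_at_reversepath[OF p(1)] by (intro bexI[of _ "path_class S (reversepath p)"])
      (auto simp: carrier_fundamental_group)
qed

section \<open>Small sets in closed manifolds\<close>

text \<open>Homotopies may leave \<open>B\<close>, since it is in \<open>M\<close> that they are
  lifted. Comparing two paths with common ends, instead of contracting loops, is the form used to
  identify end points of lifts.\<close>

definition inessential_in :: "'a::topological_space set \<Rightarrow> 'a set \<Rightarrow> bool" where
  "inessential_in M B \<longleftrightarrow> path_connected B \<and>
     (\<forall>p r. path p \<and> path_image p \<subseteq> B \<and> path r \<and> path_image r \<subseteq> B \<and>
        pathstart p = pathstart r \<and> pathfinish p = pathfinish r \<longrightarrow> homotopic_paths M p r)"

lemma continuous_on_affine_combination:
  fixes a b :: "'c::topological_space \<Rightarrow> nat \<Rightarrow> real"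
  assumes "continuous_on S u" "continuous_on S a" "continuous_on S b"
  shows "continuous_on S (\<lambda>z i. (1 - u z) * a z i + u z * b z i)"
proof (rule continuous_on_coordinatewise_then_product)
  fix i
  have "continuous_on S (\<lambda>z. a z i)" "continuous_on S (\<lambda>z. b z i)"
    by (rule continuous_on_product_then_coordinatewise[OF assms(2)],
        rule continuous_on_product_then_coordinatewise[OF assms(3)])
  then show "continuous_on S (\<lambda>z. (1 - u z) * a z i + u z * b z i)"
    using assms(1) by (intro continuous_intros)
qed

lemma Euclidean_space_eq_top_of_set:
  "Euclidean_space n = top_of_set {x. \<forall>i\<ge>n. x i = 0}"
  by (simp add: Euclidean_space_def euclidean_product_topology)

text \<open>Convexity is spelled out coordinatewise, as the space consists of sequences. A basic
  open box is shrunk to a box of intervals; only its finitely many sides other than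
  \<open>UNIV\<close> change, so the product stays open.\<close>

lemma Euclidean_space_convex_neighbourhood:
  fixes c :: "nat \<Rightarrow> real"
  assumes W: "openin (Euclidean_space n) W" "c \<in> W"
  obtains D where "openin (Euclidean_space n) D" "c \<in> D" "D \<subseteq> W"
    "\<And>a b u. a \<in> D \<Longrightarrow> b \<in> D \<Longrightarrow> u \<in> {0..1} \<Longrightarrow> (\<lambda>i. (1 - u) * a i + u * b i) \<in> D"
proof -
  let ?E = "{x :: nat \<Rightarrow> real. \<forall>i\<ge>n. x i = 0}"
  obtain W' where W': "open W'" "W = ?E \<inter> W'"
    using W unfolding Euclidean_space_eq_top_of_set openin_open by blast
  then have "openin (product_topology (\<lambda>i. euclidean) UNIV) W'" "c \<in> W'"
    using W by (auto simp: open_fun_def)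
  then obtain X where X: "c \<in> (\<Pi>\<^sub>E i\<in>UNIV. X i)" "\<And>i. open (X i)" "finite {i. X i \<noteq> UNIV}" "(\<Pi>\<^sub>E i\<in>UNIV. X i) \<subseteq> W'"
    using product_topology_open_contains_basis[of "\<lambda>i. euclidean" UNIV W' c] by auto
  have "\<exists>Y. open Y \<and> convex Y \<and> c i \<in> Y \<and> Y \<subseteq> X i \<and> (X i = UNIV \<longrightarrow> Y = UNIV)" for i
  proof (cases "X i = UNIV")
    case False
    have "c i \<in> X i" using X(1) by blast
    then obtain e where "e > 0" "ball (c i) e \<subseteq> X i"
      using X(2) open_contains_ball by blast
    then show ?thesis using False by (intro exI[of _ "ball (c i) e"]) auto
  qed auto
  then obtain Y where Y: "\<And>i. open (Y i)" "\<And>i. convex (Y i)" "\<And>i. c i \<in> Y i" "\<And>i. Y i \<subseteq> X i"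
      "\<And>i. X i = UNIV \<Longrightarrow> Y i = UNIV"
    by metis
  let ?D = "?E \<inter> (\<Pi>\<^sub>E i\<in>UNIV. Y i)"
  have "finite {i. Y i \<noteq> UNIV}"
    by (rule finite_subset[OF _ X(3)]) (use Y in auto)
  then have "open (\<Pi>\<^sub>E i\<in>UNIV. Y i)"
    using Y(1) by (intro open_PiE) auto
  then have "openin (Euclidean_space n) ?D"
    unfolding Euclidean_space_eq_top_of_set openin_open by blast
  moreover have "c \<in> ?D" using W W' Y by auto
  moreover have "(\<Pi>\<^sub>E i\<in>UNIV. Y i) \<subseteq> W'"
    using Y(4) X(4) by (meson PiE_mono subset_trans)
  then have "?D \<subseteq> W" using W' by blast
  moreover have "(\<lambda>i. (1 - u) * a i + u * b i) \<in> ?D" if ab: "a \<in> ?D" "b \<in> ?D" "u \<in> {0..1}" for a b u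
  proof -
    have "(1 - u) * a i + u * b i \<in> Y i" for i
      using convexD[OF Y(2)[of i], of "a i" "b i" "1 - u" u] ab by auto
    then show ?thesis using ab by auto
  qed
  ultimately show ?thesis using that by blast
qed

text \<open>\<open>B\<close> corresponds to a convex set in a chart, and the straight-line homotopy
  there is carried back to \<open>M\<close>.\<close>

lemma closed_manifold_inessential_neighbourhood:
  assumes M: "closed_manifold n M" and O: "openin (top_of_set M) O'" "y \<in> O'"
  obtains B where "openin (top_of_set M) B" "y \<in> B" "B \<subseteq> O'" "inessential_in M B"
proof -
  have "y \<in> M" using O openin_imp_subset by blast
  then obtain U V where UV: "y \<in> U" "openin (top_of_set M) U" "openin (Euclidean_space n) V"
      "top_of_set U homeomorphic_space subtopology (Euclidean_space n) V"
    using M unfolding closed_manifold_def by blast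
  let ?E = "{x :: nat \<Rightarrow> real. \<forall>i\<ge>n. x i = 0}"
  have VE: "V \<subseteq> ?E" "openin (top_of_set ?E) V"
    using UV(3) openin_imp_subset unfolding Euclidean_space_eq_top_of_set by blast+
  have "subtopology (Euclidean_space n) V = top_of_set V"
    unfolding Euclidean_space_eq_top_of_set subtopology_subtopology using VE by (simp add: Int_absorb1)
  then obtain f g where fg: "homeomorphic_maps (top_of_set U) (top_of_set V) f g"
    using UV(4) unfolding homeomorphic_space_def by auto
  have f: "continuous_on U f" "f ` U \<subseteq> V" and g: "continuous_on V g" "g ` V \<subseteq> U"
    and gf: "\<And>z. z \<in> U \<Longrightarrow> g (f z) = z" and fg': "\<And>z. z \<in> V \<Longrightarrow> f (g z) = z"
    using fg unfolding homeomorphic_maps_def by (auto simp: continuous_map_subtopology_eu image_subset_iff_funcset)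
  have UM: "U \<subseteq> M" using UV(2) openin_imp_subset by blast
  have "openin (top_of_set U) (U \<inter> O')"
    using O UM by (auto simp: openin_open)
  then have "openin (top_of_set V) (V \<inter> g -` (U \<inter> O'))"
    using openin_preimage[OF g] by blast
  then have op: "openin (Euclidean_space n) (V \<inter> g -` (U \<inter> O'))"
    using VE(2) unfolding Euclidean_space_eq_top_of_set by (rule openin_trans)
  have fy: "f y \<in> V \<inter> g -` (U \<inter> O')"
    using f gf UV(1) O by auto
  obtain D where D: "openin (Euclidean_space n) D" "f y \<in> D" "D \<subseteq> V \<inter> g -` (U \<inter> O')"
    "\<And>a b u. a \<in> D \<Longrightarrow> b \<in> D \<Longrightarrow> u \<in> {0..1} \<Longrightarrow> (\<lambda>i. (1 - u) * a i + u * b i) \<in> D"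
    by (rule Euclidean_space_convex_neighbourhood[OF op fy]) blast
  define B where "B = U \<inter> f -` D"
  have BD: "B = g ` D"
    unfolding B_def using D(3) g gf fg' by (auto simp: image_iff) (metis IntE subsetD)+
  have "openin (top_of_set V) D"
    by (rule openin_subset_trans[OF D(1)[unfolded Euclidean_space_eq_top_of_set] _ VE(1)]) (use D(3) in blast)
  then have "openin (top_of_set U) B"
    unfolding B_def using openin_preimage[OF f] by blast
  then have "openin (top_of_set M) B"
    using UV(2) by (rule openin_trans)
  moreover have "y \<in> B" using D UV by (simp add: B_def)
  moreover have "B \<subseteq> O'" unfolding BD using D(3) by blast
  moreover have "inessential_in M B"
    unfolding inessential_in_def
  proof (intro conjI allI impI)
    have "path_connected D"
      unfolding path_connected_def
    proof (intro ballI)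
      fix a b assume "a \<in> D" "b \<in> D"
      then show "\<exists>p. path p \<and> path_image p \<subseteq> D \<and> pathstart p = a \<and> pathfinish p = b"
        unfolding path_def path_image_def pathstart_def pathfinish_def
        using D(4) by (intro exI[of _ "\<lambda>t i. (1 - t) * a i + t * b i"] conjI
            continuous_on_affine_combination continuous_intros) auto
    qed
    then show "path_connected B"
      unfolding BD using D(3) g by (intro path_connected_continuous_image) (auto intro: continuous_on_subset)
  next
    fix p r assume *: "path p \<and> path_image p \<subseteq> B \<and> path r \<and> path_image r \<subseteq> B \<and>
        pathstart p = pathstart r \<and> pathfinish p = pathfinish r"
    have pr: "p t \<in> B" "r t \<in> B" if "t \<in> {0..1}" for t
      using * that by (auto simp: path_image_def)
    have fB: "continuous_on B f" "\<And>z. z \<in> B \<Longrightarrow> f z \<in> D"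
      using f by (auto simp: B_def intro: continuous_on_subset)
    have c: "continuous_on {0..1} (\<lambda>t. f (p t))" "continuous_on {0..1} (\<lambda>t. f (r t))"
      using * pr by (auto simp: path_def intro!: continuous_on_compose2[OF fB(1)])
    have "homotopic_paths D (f \<circ> p) (f \<circ> r)"
      unfolding homotopic_paths pathstart_def pathfinish_def
    proof (intro exI conjI ballI)
      let ?h = "\<lambda>w i. (1 - fst w) * f (p (snd w)) i + fst w * f (r (snd w)) i"
      have "continuous_on ({0..1} \<times> {0..1::real}) (\<lambda>w. f (p (snd w)))"
           "continuous_on ({0..1} \<times> {0..1::real}) (\<lambda>w. f (r (snd w)))"
        by (rule continuous_on_compose2[OF c(1) continuous_on_snd[OF continuous_on_id]], force)
           (rule continuous_on_compose2[OF c(2) continuous_on_snd[OF continuous_on_id]], force)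
      then show "continuous_on ({0..1} \<times> {0..1::real}) ?h"
        by (intro continuous_on_affine_combination continuous_on_fst continuous_on_id)
      show "?h \<in> {0..1} \<times> {0..1} \<rightarrow> D"
        using D(4) fB pr by auto
      show "(?h \<circ> Pair t) 0 = (f \<circ> p) 0" "(?h \<circ> Pair t) 1 = (f \<circ> p) 1" for t
        using * by (auto simp: pathstart_def pathfinish_def algebra_simps)
    qed auto
    then have "homotopic_paths M (g \<circ> (f \<circ> p)) (g \<circ> (f \<circ> r))"
    proof (rule homotopic_paths_continuous_image)
      show "continuous_on D g" using g D(3) by (auto intro: continuous_on_subset)
      show "g \<in> D \<rightarrow> M" using g D(3) UM by auto
    qed
    moreover have "homotopic_paths M p (g \<circ> (f \<circ> p))" "homotopic_paths M r (g \<circ> (f \<circ> r))"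
      using * UM pr by (auto intro!: homotopic_paths_eq simp: B_def gf)
    ultimately show "homotopic_paths M p r"
      using homotopic_paths_sym homotopic_paths_trans by metis
  qed
  ultimately show ?thesis using that by blast
qed

lemma closed_manifold_path_connected:
  assumes M: "closed_manifold n M"
  shows "path_connected M"
proof -
  have "path_component M a b" if ab: "a \<in> M" "b \<in> M" for a b
  proof -
    let ?P = "{z \<in> M. path_component M a z}"
    have nbhd: "\<exists>B. openin (top_of_set M) B \<and> z \<in> B \<and> (\<forall>w\<in>B. path_component M z w)" if z: "z \<in> M" for z
    proof -
      obtain B where B: "openin (top_of_set M) B" "z \<in> B" "inessential_in M B"
        by (rule closed_manifold_inessential_neighbourhood[OF M openin_subtopology_self z]) blast
      moreover have "path_component M z w" if "w \<in> B" for w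
      proof -
        have "path_component B z w"
          using B that unfolding inessential_in_def path_connected_component by blast
        then show ?thesis
          using path_component_of_subset[OF openin_imp_subset[OF B(1)]] by blast
      qed
      ultimately show ?thesis by blast
    qed
    have "openin (top_of_set M) ?P"
    proof (subst openin_subopen, intro ballI)
      fix z assume "z \<in> ?P"
      then obtain B where "openin (top_of_set M) B" "z \<in> B" "\<forall>w\<in>B. path_component M z w" "path_component M a z"
        using nbhd by blast
      then show "\<exists>T. openin (top_of_set M) T \<and> z \<in> T \<and> T \<subseteq> ?P"
        using path_component_trans path_component_mem(2) by (intro exI[of _ B]) blast
    qed
    moreover have "openin (top_of_set M) (M - ?P)"
    proof (subst openin_subopen, intro ballI)
      fix z assume z: "z \<in> M - ?P"
      then obtain B where "openin (top_of_set M) B" "z \<in> B" "\<forall>w\<in>B. path_component M z w"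
        using nbhd by blast
      then show "\<exists>T. openin (top_of_set M) T \<and> z \<in> T \<and> T \<subseteq> M - ?P"
        using z path_component_trans path_component_sym path_component_mem(2) by (intro exI[of _ B]) blast
    qed
    then have "closedin (top_of_set M) ?P"
      unfolding closedin_def by auto
    moreover have "connected M" using M by (simp add: closed_manifold_def)
    ultimately have "?P = {} \<or> ?P = M"
      unfolding connected_clopen by blast
    moreover have "a \<in> ?P" using ab by (simp add: path_component_refl)
    ultimately show ?thesis using ab by blast
  qed
  then show ?thesis by (simp add: path_connected_component)
qed

text \<open>Regularity gives \<open>V y \<subseteq> C y \<subseteq> B y\<close> with
  \<open>C y\<close> relatively closed, and finitely many \<open>V y\<close> cover \<open>M\<close>.
  The neighbourhood \<open>N z\<close> avoids each \<open>C y\<close> not containing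
  \<open>z\<close> and lies in \<open>B y\<close> for the others. A point common to
  \<open>N z\<close> and \<open>N z'\<close> lies in some \<open>C y\<close>, which forces both into
  the same \<open>B y\<close>.\<close>

lemma closed_manifold_star_refinement:
  assumes M: "closed_manifold n M"
    and \<U>: "\<And>y. y \<in> M \<Longrightarrow> \<exists>U\<in>\<U>. openin (top_of_set M) U \<and> y \<in> U"
  obtains \<Q> where "\<forall>Q\<in>\<Q>. openin (top_of_set M) Q \<and> path_connected Q \<and> (\<exists>U\<in>\<U>. Q \<subseteq> U)"
    "\<Union>\<Q> = M"
    "\<forall>Q\<in>\<Q>. \<forall>Q'\<in>\<Q>. Q \<inter> Q' \<noteq> {} \<longrightarrow> (\<exists>B. inessential_in M B \<and> Q \<union> Q' \<subseteq> B)"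
proof -
  have "compact_space (top_of_set M)"
    using M by (simp add: closed_manifold_def compact_space_subtopology compactin_euclidean_iff)
  then have reg: "regular_space (top_of_set M)"
    using M by (simp add: closed_manifold_def compact_Hausdorff_imp_regular_space)
  have "\<exists>B V C. inessential_in M B \<and> (\<exists>U\<in>\<U>. B \<subseteq> U) \<and> openin (top_of_set M) B \<and>
      openin (top_of_set M) V \<and> y \<in> V \<and> openin (top_of_set M) (M - C) \<and> V \<subseteq> C \<and> C \<subseteq> B" if y: "y \<in> M" for y
  proof -
    obtain U where U: "U \<in> \<U>" "openin (top_of_set M) U" "y \<in> U" using \<U>[OF y] by blast
    obtain B where B: "openin (top_of_set M) B" "y \<in> B" "B \<subseteq> U" "inessential_in M B"
      using closed_manifold_inessential_neighbourhood[OF M U(2,3)] by blast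
    have "closedin (top_of_set M) (M - B)" "y \<in> topspace (top_of_set M) - (M - B)"
      using B y by auto
    then obtain V W where VW: "openin (top_of_set M) V" "openin (top_of_set M) W" "y \<in> V" "M - B \<subseteq> W" "disjnt V W"
      using reg unfolding regular_space_def by meson
    have "V \<subseteq> M" "W \<subseteq> M" using VW openin_imp_subset by blast+
    then have "V \<subseteq> M - W" "M - W \<subseteq> B" "M - (M - W) = W"
      using VW by (auto simp: disjnt_def)
    then show ?thesis
      using B U VW by (intro exI[of _ B] exI[of _ V] exI[of _ "M - W"]) auto
  qed
  then obtain B V C where BVC: "\<And>y. y \<in> M \<Longrightarrow> inessential_in M (B y) \<and> (\<exists>U\<in>\<U>. B y \<subseteq> U) \<and> openin (top_of_set M) (B y) \<and>
      openin (top_of_set M) (V y) \<and> y \<in> V y \<and> openin (top_of_set M) (M - C y) \<and> V y \<subseteq> C y \<and> C y \<subseteq> B y"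
    by metis
  have "compact M" using M by (simp add: closed_manifold_def)
  moreover have "\<forall>c\<in>V ` M. openin (top_of_set M) c" "M \<subseteq> \<Union>(V ` M)" using BVC by auto
  ultimately obtain \<D> where "\<D> \<subseteq> V ` M" "finite \<D>" "M \<subseteq> \<Union>\<D>"
    unfolding compact_eq_openin_cover by meson
  then obtain Y where Y: "Y \<subseteq> M" "finite Y" "M \<subseteq> \<Union>(V ` Y)"
    by (metis finite_subset_image)
  define N where "N z = \<Inter>(insert M ((\<lambda>y. if z \<in> C y then B y else M - C y) ` Y))" for z
  have N: "openin (top_of_set M) (N z)" "z \<in> N z" if "z \<in> M" for z
  proof -
    show "openin (top_of_set M) (N z)"
      unfolding N_def
    proof (rule openin_Inter)
      fix A assume "A \<in> insert M ((\<lambda>y. if z \<in> C y then B y else M - C y) ` Y)"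
      then consider "A = M" | y where "y \<in> M" "A = B y" | y where "y \<in> M" "A = M - C y"
        using Y(1) by (auto split: if_splits)
      then show "openin (top_of_set M) A"
        using BVC by cases auto
    qed (use Y(2) in auto)
    show "z \<in> N z"
      unfolding N_def using that BVC Y(1) by auto
  qed
  have star: "N z \<subseteq> B y" if "y \<in> Y" "w \<in> C y" "w \<in> N z" for z y w
  proof -
    have "N z \<subseteq> (if z \<in> C y then B y else M - C y)"
      unfolding N_def using that(1) by blast
    then show ?thesis using that(2,3) by (cases "z \<in> C y") auto
  qed
  have cover: "\<exists>y\<in>Y. z \<in> C y" if "z \<in> M" for z
    using that Y BVC by blast
  have "\<exists>Q. openin (top_of_set M) Q \<and> z \<in> Q \<and> Q \<subseteq> N z \<and> path_connected Q" if "z \<in> M" for z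
    using closed_manifold_inessential_neighbourhood[OF M N[OF that]] by (metis inessential_in_def)
  then obtain Q where Q: "\<And>z. z \<in> M \<Longrightarrow> openin (top_of_set M) (Q z) \<and> z \<in> Q z \<and> Q z \<subseteq> N z \<and> path_connected (Q z)"
    by metis
  show ?thesis
  proof (rule that[of "Q ` M"]; (intro ballI impI)?)
    fix A assume "A \<in> Q ` M"
    then obtain z where z: "z \<in> M" "A = Q z" by blast
    then obtain y where y: "y \<in> Y" "z \<in> C y" using cover by blast
    then have "A \<subseteq> B y" using star[of y z z] N z Q by blast
    moreover have "\<exists>U\<in>\<U>. B y \<subseteq> U" using BVC y Y by blast
    ultimately show "openin (top_of_set M) A \<and> path_connected A \<and> (\<exists>U\<in>\<U>. A \<subseteq> U)"
      using Q z by blast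
  next
    show "\<Union>(Q ` M) = M"
      using Q openin_imp_subset by blast
  next
    fix A A' assume "A \<in> Q ` M" "A' \<in> Q ` M" "A \<inter> A' \<noteq> {}"
    then obtain z z' w where z: "z \<in> M" "A = Q z" "z' \<in> M" "A' = Q z'" "w \<in> A" "w \<in> A'" by blast
    then have "w \<in> M" "w \<in> N z" "w \<in> N z'" using Q openin_imp_subset by blast+
    then obtain y where y: "y \<in> Y" "w \<in> C y" using cover by blast
    then have "N z \<subseteq> B y" "N z' \<subseteq> B y" using star \<open>w \<in> N z\<close> \<open>w \<in> N z'\<close> by blast+
    then have "A \<union> A' \<subseteq> B y" using z Q by blast
    moreover have "inessential_in M (B y)" using BVC y Y by blast
    ultimately show "\<exists>B. inessential_in M B \<and> A \<union> A' \<subseteq> B" by blast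
  qed
qed

section \<open>Path lifting and monodromy of a solenoidal manifold\<close>

locale solenoid =
  fixes n :: nat and M :: "nat \<Rightarrow> 'a::topological_space set" and q :: "nat \<Rightarrow> 'a \<Rightarrow> 'a"
  assumes presentation: "presentation n M q"
begin

abbreviation S :: "(nat \<Rightarrow> 'a) set" where "S \<equiv> solenoidal_manifold M q"

lemma manifold: "closed_manifold n (M l)"
  using presentation by (simp add: presentation_def)

lemma covering: "covering_space (M (Suc l)) (q (Suc l)) (M l)"
proof -
  have "proper_finite_covering (M (Suc l)) (q (Suc l)) (M (Suc l - 1))"
    using presentation unfolding presentation_def by (metis le_add1 plus_1_eq_Suc)
  then show ?thesis by (simp add: proper_finite_covering_def)
qed

lemma finite_covering_fibre: "y \<in> M l \<Longrightarrow> finite {z \<in> M (Suc l). q (Suc l) z = y}"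
proof -
  assume y: "y \<in> M l"
  have "proper_finite_covering (M (Suc l)) (q (Suc l)) (M (Suc l - 1))"
    using presentation unfolding presentation_def by (metis le_add1 plus_1_eq_Suc)
  then obtain d where "d > 1" "card {z \<in> M (Suc l). q (Suc l) z = y} = d"
    using y unfolding proper_finite_covering_def by auto
  \<comment> \<open>A degree above \<open>1\<close> excludes infinite fibres, whose
    \<open>card\<close> is \<open>0\<close>.\<close>
  then show ?thesis by (intro card_ge_0_finite) simp
qed

lemma continuous_bonding: "continuous_on (M (Suc l)) (q (Suc l))"
  and bonding_image: "q (Suc l) ` M (Suc l) = M l"
  using covering[of l] covering_space_imp_continuous covering_space_imp_surjective by blast+

lemma solenoid_mem: "z \<in> S \<Longrightarrow> z l \<in> M l"
  by (simp add: solenoidal_manifold_def)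

lemma solenoid_step: "z \<in> S \<Longrightarrow> q (Suc l) (z (Suc l)) = z l"
  by (simp add: solenoidal_manifold_def)

lemma solenoidI: "(\<And>l. z l \<in> M l) \<Longrightarrow> (\<And>l. q (Suc l) (z (Suc l)) = z l) \<Longrightarrow> z \<in> S"
  unfolding solenoidal_manifold_def by (auto simp: Suc_le_eq gr0_conv_Suc)

lemma level_antimono:
  assumes "z \<in> S" "w \<in> S" "l \<le> m" "z m = w m"
  shows "z l = w l"
  using assms(3,4)
proof (induction m rule: dec_induct)
  case (step m)
  then show ?case using solenoid_step[OF assms(1), of m] solenoid_step[OF assms(2), of m] by simp
qed

lemma bonding_map_solenoid: "z \<in> S \<Longrightarrow> bonding_map q l (z l) = z 0"
  by (induction l) (simp_all add: solenoid_step)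

lemma continuous_bonding_map: "continuous_on (M l) (bonding_map q l)"
  and bonding_map_mem: "y \<in> M l \<Longrightarrow> bonding_map q l y \<in> M 0"
proof -
  have "continuous_on (M l) (bonding_map q l) \<and> bonding_map q l ` M l \<subseteq> M 0"
  proof (induction l)
    case (Suc l)
    have "continuous_on (M (Suc l)) (bonding_map q l \<circ> q (Suc l))"
      using Suc by (intro continuous_on_compose continuous_bonding) (simp add: bonding_image)
    moreover have "(bonding_map q l \<circ> q (Suc l)) ` M (Suc l) = bonding_map q l ` M l"
      by (simp only: image_comp[symmetric] bonding_image)
    ultimately show ?case using Suc by simp
  qed (simp add: id_def)
  then show "continuous_on (M l) (bonding_map q l)" "y \<in> M l \<Longrightarrow> bonding_map q l y \<in> M 0" by auto
qed

text \<open>Uniqueness is pulled up one covering at a time, without treating the composite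
  \<open>bonding_map\<close> as a covering.\<close>

lemma bonding_map_unique_lift:
  assumes "continuous_on {0..1::real} f" "continuous_on {0..1} g" "f ` {0..1} \<subseteq> M l" "g ` {0..1} \<subseteq> M l"
    and "\<And>t. t \<in> {0..1} \<Longrightarrow> bonding_map q l (f t) = bonding_map q l (g t)"
    and "f 0 = g 0" "t \<in> {0..1}"
  shows "f t = g t"
  using assms
proof (induction l arbitrary: f g t)
  case (Suc l)
  have eq: "q (Suc l) (f t) = q (Suc l) (g t)" if t: "t \<in> {0..1}" for t
  proof (rule Suc.IH[where f = "\<lambda>t. q (Suc l) (f t)" and g = "\<lambda>t. q (Suc l) (g t)"])
    show "continuous_on {0..1} (\<lambda>t. q (Suc l) (f t))" "continuous_on {0..1} (\<lambda>t. q (Suc l) (g t))"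
      by (rule continuous_on_compose2[OF continuous_bonding]; use Suc.prems in blast)+
    show "(\<lambda>t. q (Suc l) (f t)) ` {0..1} \<subseteq> M l" "(\<lambda>t. q (Suc l) (g t)) ` {0..1} \<subseteq> M l"
      using Suc.prems bonding_image[of l] by blast+
  qed (use Suc.prems t in auto)
  show ?case
    by (rule covering_space_unique_lift[OF covering, of "{0..1}" f l g 0]) (use Suc.prems eq in auto)
qed simp

section \<open>Paths in the solenoidal manifold\<close>

definition solenoid_path :: "(real \<Rightarrow> nat \<Rightarrow> 'a) \<Rightarrow> bool" where
  "solenoid_path u \<longleftrightarrow> path u \<and> path_image u \<subseteq> S"

lemma solenoid_path_mem: "solenoid_path u \<Longrightarrow> t \<in> {0..1} \<Longrightarrow> u t \<in> S"
  by (auto simp: solenoid_path_def path_image_def)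

lemma solenoid_path_coordinate:
  assumes "solenoid_path u"
  shows "path (\<lambda>t. u t l)" "path_image (\<lambda>t. u t l) \<subseteq> M l"
proof -
  show "path (\<lambda>t. u t l)"
    using assms unfolding solenoid_path_def path_def
    by (simp add: continuous_on_product_then_coordinatewise)
  show "path_image (\<lambda>t. u t l) \<subseteq> M l"
    using solenoid_path_mem[OF assms] solenoid_mem by (auto simp: path_image_def)
qed

text \<open>The geometric source of \<open>act_level\<close>: lifts of one path of
  \<open>M 0\<close> that agree in coordinate \<open>l\<close> at the start agree there throughout,
  whatever their deeper coordinates.\<close>

lemma solenoid_path_level_unique:
  assumes u: "solenoid_path u" and v: "solenoid_path v"
    and eq: "\<And>t. t \<in> {0..1} \<Longrightarrow> u t 0 = v t 0" and "u 0 l = v 0 l" and t: "t \<in> {0..1}"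
  shows "u t l = v t l"
proof (rule bonding_map_unique_lift[where l = l and f = "\<lambda>t. u t l" and g = "\<lambda>t. v t l"])
  show "bonding_map q l (u t l) = bonding_map q l (v t l)" if "t \<in> {0..1}" for t
    using bonding_map_solenoid[OF solenoid_path_mem[OF u that]]
      bonding_map_solenoid[OF solenoid_path_mem[OF v that]] eq[OF that] by simp
qed (use solenoid_path_coordinate[OF u] solenoid_path_coordinate[OF v] assms in
    \<open>simp_all add: path_def path_image_def\<close>)

lemma ex_solenoid_path_lift_0:
  assumes z: "z \<in> S" and p: "path p" "path_image p \<subseteq> M 0" "pathstart p = z 0"
  obtains u where "solenoid_path u" "u 0 = z" "\<And>t. t \<in> {0..1} \<Longrightarrow> u t 0 = p t"
proof -
  \<comment> \<open>Coordinates are lifted one level at a time, each starting at the coordinate of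
    \<open>z\<close>. In the product topology continuity of every coordinate is enough.\<close>
  define P where "P l g \<longleftrightarrow> path g \<and> path_image g \<subseteq> M l \<and> pathstart g = z l \<and> (l = 0 \<longrightarrow> g = p)" for l g
  have "\<exists>g. \<forall>l. P l (g l) \<and> (\<forall>t\<in>{0..1}. q (Suc l) (g (Suc l) t) = g l t)"
  proof (rule dependent_nat_choice)
    show "\<exists>g. P 0 g" using p by (auto simp: P_def)
    fix g l assume "P l g"
    then have g: "path g" "path_image g \<subseteq> M l" "q (Suc l) (z (Suc l)) = pathstart g"
      by (auto simp: P_def solenoid_step z)
    show "\<exists>h. P (Suc l) h \<and> (\<forall>t\<in>{0..1}. q (Suc l) (h t) = g t)"
      by (rule covering_space_path_lift[OF covering g(1,2) solenoid_mem[OF z] g(3)])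
        (auto simp: P_def)
  qed
  then obtain g where g: "\<And>l. P l (g l)" "\<And>l t. t \<in> {0..1} \<Longrightarrow> q (Suc l) (g (Suc l) t) = g l t"
    by blast
  show ?thesis
  proof (rule that[of "\<lambda>t l. g l t"])
    have "path (\<lambda>t l. g l t)"
      unfolding path_def
      by (rule continuous_on_coordinatewise_then_product) (use g in \<open>simp add: P_def path_def\<close>)
    moreover have "(\<lambda>l. g l t) \<in> S" if "t \<in> {0..1}" for t
    proof (rule solenoidI)
      show "g l t \<in> M l" for l using g(1)[of l] that unfolding P_def path_image_def by blast
    qed (use g(2) that in blast)
    ultimately show "solenoid_path (\<lambda>t l. g l t)"
      by (auto simp: solenoid_path_def path_image_def)
    show "(\<lambda>l. g l 0) = z" using g by (auto simp: P_def pathstart_def)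
    show "g 0 t = p t" for t using g(1)[of 0] by (simp add: P_def)
  qed
qed

text \<open>The path is pushed down to \<open>M 0\<close> and lifted from there; unique lifting
  identifies coordinate \<open>j\<close> of the result with \<open>p\<close>.\<close>

lemma ex_solenoid_path_lift:
  assumes z: "z \<in> S" and p: "path p" "path_image p \<subseteq> M j" "pathstart p = z j"
  obtains u where "solenoid_path u" "u 0 = z" "\<And>t. t \<in> {0..1} \<Longrightarrow> u t j = p t"
proof -
  have pM: "p t \<in> M j" if "t \<in> {0..1}" for t using p that by (auto simp: path_image_def)
  have c: "continuous_on {0..1} (\<lambda>t. bonding_map q j (p t))"
    by (rule continuous_on_compose2[OF continuous_bonding_map]) (use p pM in \<open>auto simp: path_def\<close>)
  obtain u where u: "solenoid_path u" "u 0 = z" "\<And>t. t \<in> {0..1} \<Longrightarrow> u t 0 = bonding_map q j (p t)"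
  proof (rule ex_solenoid_path_lift_0[OF z])
    show "path (\<lambda>t. bonding_map q j (p t))" using c by (simp add: path_def)
    show "path_image (\<lambda>t. bonding_map q j (p t)) \<subseteq> M 0"
      using pM bonding_map_mem by (auto simp: path_image_def)
    show "pathstart (\<lambda>t. bonding_map q j (p t)) = z 0"
      using p bonding_map_solenoid[OF z] by (simp add: pathstart_def)
  qed auto
  have "u t j = p t" if "t \<in> {0..1}" for t
  proof (rule bonding_map_unique_lift[where f = "\<lambda>t. u t j" and g = p and l = j])
    show "bonding_map q j (u t j) = bonding_map q j (p t)" if "t \<in> {0..1}" for t
      using bonding_map_solenoid[OF solenoid_path_mem[OF u(1) that], of j] u(3)[OF that] by simp
  qed (use solenoid_path_coordinate[OF u(1), of j] p u(2) that in \<open>auto simp: path_def path_image_def pathstart_def\<close>)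
  then show ?thesis using that u by blast
qed

text \<open>The homotopy is lifted through the tower level by level, so the end points agree in
  every coordinate.\<close>

lemma homotopic_solenoid_paths:
  assumes u: "solenoid_path u" and v: "solenoid_path v" and "u 0 = v 0"
    and hom: "homotopic_paths (M 0) (\<lambda>t. u t 0) (\<lambda>t. v t 0)"
  shows "u 1 = v 1"
proof
  have "homotopic_paths (M l) (\<lambda>t. u t l) (\<lambda>t. v t l)" for l
  proof (induction l)
    case (Suc l)
    have "homotopic_paths (M l) (\<lambda>t. w t l) (q (Suc l) \<circ> (\<lambda>t. w t (Suc l)))" if w: "solenoid_path w" for w
      by (rule homotopic_paths_eq) (use solenoid_path_coordinate[OF w] solenoid_path_mem[OF w] solenoid_step in auto)
    then have "homotopic_paths (M l) (q (Suc l) \<circ> (\<lambda>t. u t (Suc l))) (q (Suc l) \<circ> (\<lambda>t. v t (Suc l)))"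
      using Suc u v homotopic_paths_sym homotopic_paths_trans by metis
    then show ?case
      by (intro covering_space_homotopic_lifts[OF covering])
        (use solenoid_path_coordinate u v assms(3) in \<open>auto simp: pathstart_def\<close>)
  qed (fact hom)
  then show "u 1 l = v 1 l" for l
    using homotopic_paths_imp_pathfinish by (auto simp: pathfinish_def)
qed

text \<open>The homotopy that \<open>B\<close> provides in \<open>M j\<close> is projected to
  \<open>M 0\<close>, from where it lifts to all levels.\<close>

lemma inessential_solenoid_paths:
  assumes B: "inessential_in (M j) B" and u: "solenoid_path u" and v: "solenoid_path v" and "u 0 = v 0" "u 1 j = v 1 j"
    and uB: "\<And>t. t \<in> {0..1} \<Longrightarrow> u t j \<in> B" and vB: "\<And>t. t \<in> {0..1} \<Longrightarrow> v t j \<in> B"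
  shows "u 1 = v 1"
proof (rule homotopic_solenoid_paths[OF u v])
  have "homotopic_paths (M j) (\<lambda>t. u t j) (\<lambda>t. v t j)"
    using B assms(4,5) uB vB solenoid_path_coordinate(1)[OF u] solenoid_path_coordinate(1)[OF v]
    unfolding inessential_in_def by (auto simp: path_image_def pathstart_def pathfinish_def image_subset_iff)
  then have "homotopic_paths (M 0) (bonding_map q j \<circ> (\<lambda>t. u t j)) (bonding_map q j \<circ> (\<lambda>t. v t j))"
    by (rule homotopic_paths_continuous_image[OF _ continuous_bonding_map]) (simp add: bonding_map_mem)
  moreover have "homotopic_paths (M 0) (\<lambda>t. w t 0) (bonding_map q j \<circ> (\<lambda>t. w t j))" if w: "solenoid_path w" for w
    by (rule homotopic_paths_eq) (use solenoid_path_coordinate[OF w] solenoid_path_mem[OF w] bonding_map_solenoid in auto)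
  ultimately show "homotopic_paths (M 0) (\<lambda>t. u t 0) (\<lambda>t. v t 0)"
    using u v homotopic_paths_sym homotopic_paths_trans by metis
qed (fact \<open>u 0 = v 0\<close>)

lemma solenoid_path_join:
  "solenoid_path u \<Longrightarrow> solenoid_path v \<Longrightarrow> u 1 = v 0 \<Longrightarrow> solenoid_path (u +++ v)"
  unfolding solenoid_path_def
  by (simp add: path_join pathfinish_def pathstart_def subset_path_image_join)

lemma solenoid_path_reverse: "solenoid_path u \<Longrightarrow> solenoid_path (reversepath u)"
  by (simp add: solenoid_path_def)

section \<open>Transport and monodromy\<close>

text \<open>As a relation, transport can be reversed and cancelled symmetrically. Only the values of
  \<open>p\<close> on \<open>{0..1}\<close> enter.\<close>

definition transport :: "(real \<Rightarrow> 'a) \<Rightarrow> (nat \<Rightarrow> 'a) \<Rightarrow> (nat \<Rightarrow> 'a) \<Rightarrow> bool" where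
  "transport p z w \<longleftrightarrow> (\<exists>u. solenoid_path u \<and> u 0 = z \<and> u 1 = w \<and> (\<forall>t\<in>{0..1}. u t 0 = p t))"

lemma transportI: "solenoid_path u \<Longrightarrow> transport (\<lambda>t. u t 0) (u 0) (u 1)"
  by (auto simp: transport_def)

lemma transport_mem: "transport p z w \<Longrightarrow> z \<in> S" "transport p z w \<Longrightarrow> w \<in> S"
  using solenoid_path_mem[of _ 0] solenoid_path_mem[of _ 1] unfolding transport_def by force+

lemma transport_ends: "transport p z w \<Longrightarrow> z 0 = p 0" "transport p z w \<Longrightarrow> w 0 = p 1"
  by (auto simp: transport_def)

lemma transport_level:
  assumes "transport p z w" "transport p z' w'" "z l = z' l"
  shows "w l = w' l"
  using assms solenoid_path_level_unique[of _ _ l 1] unfolding transport_def by (metis atLeastAtMost_iff order_refl zero_le_one)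

lemma transport_unique: "transport p z w \<Longrightarrow> transport p z w' \<Longrightarrow> w = w'"
  using transport_level by blast

lemma transport_reverse: "transport p z w \<Longrightarrow> transport (reversepath p) w z"
proof -
  assume "transport p z w"
  then obtain u where u: "solenoid_path u" "u 0 = z" "u 1 = w" "\<forall>t\<in>{0..1}. u t 0 = p t"
    unfolding transport_def by blast
  then show ?thesis
    unfolding transport_def
    by (intro exI[of _ "reversepath u"]) (auto simp: solenoid_path_reverse, auto simp: reversepath_def)
qed

lemma transport_reverse_iff: "transport (reversepath p) w z \<longleftrightarrow> transport p z w"
  using transport_reverse[of p z w] transport_reverse[of "reversepath p" w z] by auto

lemma transport_unique': "transport p z w \<Longrightarrow> transport p z' w \<Longrightarrow> z = z'"
  using transport_unique transport_reverse by blast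

lemma transport_join: "transport p z v \<Longrightarrow> transport r v w \<Longrightarrow> transport (p +++ r) z w"
proof -
  assume "transport p z v" "transport r v w"
  then obtain u u' where u: "solenoid_path u" "u 0 = z" "u 1 = v" "\<forall>t\<in>{0..1}. u t 0 = p t"
    and u': "solenoid_path u'" "u' 0 = v" "u' 1 = w" "\<forall>t\<in>{0..1}. u' t 0 = r t"
    unfolding transport_def by blast
  have "solenoid_path (u +++ u')" using u u' solenoid_path_join by simp
  then show ?thesis
    unfolding transport_def using u u' by (intro exI[of _ "u +++ u'"]) (auto simp: joinpaths_def)
qed

lemma transport_total:
  assumes "z \<in> S" "path p" "path_image p \<subseteq> M 0" "pathstart p = z 0"
  shows "\<exists>w. transport p z w"
  using ex_solenoid_path_lift_0[OF assms] unfolding transport_def by metis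

lemma transport_homotopic:
  assumes "transport p z w" "homotopic_paths (M 0) p r" 
  shows "transport r z w"
proof -
  obtain u where u: "solenoid_path u" "u 0 = z" "u 1 = w" "\<forall>t\<in>{0..1}. u t 0 = p t"
    using assms(1) unfolding transport_def by blast
  have r: "path r" "path_image r \<subseteq> M 0" "pathstart r = z 0"
    using homotopic_paths_imp_path[OF assms(2)] homotopic_paths_imp_subset[OF assms(2)]
      homotopic_paths_imp_pathstart[OF assms(2)] transport_ends(1)[OF assms(1)] by (auto simp: pathstart_def)
  then obtain v where v: "solenoid_path v" "v 0 = z" "\<And>t. t \<in> {0..1} \<Longrightarrow> v t 0 = r t"
    using ex_solenoid_path_lift_0 transport_mem(1)[OF assms(1)] by metis
  have hp: "homotopic_paths (M 0) p (\<lambda>t. u t 0)" "homotopic_paths (M 0) r (\<lambda>t. v t 0)"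
    using homotopic_paths_imp_path[OF assms(2)] homotopic_paths_imp_subset[OF assms(2)] u(4) v(3)
    by (intro homotopic_paths_eq; force)+
  have "homotopic_paths (M 0) (\<lambda>t. u t 0) (\<lambda>t. v t 0)"
    by (rule homotopic_paths_trans[OF homotopic_paths_sym[OF hp(1)] homotopic_paths_trans[OF assms(2) hp(2)]])
  then have "u 1 = v 1"
    by (rule homotopic_solenoid_paths[OF u(1) v(1), rotated]) (simp add: u(2) v(2))
  then show ?thesis
    unfolding transport_def using u(3) v by (intro exI[of _ v]) simp
qed

text \<open>Homotopic representatives transport \<open>z\<close> to the same point, which justifies
  the description when \<open>g\<close> is a class of loops at \<open>z 0\<close>.\<close>

definition monodromy :: "(real \<Rightarrow> 'a) set \<Rightarrow> (nat \<Rightarrow> 'a) \<Rightarrow> nat \<Rightarrow> 'a" where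
  "monodromy g z = (THE w. \<exists>p\<in>g. transport p z w)"

lemma transport_monodromy:
  assumes "p \<in> loops_at (M 0) y" "z \<in> S" "z 0 = y"
  shows "transport p z (monodromy (path_class (M 0) p) z)"
proof -
  obtain w where w: "transport p z w"
    using transport_total assms unfolding loops_at_def by (metis (mono_tags, lifting) mem_Collect_eq)
  have "monodromy (path_class (M 0) p) z = w"
    unfolding monodromy_def
  proof (rule the_equality)
    show "\<exists>p\<in>path_class (M 0) p. transport p z w"
      using w assms mem_path_class_self unfolding loops_at_def by blast
    fix w' assume "\<exists>p\<in>path_class (M 0) p. transport p z w'"
    then show "w' = w"
      using w transport_homotopic transport_unique unfolding path_class_def by blast
  qed
  then show ?thesis using w by simp
qed

lemma monodromy_eqI:
  assumes "p \<in> loops_at (M 0) y" "transport p z w"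
  shows "monodromy (path_class (M 0) p) z = w"
proof -
  have "z 0 = y"
    using assms transport_ends(1) by (auto simp: loops_at_def pathstart_def)
  then show ?thesis
    using transport_monodromy[OF assms(1)] assms(2) transport_unique transport_mem(1) by blast
qed

lemma path_connected_level: "path_connected (M l)"
  using closed_manifold_path_connected manifold by blast

lemma finite_fibre_level: "finite ((\<lambda>z. z l) ` {z \<in> S. z 0 = y})"
proof (induction l)
  case 0
  show ?case by (rule finite_subset[of _ "{y}"]) auto
next
  case (Suc l)
  let ?F = "(\<lambda>z. z l) ` {z \<in> S. z 0 = y}"
  have "(\<lambda>z. z (Suc l)) ` {z \<in> S. z 0 = y} \<subseteq> (\<Union>c\<in>?F. {b \<in> M (Suc l). q (Suc l) b = c})"
    using solenoid_mem solenoid_step by fastforce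
  moreover have "finite (\<Union>c\<in>?F. {b \<in> M (Suc l). q (Suc l) b = c})"
    using Suc finite_covering_fibre solenoid_mem by blast
  ultimately show ?case by (rule finite_subset)
qed

text \<open>A path in \<open>M l\<close> between the two coordinates is lifted to \<open>S\<close>
  and projected to a loop of \<open>M 0\<close>. The point reached agrees with \<open>b\<close> up
  to level \<open>l\<close>, and may differ beyond.\<close>

lemma monodromy_transitive:
  assumes "a \<in> S" "b \<in> S" "a 0 = y" "b 0 = y"
  shows "\<exists>g\<in>carrier (fundamental_group (M 0) y). monodromy g a l = b l"
proof -
  obtain p where p: "path p" "path_image p \<subseteq> M l" "pathstart p = a l" "pathfinish p = b l"
    using path_connected_level[of l] solenoid_mem assms unfolding path_connected_def by metis
  obtain u where u: "solenoid_path u" "u 0 = a" "\<And>t. t \<in> {0..1} \<Longrightarrow> u t l = p t"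
    using ex_solenoid_path_lift[OF assms(1) p(1-3)] by blast
  have "u 1 l = b l" using u(3)[of 1] p(4) by (simp add: pathfinish_def)
  then have "u 1 0 = y"
    using level_antimono[of "u 1" b 0 l] solenoid_path_mem[OF u(1), of 1] assms by simp
  then have loop: "(\<lambda>t. u t 0) \<in> loops_at (M 0) y"
    using solenoid_path_coordinate[OF u(1)] u(2) assms by (simp add: loops_at_def pathstart_def pathfinish_def)
  have "monodromy (path_class (M 0) (\<lambda>t. u t 0)) a = u 1"
    using monodromy_eqI[OF loop] transportI[OF u(1)] u(2) by simp
  then show ?thesis
    using loop \<open>u 1 l = b l\<close> unfolding carrier_fundamental_group by (metis imageI)
qed

text \<open>A loop of \<open>M l\<close> projects to a loop whose lift from \<open>x\<close> returns
  to \<open>x l\<close>; conversely, coordinate \<open>l\<close> of a lift returning to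
  \<open>x l\<close> is a loop of \<open>M l\<close> with the given projection.\<close>

lemma presentation_chain_eq:
  assumes x: "x \<in> S"
  shows "presentation_chain M q x l = {g \<in> carrier (fundamental_group (M 0) (x 0)). monodromy g x l = x l}"
proof -
  have hom: "induced_hom (M 0) (bonding_map q l) (path_class (M l) p) = path_class (M 0) (bonding_map q l \<circ> p)"
    if p: "p \<in> loops_at (M l) (x l)" for p
  proof -
    have "path_class (M 0) (bonding_map q l \<circ> r) = path_class (M 0) (bonding_map q l \<circ> p)"
      if "r \<in> path_class (M l) p" for r
      using that homotopic_paths_continuous_image[OF _ continuous_bonding_map, of l p r "M 0"] bonding_map_mem
      by (auto simp: path_class_def[of "M l"] intro!: path_class_eqI homotopic_paths_sym)
    moreover have "p \<in> path_class (M l) p"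
      using p mem_path_class_self by (auto simp: loops_at_def)
    ultimately show ?thesis
      unfolding induced_hom_def by (metis (no_types, lifting) UN_constant_eq)
  qed
  show ?thesis
  proof (intro equalityI subsetI)
    fix g assume "g \<in> presentation_chain M q x l"
    then obtain p where p: "p \<in> loops_at (M l) (x l)" "g = path_class (M 0) (bonding_map q l \<circ> p)"
      unfolding presentation_chain_def carrier_fundamental_group using hom by auto
    then have pp: "path p" "path_image p \<subseteq> M l" "pathstart p = x l" "pathfinish p = x l"
      by (auto simp: loops_at_def)
    obtain u where u: "solenoid_path u" "u 0 = x" "\<And>t. t \<in> {0..1} \<Longrightarrow> u t l = p t"
      using ex_solenoid_path_lift[OF x pp(1-3)] by blast
    have u0: "u t 0 = (bonding_map q l \<circ> p) t" if "t \<in> {0..1}" for t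
      using bonding_map_solenoid[OF solenoid_path_mem[OF u(1) that], of l] u(3)[OF that] by simp
    have "path (bonding_map q l \<circ> p)"
      using pp by (intro path_continuous_image) (auto intro: continuous_on_subset[OF continuous_bonding_map])
    then have loop: "bonding_map q l \<circ> p \<in> loops_at (M 0) (x 0)"
      using pp bonding_map_mem bonding_map_solenoid[OF x]
      by (auto simp: loops_at_def path_image_compose pathstart_compose pathfinish_compose)
    have "transport (bonding_map q l \<circ> p) x (u 1)"
      unfolding transport_def using u u0 by blast
    then have "monodromy g x = u 1"
      unfolding p(2) by (rule monodromy_eqI[OF loop])
    then show "g \<in> {g \<in> carrier (fundamental_group (M 0) (x 0)). monodromy g x l = x l}"
      using loop u(3)[of 1] pp p by (auto simp: carrier_fundamental_group pathfinish_def)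
  next
    fix g assume "g \<in> {g \<in> carrier (fundamental_group (M 0) (x 0)). monodromy g x l = x l}"
    then obtain p where p: "p \<in> loops_at (M 0) (x 0)" "g = path_class (M 0) p" "monodromy g x l = x l"
      by (auto simp: carrier_fundamental_group)
    have "transport p x (monodromy g x)"
      using transport_monodromy[OF p(1) x] p by simp
    then obtain u where u: "solenoid_path u" "u 0 = x" "u 1 = monodromy g x" "\<forall>t\<in>{0..1}. u t 0 = p t"
      unfolding transport_def by blast
    let ?r = "\<lambda>t. u t l"
    have r: "?r \<in> loops_at (M l) (x l)"
      using solenoid_path_coordinate[OF u(1)] u p by (simp add: loops_at_def pathstart_def pathfinish_def)
    have "homotopic_paths (M 0) p (bonding_map q l \<circ> ?r)"
    proof (rule homotopic_paths_eq)
      show "path p" "path_image p \<subseteq> M 0" using p by (auto simp: loops_at_def)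
      show "p t = (bonding_map q l \<circ> ?r) t" if "t \<in> {0..1}" for t
        using bonding_map_solenoid[OF solenoid_path_mem[OF u(1) that], of l] u(4) that by simp
    qed
    then have "g = induced_hom (M 0) (bonding_map q l) (path_class (M l) ?r)"
      using hom[OF r] p(2) path_class_eqI by simp
    then show "g \<in> presentation_chain M q x l"
      unfolding presentation_chain_def carrier_fundamental_group using r by blast
  qed
qed

lemma chain_action_monodromy:
  assumes x: "x \<in> S"
  shows "chain_action (fundamental_group (M 0) (x 0)) (presentation_chain M q x) {z \<in> S. z 0 = x 0} monodromy x"
proof -
  let ?G = "fundamental_group (M 0) (x 0)" and ?\<Phi> = "{z \<in> S. z 0 = x 0}"
  interpret group ?G
    using group_fundamental_group solenoid_mem[OF x] by blast
  have tr: "\<exists>p\<in>loops_at (M 0) (x 0). g = path_class (M 0) p \<and> (\<forall>z\<in>?\<Phi>. transport p z (monodromy g z))"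
    if "g \<in> carrier ?G" for g
    using that transport_monodromy by (auto simp: carrier_fundamental_group)
  show ?thesis
  proof
    fix g z assume g: "g \<in> carrier ?G" "z \<in> ?\<Phi>"
    then show "monodromy g z \<in> ?\<Phi>"
      using tr[OF g(1)] transport_mem(2) transport_ends(2)
      unfolding loops_at_def pathfinish_def by (metis (mono_tags, lifting) mem_Collect_eq)
  next
    fix g h z assume g: "g \<in> carrier ?G" "h \<in> carrier ?G" "z \<in> ?\<Phi>"
    obtain p where p: "p \<in> loops_at (M 0) (x 0)" "g = path_class (M 0) p" "\<forall>z\<in>?\<Phi>. transport p z (monodromy g z)"
      using tr[OF g(1)] by blast
    obtain r where r: "r \<in> loops_at (M 0) (x 0)" "h = path_class (M 0) r" "\<forall>z\<in>?\<Phi>. transport r z (monodromy h z)"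
      using tr[OF g(2)] by blast
    have 1: "transport p z (monodromy g z)" using p g by blast
    then have "monodromy g z \<in> ?\<Phi>"
      using transport_mem(2)[OF 1] transport_ends(2)[OF 1] p(1) by (simp add: loops_at_def pathfinish_def)
    then have "transport r (monodromy g z) (monodromy h (monodromy g z))"
      using r by blast
    then have "transport (p +++ r) z (monodromy h (monodromy g z))"
      using 1 transport_join by blast
    then show "monodromy (g \<otimes>\<^bsub>?G\<^esub> h) z = monodromy h (monodromy g z)"
      using p r monodromy_eqI[OF loops_at_join[OF p(1) r(1)]] by (simp add: fundamental_group_mult)
  next
    fix z assume z: "z \<in> ?\<Phi>"
    have "solenoid_path (\<lambda>_. z)"
      using z by (auto simp: solenoid_path_def path_def path_image_def)
    then have "transport (\<lambda>_. x 0) z z"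
      using z unfolding transport_def by (intro exI[of _ "\<lambda>_. z"]) auto
    then show "monodromy \<one>\<^bsub>?G\<^esub> z = z"
      unfolding one_fundamental_group using monodromy_eqI loops_at_const solenoid_mem[OF x] by blast
  next
    fix g z w l assume "g \<in> carrier ?G" "z \<in> ?\<Phi>" "w \<in> ?\<Phi>" "z l = w l"
    then show "monodromy g z l = monodromy g w l"
      using tr[of g] transport_level by blast
  next
    show "presentation_chain M q x l = {g \<in> carrier ?G. monodromy g x l = x l}" for l
      by (rule presentation_chain_eq[OF x])
  qed (use level_antimono finite_fibre_level x in auto)
qed

section \<open>Compactness and uniform levels\<close>

text \<open>\<open>S\<close> is closed in a product of compact spaces, being cut out by equations
  between maps into Hausdorff spaces. The product is formed from the subspaces, because the ambient
  type is not assumed Hausdorff.\<close>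

lemma compact_solenoid: "compact S"
proof -
  let ?Z = "product_topology (\<lambda>l. top_of_set (M l)) UNIV"
  have Z: "?Z = top_of_set (\<Pi>\<^sub>E l\<in>UNIV. M l)"
    by (simp add: euclidean_product_topology flip: subtopology_product_topology)
  have "compact_space ?Z"
    using manifold by (simp add: compact_space_product_topology closed_manifold_def compact_space_subtopology compactin_euclidean_iff)
  moreover have "closedin ?Z S"
  proof -
    have "closedin ?Z {z \<in> topspace ?Z. q (Suc l) (z (Suc l)) = z l}" for l
    proof (rule closedin_continuous_maps_eq)
      show "Hausdorff_space (top_of_set (M l))"
        using manifold[of l] by (simp add: closed_manifold_def)
      have pr: "continuous_map ?Z (top_of_set (M k)) (\<lambda>z. z k)" for k
        by (rule continuous_map_product_projection) simp
      then show "continuous_map ?Z (top_of_set (M l)) (\<lambda>z. z l)" .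
      have "continuous_map (top_of_set (M (Suc l))) (top_of_set (M l)) (q (Suc l))"
        using continuous_bonding[of l] bonding_image[of l] by (auto simp: continuous_map_subtopology_eu)
      then show "continuous_map ?Z (top_of_set (M l)) (\<lambda>z. q (Suc l) (z (Suc l)))"
        using continuous_map_compose[OF pr[of "Suc l"]] unfolding o_def by blast
    qed
    then have "closedin ?Z (\<Inter>l. {z \<in> topspace ?Z. q (Suc l) (z (Suc l)) = z l})"
      by (intro closedin_Inter) auto
    moreover have "(\<Inter>l. {z \<in> topspace ?Z. q (Suc l) (z (Suc l)) = z l}) = S"
      using solenoid_mem solenoid_step by (auto intro!: solenoidI simp: PiE_iff)
    ultimately show ?thesis by simp
  qed
  ultimately have "compactin ?Z S"
    using closedin_compact_space by blast
  then show ?thesis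
    unfolding Z by (simp add: compactin_subtopology)
qed

lemma ex_higher_level_open:
  assumes "l \<le> m" "openin (top_of_set (M l)) U"
  obtains U' where "openin (top_of_set (M m)) U'" "\<And>z. z \<in> S \<Longrightarrow> z m \<in> U' \<longleftrightarrow> z l \<in> U"
proof -
  have "\<exists>U'. openin (top_of_set (M m)) U' \<and> (\<forall>z\<in>S. z m \<in> U' \<longleftrightarrow> z l \<in> U)"
    using assms(1)
  proof (induction m rule: dec_induct)
    case base
    then show ?case using assms(2) by blast
  next
    case (step m)
    then obtain U' where U': "openin (top_of_set (M m)) U'" "\<forall>z\<in>S. z m \<in> U' \<longleftrightarrow> z l \<in> U" by blast
    have "openin (top_of_set (M (Suc m))) (M (Suc m) \<inter> q (Suc m) -` U')"
      using openin_preimage[OF continuous_bonding _ U'(1)] bonding_image by blast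
    then show ?case
      using U'(2) solenoid_mem solenoid_step by (intro exI[of _ "M (Suc m) \<inter> q (Suc m) -` U'"]) auto
  qed
  then show ?thesis using that by blast
qed

text \<open>Conditions on one coordinate form a basis: finitely many of them are all visible at the
  largest level involved.\<close>

lemma solenoid_neighbourhood:
  assumes W: "openin (top_of_set S) W" and a: "a \<in> W"
  obtains l U where "openin (top_of_set (M l)) U" "a l \<in> U" "\<And>z. z \<in> S \<Longrightarrow> z l \<in> U \<Longrightarrow> z \<in> W"
proof -
  have aS: "a \<in> S" using W a openin_imp_subset by blast
  obtain W' where W': "open W'" "W = S \<inter> W'"
    using W unfolding openin_open by blast
  then have "openin (product_topology (\<lambda>i. euclidean) UNIV) W'" "a \<in> W'"
    using a by (auto simp: open_fun_def)
  then obtain X where X: "a \<in> (\<Pi>\<^sub>E i\<in>UNIV. X i)" "\<And>i. open (X i)" "finite {i. X i \<noteq> UNIV}" "(\<Pi>\<^sub>E i\<in>UNIV. X i) \<subseteq> W'"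
    using product_topology_open_contains_basis[of "\<lambda>i. euclidean" UNIV W' a] by auto
  have "\<exists>l U. openin (top_of_set (M l)) U \<and> a l \<in> U \<and> (\<forall>z\<in>S. z l \<in> U \<longrightarrow> (\<forall>i\<in>I. z i \<in> X i))" if "finite I" for I
    using that
  proof (induction I)
    case empty
    then show ?case using solenoid_mem[OF aS] by (intro exI[of _ 0] exI[of _ "M 0"]) auto
  next
    case (insert i I)
    then obtain l U where U: "openin (top_of_set (M l)) U" "a l \<in> U" "\<forall>z\<in>S. z l \<in> U \<longrightarrow> (\<forall>i\<in>I. z i \<in> X i)"
      by blast
    let ?m = "max l i"
    obtain U1 where U1: "openin (top_of_set (M ?m)) U1" "\<And>z. z \<in> S \<Longrightarrow> z ?m \<in> U1 \<longleftrightarrow> z l \<in> U"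
      using ex_higher_level_open[OF _ U(1), of ?m] by auto
    have "openin (top_of_set (M i)) (M i \<inter> X i)"
      using X(2) by (auto simp: openin_open)
    then obtain U2 where U2: "openin (top_of_set (M ?m)) U2" "\<And>z. z \<in> S \<Longrightarrow> z ?m \<in> U2 \<longleftrightarrow> z i \<in> M i \<inter> X i"
      using ex_higher_level_open[OF max.cobounded2] by blast
    have "a i \<in> X i" using X(1) by blast
    then have "a ?m \<in> U1 \<inter> U2"
      using U1(2)[OF aS] U2(2)[OF aS] U(2) solenoid_mem[OF aS] by simp
    moreover have "z i' \<in> X i'" if "z \<in> S" "z ?m \<in> U1 \<inter> U2" "i' \<in> insert i I" for z i'
      using U1(2)[OF that(1)] U2(2)[OF that(1)] U(3) that by auto
    ultimately show ?case
      using U1(1) U2(1) by (intro exI[of _ ?m] exI[of _ "U1 \<inter> U2"]) auto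
  qed
  from this[OF X(3)] obtain l U where U: "openin (top_of_set (M l)) U" "a l \<in> U" "\<forall>z\<in>S. z l \<in> U \<longrightarrow> (\<forall>i\<in>{i. X i \<noteq> UNIV}. z i \<in> X i)"
    by blast
  have "z \<in> W" if "z \<in> S" "z l \<in> U" for z
  proof -
    have "z i \<in> X i" for i using U(3) that by (cases "X i = UNIV") auto
    then have "z \<in> W'" using X(4) by auto
    then show ?thesis using W' that by simp
  qed
  then show ?thesis using that U by blast
qed

lemma openin_level_preimage: "openin (top_of_set (M l)) U \<Longrightarrow> openin (top_of_set S) {z \<in> S. z l \<in> U}"
proof -
  assume "openin (top_of_set (M l)) U"
  moreover have "continuous_on S (\<lambda>z. z l)"
    by (rule continuous_on_product_then_coordinatewise[OF continuous_on_id])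
  ultimately have "openin (top_of_set S) (S \<inter> (\<lambda>z. z l) -` U)"
    using solenoid_mem by (intro openin_preimage[of S "\<lambda>z. z l" "M l"]) auto
  moreover have "S \<inter> (\<lambda>z. z l) -` U = {z \<in> S. z l \<in> U}" by blast
  ultimately show ?thesis by simp
qed

text \<open>Any point of \<open>S\<close> can be moved along a lifted path of the path-connected
  \<open>M l\<close>.\<close>

lemma level_surjective:
  assumes "S \<noteq> {}" "y \<in> M l"
  obtains z where "z \<in> S" "z l = y"
proof -
  obtain a where a: "a \<in> S" using assms by blast
  obtain p where p: "path p" "path_image p \<subseteq> M l" "pathstart p = a l" "pathfinish p = y"
    using path_connected_level[of l] solenoid_mem[OF a] assms(2) unfolding path_connected_def by metis
  obtain u where u: "solenoid_path u" "u 0 = a" "\<And>t. t \<in> {0..1} \<Longrightarrow> u t l = p t"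
    using ex_solenoid_path_lift[OF a p(1-3)] by blast
  show ?thesis
    using that[of "u 1"] u(3)[of 1] p(4) solenoid_path_mem[OF u(1), of 1] by (simp add: pathfinish_def)
qed

text \<open>The Lebesgue number of a cover takes the form of a level: finitely many sets, each given
  by one coordinate, cover \<open>S\<close>, and the largest of their levels sees them all.
  Neighbourhoods in \<open>M k\<close> are produced so that continuity of paths in
  \<open>M k\<close> can be used.\<close>

lemma level_Lebesgue:
  assumes "S \<noteq> {}" and W: "\<And>z. z \<in> S \<Longrightarrow> \<exists>i\<in>I. openin (top_of_set S) (W i) \<and> z \<in> W i"
  shows "\<exists>k. \<forall>y\<in>M k. \<exists>U. openin (top_of_set (M k)) U \<and> y \<in> U \<and> (\<exists>i\<in>I. \<forall>z\<in>S. z k \<in> U \<longrightarrow> z \<in> W i)"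
proof -
  have "\<exists>l U. openin (top_of_set (M l)) U \<and> z l \<in> U \<and> (\<exists>i\<in>I. \<forall>w\<in>S. w l \<in> U \<longrightarrow> w \<in> W i)" if z: "z \<in> S" for z
  proof -
    obtain i where i: "i \<in> I" "openin (top_of_set S) (W i)" "z \<in> W i" using W[OF z] by blast
    show ?thesis
      by (rule solenoid_neighbourhood[OF i(2,3)]) (use i(1) in blast)
  qed
  then obtain l U where lU: "\<And>z. z \<in> S \<Longrightarrow> openin (top_of_set (M (l z))) (U z) \<and> z (l z) \<in> U z \<and> (\<exists>i\<in>I. \<forall>w\<in>S. w (l z) \<in> U z \<longrightarrow> w \<in> W i)"
    by metis
  define N where "N z = {w \<in> S. w (l z) \<in> U z}" for z
  have "\<forall>c\<in>N ` S. openin (top_of_set S) c" "S \<subseteq> \<Union>(N ` S)"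
    using openin_level_preimage lU unfolding N_def by auto
  then obtain \<D> where "\<D> \<subseteq> N ` S" "finite \<D>" "S \<subseteq> \<Union>\<D>"
    using compact_solenoid unfolding compact_eq_openin_cover by meson
  then obtain Y where Y: "Y \<subseteq> S" "finite Y" "S \<subseteq> \<Union>(N ` Y)"
    by (metis finite_subset_image)
  define k where "k = Max (insert 0 (l ` Y))"
  show ?thesis
  proof (intro exI[of _ k] ballI)
    fix y assume "y \<in> M k"
    then obtain z where z: "z \<in> S" "z k = y" using level_surjective assms(1) by blast
    then obtain a where a: "a \<in> Y" "z \<in> N a" using Y by blast
    then have "l a \<le> k" "a \<in> S" unfolding k_def using Y by auto
    then obtain U' where U': "openin (top_of_set (M k)) U'" "\<And>z. z \<in> S \<Longrightarrow> z k \<in> U' \<longleftrightarrow> z (l a) \<in> U a"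
      using ex_higher_level_open lU by metis
    then show "\<exists>U. openin (top_of_set (M k)) U \<and> y \<in> U \<and> (\<exists>i\<in>I. \<forall>z\<in>S. z k \<in> U \<longrightarrow> z \<in> W i)"
      using a(2) z lU[OF \<open>a \<in> S\<close>] unfolding N_def by (intro exI[of _ U']) auto
  qed
qed

text \<open>The fibre is closed because \<open>M k\<close> is Hausdorff; its complement joins the
  cover of the compact space \<open>S\<close> and is discarded afterwards.\<close>

lemma fibre_finite_subcover:
  assumes W: "\<And>a. a \<in> S \<Longrightarrow> a k = c \<Longrightarrow> openin (top_of_set S) (W a) \<and> a \<in> W a" and "c \<in> M k"
  obtains A where "finite A" "A \<subseteq> {z \<in> S. z k = c}" "{z \<in> S. z k = c} \<subseteq> \<Union>(W ` A)"
proof -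
  let ?F = "{z \<in> S. z k = c}"
  have "closedin (top_of_set (M k)) {c}"
    using manifold[of k] assms(2) by (intro closedin_Hausdorff_singleton) (auto simp: closed_manifold_def)
  then have "openin (top_of_set (M k)) (M k - {c})"
    by (simp add: closedin_def)
  then have "openin (top_of_set S) {z \<in> S. z k \<in> M k - {c}}"
    by (rule openin_level_preimage)
  moreover have "{z \<in> S. z k \<in> M k - {c}} = S - ?F"
    using solenoid_mem by auto
  ultimately have "openin (top_of_set S) (S - ?F)" by simp
  then have "\<forall>c\<in>insert (S - ?F) (W ` ?F). openin (top_of_set S) c" "S \<subseteq> \<Union>(insert (S - ?F) (W ` ?F))"
    using W by auto
  then obtain \<D> where \<D>: "\<D> \<subseteq> insert (S - ?F) (W ` ?F)" "finite \<D>" "S \<subseteq> \<Union>\<D>"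
    using compact_solenoid unfolding compact_eq_openin_cover by meson
  then have "\<D> - {S - ?F} \<subseteq> W ` ?F" "finite (\<D> - {S - ?F})" by auto
  from finite_subset_image[OF this(2,1)]
  obtain A where "A \<subseteq> ?F \<and> finite A \<and> \<D> - {S - ?F} = W ` A"
    by (rule exE)
  then have A: "A \<subseteq> ?F" "finite A" "\<D> - {S - ?F} = W ` A" by simp_all
  have "?F \<subseteq> \<Union>(\<D> - {S - ?F})"
    using \<D>(3) by blast
  then have "?F \<subseteq> \<Union>(W ` A)" by (simp only: A(3))
  then show ?thesis using that[OF A(2,1)] by blast
qed

text \<open>Each point has a neighbourhood, given by one coordinate, on which \<open>r\<close> is
  constant along the fibre. The largest level in a finite subcover serves all pairs.\<close>

lemma fibre_uniform_level:
  assumes r: "\<And>a. a \<in> S \<Longrightarrow> a k = c \<Longrightarrow>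
      \<exists>W. openin (top_of_set S) W \<and> a \<in> W \<and> (\<forall>b\<in>W. b k = c \<longrightarrow> r b = r a)"
    and "c \<in> M k"
  shows "\<exists>l. \<forall>a\<in>S. \<forall>b\<in>S. a k = c \<longrightarrow> b k = c \<longrightarrow> a l = b l \<longrightarrow> r a = r b"
proof -
  have "\<exists>l U. openin (top_of_set (M l)) U \<and> a l \<in> U \<and> (\<forall>b\<in>S. b l \<in> U \<longrightarrow> b k = c \<longrightarrow> r b = r a)" if a: "a \<in> S" "a k = c" for a
  proof -
    obtain W where W: "openin (top_of_set S) W" "a \<in> W" "\<forall>b\<in>W. b k = c \<longrightarrow> r b = r a"
      using r[OF a] by blast
    show ?thesis
      by (rule solenoid_neighbourhood[OF W(1,2)]) (use W(3) in blast)
  qed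
  then obtain l U where lU: "\<And>a. a \<in> S \<Longrightarrow> a k = c \<Longrightarrow> openin (top_of_set (M (l a))) (U a) \<and> a (l a) \<in> U a \<and>
      (\<forall>b\<in>S. b (l a) \<in> U a \<longrightarrow> b k = c \<longrightarrow> r b = r a)"
    by metis
  obtain A where A: "finite A" "A \<subseteq> {z \<in> S. z k = c}" "{z \<in> S. z k = c} \<subseteq> \<Union>((\<lambda>a. {z \<in> S. z (l a) \<in> U a}) ` A)"
  proof (rule fibre_finite_subcover[of k c "\<lambda>a. {z \<in> S. z (l a) \<in> U a}"])
    show "openin (top_of_set S) {z \<in> S. z (l a) \<in> U a} \<and> a \<in> {z \<in> S. z (l a) \<in> U a}" if "a \<in> S" "a k = c" for a
      using lU[OF that] that openin_level_preimage by blast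
  qed (use assms(2) in auto)
  show ?thesis
  proof (intro exI[of _ "Max (insert 0 (l ` A))"] ballI impI)
    fix a b assume ab: "a \<in> S" "b \<in> S" "a k = c" "b k = c" and eq: "a (Max (insert 0 (l ` A))) = b (Max (insert 0 (l ` A)))"
    obtain d where d: "d \<in> A" "a (l d) \<in> U d" using A(3) ab by blast
    have "l d \<le> Max (insert 0 (l ` A))" using A(1) d(1) by simp
    then have "b (l d) \<in> U d"
      using level_antimono[OF ab(1,2) _ eq] d(2) by metis
    moreover have "d \<in> S" "d k = c" using A(2) d(1) by blast+
    ultimately show "r a = r b"
      using lU[of d] d(2) ab by metis
  qed
qed

end

section \<open>Comparing homeomorphic solenoidal manifolds\<close>

context solenoid begin

text \<open>The points reachable from \<open>a\<close> form its plaque over \<open>B\<close>, the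
  path component of \<open>a\<close> among the points of \<open>S\<close> with coordinate
  \<open>j\<close> in \<open>B\<close>.\<close>

definition reach :: "nat \<Rightarrow> 'a set \<Rightarrow> (nat \<Rightarrow> 'a) \<Rightarrow> (nat \<Rightarrow> 'a) \<Rightarrow> bool" where
  "reach j B a b \<longleftrightarrow> (\<exists>u. solenoid_path u \<and> u 0 = a \<and> u 1 = b \<and> (\<forall>t\<in>{0..1}. u t j \<in> B))"

lemma reach_mem: "reach j B a b \<Longrightarrow> a \<in> S \<and> b \<in> S \<and> a j \<in> B \<and> b j \<in> B"
  unfolding reach_def using solenoid_path_mem by fastforce

lemma reach_sym: "reach j B a b \<Longrightarrow> reach j B b a"
proof -
  assume "reach j B a b"
  then obtain u where "solenoid_path u" "u 0 = a" "u 1 = b" "\<forall>t\<in>{0..1}. u t j \<in> B"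
    unfolding reach_def by blast
  then show ?thesis
    unfolding reach_def by (intro exI[of _ "reversepath u"]) (simp add: solenoid_path_reverse, simp add: reversepath_def)
qed

lemma reach_trans: "reach j B a b \<Longrightarrow> reach j B b c \<Longrightarrow> reach j B a c"
proof -
  assume "reach j B a b" "reach j B b c"
  then obtain u v where u: "solenoid_path u" "u 0 = a" "u 1 = b" "\<forall>t\<in>{0..1}. u t j \<in> B"
      and v: "solenoid_path v" "v 0 = b" "v 1 = c" "\<forall>t\<in>{0..1}. v t j \<in> B"
    unfolding reach_def by blast
  then have "solenoid_path (u +++ v)" using solenoid_path_join by simp
  then show ?thesis
    unfolding reach_def using u v by (intro exI[of _ "u +++ v"]) (auto simp: joinpaths_def)
qed

lemma reach_refl: "a \<in> S \<Longrightarrow> a j \<in> B \<Longrightarrow> reach j B a a"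
  unfolding reach_def by (intro exI[of _ "\<lambda>_. a"]) (auto simp: solenoid_path_def path_def path_image_def)

lemma reach_mono:
  assumes "reach j B a b" "\<And>z. z \<in> S \<Longrightarrow> z j \<in> B \<Longrightarrow> z m \<in> B'"
  shows "reach m B' a b"
  using assms solenoid_path_mem unfolding reach_def by metis

text \<open>Comparison with the constant path at \<open>a\<close>: a plaque over an inessential set
  has at most one point above each point of that set.\<close>

lemma reach_unique:
  assumes B: "inessential_in (M j) B" and ab: "reach j B a b" and "a j = b j"
  shows "a = b"
proof -
  obtain u where u: "solenoid_path u" "u 0 = a" "u 1 = b" "\<forall>t\<in>{0..1}. u t j \<in> B"
    using ab unfolding reach_def by blast
  have a: "a \<in> S" "a j \<in> B" using reach_mem[OF ab] by auto
  have "solenoid_path (\<lambda>_. a)"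
    using a by (auto simp: solenoid_path_def path_def path_image_def)
  then have "u 1 = (\<lambda>_. a) (1::real)"
    by (rule inessential_solenoid_paths[OF B u(1)]) (use u a assms(3) in auto)
  then show ?thesis using u by simp
qed

text \<open>\<open>e\<close> moves parallel to \<open>u\<close>, along the lift of coordinate
  \<open>m\<close> of \<open>u\<close>. Because \<open>j \<le> m\<close>, the motion has the same
  coordinate \<open>j\<close> as \<open>u\<close> and stays over \<open>B\<close>.\<close>

lemma reach_lift:
  assumes "solenoid_path u" "\<And>t. t \<in> {0..1} \<Longrightarrow> u t j \<in> B" "e \<in> S" "e m = u 0 m" "j \<le> m"
  obtains e' where "reach j B e e'" "e' m = u 1 m" "transport (\<lambda>t. u t 0) e e'"
proof -
  obtain v where v: "solenoid_path v" "v 0 = e" "\<And>t. t \<in> {0..1} \<Longrightarrow> v t m = u t m"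
    using ex_solenoid_path_lift[OF assms(3), of "\<lambda>t. u t m" m] solenoid_path_coordinate[OF assms(1)] assms(4)
    by (metis pathstart_def)
  have eq: "v t l = u t l" if "t \<in> {0..1}" "l \<le> m" for t l
    by (rule level_antimono[OF solenoid_path_mem solenoid_path_mem that(2)]) (use v assms(1) that in simp_all)
  have "reach j B e (v 1)"
    unfolding reach_def using v eq assms by (intro exI[of _ v]) simp
  moreover have "transport (\<lambda>t. u t 0) e (v 1)"
    unfolding transport_def using v eq by (intro exI[of _ v]) simp
  ultimately show ?thesis using that v(3)[of 1] by simp
qed

lemma ex_reach:
  assumes "path_connected B" "B \<subseteq> M j" "a \<in> S" "a j \<in> B" "y \<in> B"
  obtains b where "reach j B a b" "b j = y"
proof -
  obtain p where p: "path p" "path_image p \<subseteq> B" "pathstart p = a j" "pathfinish p = y"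
    using assms unfolding path_connected_def by metis
  obtain u where u: "solenoid_path u" "u 0 = a" "\<And>t. t \<in> {0..1} \<Longrightarrow> u t j = p t"
    using ex_solenoid_path_lift[OF assms(3) p(1) _ p(3)] p(2) assms(2) by blast
  have "reach j B a (u 1)"
    unfolding reach_def using u p(2) by (intro exI[of _ u]) (auto simp: path_image_def)
  then show ?thesis
    using that u(3)[of 1] p(4) by (simp add: pathfinish_def)
qed

lemma reach_subpath:
  assumes u: "solenoid_path u" and s: "0 \<le> s" "s \<le> s'" "s' \<le> 1"
    and B: "\<And>t. s \<le> t \<Longrightarrow> t \<le> s' \<Longrightarrow> u t j \<in> B"
  shows "reach j B (u s) (u s')"
proof -
  let ?a = "\<lambda>t. (s' - s) * t + s"
  have a: "s \<le> ?a t" "?a t \<le> s'" if "t \<in> {0..1}" for t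
  proof -
    show "s \<le> ?a t" using that s by simp
    have "(s' - s) * t \<le> (s' - s) * 1" using that s by (intro mult_left_mono) auto
    then show "?a t \<le> s'" by simp
  qed
  have cu: "continuous_on {0..1} u" using u by (simp add: solenoid_path_def path_def)
  have ca: "continuous_on {0..1} ?a" by (intro continuous_intros)
  have "?a t \<in> {0..1}" if "t \<in> {0..1}" for t
    using a[OF that] s by simp
  then have "?a ` {0..1} \<subseteq> {0..1}" by blast
  then have "continuous_on {0..1} (u \<circ> ?a)"
    by (rule continuous_on_compose[OF ca continuous_on_subset[OF cu]])
  moreover have "u (?a t) \<in> S" if "t \<in> {0..1}" for t
    using solenoid_path_mem[OF u] a[OF that] s by simp
  ultimately have "solenoid_path (u \<circ> ?a)"
    by (auto simp: solenoid_path_def path_def path_image_def)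
  then show ?thesis
    unfolding reach_def using a B by (intro exI[of _ "u \<circ> ?a"]) auto
qed

lemma transport_cong:
  "transport p z w \<Longrightarrow> (\<And>t. t \<in> {0..1} \<Longrightarrow> p t = r t) \<Longrightarrow> transport r z w"
  unfolding transport_def by metis

lemma solenoid_path_loop:
  assumes "solenoid_path u" "u 0 0 = y" "u 1 0 = y"
  shows "(\<lambda>t. u t 0) \<in> loops_at (M 0) y"
  using solenoid_path_coordinate[OF assms(1)] assms(2,3)
  by (simp add: loops_at_def pathstart_def pathfinish_def)

end

text \<open>
  The members of \<open>\<Q>\<close> are so small that \<open>h'\<close> maps the plaques over them to small sets of \<open>M 0\<close>,
  and \<open>M k\<close> resolves the \<open>j\<close>-th coordinate of \<open>h\<close> up to \<open>\<Q>\<close>.  The basepoints \<open>x\<close> and \<open>x'\<close> are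
  unrelated; \<open>x1\<close> is a point of the fibre of \<open>x\<close> over \<open>M k\<close> whose image lies on the leaf of \<open>x'\<close>.
\<close>

locale solenoid_comparison = X: solenoid n M q + X': solenoid n' M' q'
  for n n' :: nat and M :: "nat \<Rightarrow> 'a::topological_space set" and q :: "nat \<Rightarrow> 'a \<Rightarrow> 'a"
    and M' :: "nat \<Rightarrow> 'b::topological_space set" and q' :: "nat \<Rightarrow> 'b \<Rightarrow> 'b" +
  fixes h :: "(nat \<Rightarrow> 'a) \<Rightarrow> nat \<Rightarrow> 'b" and h' :: "(nat \<Rightarrow> 'b) \<Rightarrow> nat \<Rightarrow> 'a"
    and j k :: nat and \<Q> :: "'b set set" and Q0 :: "'b set" and O0 :: "'a set"
    and x x1 :: "nat \<Rightarrow> 'a" and x' :: "nat \<Rightarrow> 'b" and c :: "real \<Rightarrow> nat \<Rightarrow> 'b"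
  assumes homeo: "homeomorphism X.S X'.S h h'"
    and \<Q>: "Q \<in> \<Q> \<Longrightarrow> openin (top_of_set (M' j)) Q \<and> path_connected Q"
    and \<Q>_star: "Q \<in> \<Q> \<Longrightarrow> Q' \<in> \<Q> \<Longrightarrow> Q \<inter> Q' \<noteq> {} \<Longrightarrow> \<exists>B. inessential_in (M' j) B \<and> Q \<union> Q' \<subseteq> B"
    and \<Q>_small: "Q \<in> \<Q> \<Longrightarrow> \<exists>A. openin (top_of_set (M 0)) A \<and> inessential_in (M 0) A \<and>
        (\<forall>z\<in>X'.S. z j \<in> Q \<longrightarrow> h' z 0 \<in> A)"
    and k_fine: "y \<in> M k \<Longrightarrow> \<exists>U. openin (top_of_set (M k)) U \<and> y \<in> U \<and> (\<exists>Q\<in>\<Q>. \<forall>z\<in>X.S. z k \<in> U \<longrightarrow> h z j \<in> Q)"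
    and x: "x \<in> X.S" and x1: "x1 \<in> X.S" "x1 k = x k"
    and O0: "openin (top_of_set (M k)) O0" "x k \<in> O0"
    and Q0: "Q0 \<in> \<Q>" "z \<in> X.S \<Longrightarrow> z k \<in> O0 \<Longrightarrow> h z j \<in> Q0"
    and c: "X'.solenoid_path c" "c 0 = x'" "c 1 = h x1"
begin

definition F :: "(nat \<Rightarrow> 'a) set" where "F = {a \<in> X.S. a k = x k}"

lemma F: "a \<in> F \<longleftrightarrow> a \<in> X.S \<and> a k = x k" by (simp add: F_def)

lemma h_mem: "z \<in> X.S \<Longrightarrow> h z \<in> X'.S" and h'_mem: "w \<in> X'.S \<Longrightarrow> h' w \<in> X.S"
  and h'_h: "z \<in> X.S \<Longrightarrow> h' (h z) = z" and h_h': "w \<in> X'.S \<Longrightarrow> h (h' w) = w"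
  and continuous_h: "continuous_on X.S h" and continuous_h': "continuous_on X'.S h'"
  using homeo by (auto simp: homeomorphism_def)

lemma h_path: "X.solenoid_path u \<Longrightarrow> X'.solenoid_path (h \<circ> u)"
  using h_mem continuous_on_subset[OF continuous_h] unfolding X.solenoid_path_def X'.solenoid_path_def
  by (auto intro!: path_continuous_image simp: path_image_compose)

lemma h'_path: "X'.solenoid_path u \<Longrightarrow> X.solenoid_path (h' \<circ> u)"
  using h'_mem continuous_on_subset[OF continuous_h'] unfolding X.solenoid_path_def X'.solenoid_path_def
  by (auto intro!: path_continuous_image simp: path_image_compose)

lemma h_reach:
  assumes "X.reach m B a b" "\<And>z. z \<in> X.S \<Longrightarrow> z m \<in> B \<Longrightarrow> h z l \<in> B'"
  shows "X'.reach l B' (h a) (h b)"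
proof -
  obtain u where u: "X.solenoid_path u" "u 0 = a" "u 1 = b" "\<forall>t\<in>{0..1}. u t m \<in> B"
    using assms(1) unfolding X.reach_def by blast
  show ?thesis
    unfolding X'.reach_def
    using u h_path X.solenoid_path_mem[OF u(1)] assms(2) by (intro exI[of _ "h \<circ> u"]) simp
qed

lemma h'_reach:
  assumes "X'.reach m B a b" "\<And>z. z \<in> X'.S \<Longrightarrow> z m \<in> B \<Longrightarrow> h' z l \<in> B'"
  shows "X.reach l B' (h' a) (h' b)"
proof -
  obtain u where u: "X'.solenoid_path u" "u 0 = a" "u 1 = b" "\<forall>t\<in>{0..1}. u t m \<in> B"
    using assms(1) unfolding X'.reach_def by blast
  show ?thesis
    unfolding X.reach_def
    using u h'_path X'.solenoid_path_mem[OF u(1)] assms(2) by (intro exI[of _ "h' \<circ> u"]) simp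
qed

lemma \<Q>_subset: "Q \<in> \<Q> \<Longrightarrow> Q \<subseteq> M' j"
  using \<Q> openin_imp_subset by blast

lemma \<Q>_unique:
  assumes "Q \<in> \<Q>" "X'.reach j Q a b" "a j = b j"
  shows "a = b"
proof -
  have "Q \<inter> Q \<noteq> {}" using X'.reach_mem[OF assms(2)] by blast
  then obtain B where B: "inessential_in (M' j) B" "Q \<union> Q \<subseteq> B" using \<Q>_star assms(1) by meson
  then have "X'.reach j B a b" using X'.reach_mono[OF assms(2)] by blast
  then show ?thesis using X'.reach_unique B(1) assms(3) by blast
qed

text \<open>Plaques over intersecting sets of \<open>\<Q>\<close> agree, because both lie in an inessential set.\<close>

lemma \<Q>_change:
  assumes Q: "Q \<in> \<Q>" "Q' \<in> \<Q>" and ab: "X'.reach j Q a b" and "a j \<in> Q'" "b j \<in> Q'"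
  shows "X'.reach j Q' a b"
proof -
  have "Q \<inter> Q' \<noteq> {}" using X'.reach_mem[OF ab] assms(4) by blast
  then obtain B where B: "inessential_in (M' j) B" "Q \<union> Q' \<subseteq> B" using \<Q>_star Q by meson
  have pc: "path_connected Q'" using \<Q> Q(2) by blast
  have aS: "a \<in> X'.S" using X'.reach_mem[OF ab] by blast
  obtain b' where b': "X'.reach j Q' a b'" "b' j = b j"
    using X'.ex_reach[OF pc \<Q>_subset[OF Q(2)] aS assms(4,5)] by blast
  have "X'.reach j B a b" "X'.reach j B a b'"
    using X'.reach_mono[OF ab] X'.reach_mono[OF b'(1)] B(2) by blast+
  then have "X'.reach j B b' b" using X'.reach_sym X'.reach_trans by blast
  then have "b' = b" using X'.reach_unique[OF B(1)] b'(2) by blast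
  then show ?thesis using b' by simp
qed

text \<open>\<open>\<beta>\<close> is parallel to \<open>\<alpha>\<close> at level \<open>k\<close>,
  and \<open>u\<close> is parallel to \<open>h \<circ> \<alpha>\<close> at level \<open>j\<close>.
  On a short interval coordinate \<open>k\<close> of \<open>\<alpha>\<close> stays in one
  neighbourhood given by \<open>k_fine\<close>, so \<open>u\<close> and
  \<open>h \<circ> \<beta>\<close> both stay over one \<open>R\<close> in \<open>\<Q>\<close> and
  remain in a common plaque. \<open>\<Q>_change\<close> passes between members of
  \<open>\<Q>\<close>.\<close>

lemma follow:
  assumes \<alpha>: "X.solenoid_path \<alpha>" and \<beta>: "X.solenoid_path \<beta>" and eq: "\<And>t. t \<in> {0..1} \<Longrightarrow> \<beta> t k = \<alpha> t k"
    and u: "X'.solenoid_path u" and uj: "\<And>t. t \<in> {0..1} \<Longrightarrow> u t j = h (\<alpha> t) j"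
    and Q: "Q \<in> \<Q>" "\<And>z. z \<in> X.S \<Longrightarrow> z k = \<alpha> 0 k \<Longrightarrow> h z j \<in> Q"
    and Q': "Q' \<in> \<Q>" "\<And>z. z \<in> X.S \<Longrightarrow> z k = \<alpha> 1 k \<Longrightarrow> h z j \<in> Q'"
    and start: "X'.reach j Q (u 0) (h (\<beta> 0))"
  shows "X'.reach j Q' (u 1) (h (\<beta> 1))"
proof -
  \<comment> \<open>The whole fibre is asked for, as it contains both \<open>\<alpha> s\<close> and
    \<open>\<beta> s\<close>.\<close>
  define good where "good Q s \<longleftrightarrow> Q \<in> \<Q> \<and> (\<forall>z\<in>X.S. z k = \<alpha> s k \<longrightarrow> h z j \<in> Q)" for Q s
  have mem: "u s j \<in> Q" "h (\<beta> s) j \<in> Q" if "good Q s" "s \<in> {0..1}" for Q s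
    using that uj[OF that(2)] eq[OF that(2)] X.solenoid_path_mem \<alpha> \<beta> unfolding good_def by auto
  have ex_good: "\<exists>d>0. \<exists>Q. \<forall>s\<in>{0..1}. \<bar>s - t\<bar> < d \<longrightarrow> good Q s" if t: "t \<in> {0..1}" for t
  proof -
    have "\<alpha> t k \<in> M k" using X.solenoid_path_mem[OF \<alpha> t] X.solenoid_mem by blast
    then obtain U Q where U: "openin (top_of_set (M k)) U" "\<alpha> t k \<in> U" "Q \<in> \<Q>" "\<forall>z\<in>X.S. z k \<in> U \<longrightarrow> h z j \<in> Q"
      using k_fine by blast
    have "openin (top_of_set {0..1}) ({0..1} \<inter> (\<lambda>s. \<alpha> s k) -` U)"
      using X.solenoid_path_coordinate[OF \<alpha>] U(1) by (intro openin_preimage) (auto simp: path_def path_image_def)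
    moreover have "t \<in> {0..1} \<inter> (\<lambda>s. \<alpha> s k) -` U" using t U(2) by simp
    ultimately obtain d where d: "d > 0" "\<And>s. s \<in> {0..1} \<Longrightarrow> dist s t < d \<Longrightarrow> \<alpha> s k \<in> U"
      unfolding openin_euclidean_subtopology_iff by (metis (no_types, lifting) IntD2 vimage_eq)
    have "good Q s" if "s \<in> {0..1}" "\<bar>s - t\<bar> < d" for s
      using d(2)[of s] that U(3,4) unfolding good_def dist_real_def by auto
    then show ?thesis using d(1) by blast
  qed
  \<comment> \<open>Quantifying over all good sets at both ends frees adjacent intervals from having
    to choose the same one.\<close>
  let ?P = "\<lambda>s s'. 0 \<le> s \<and> s' \<le> 1 \<longrightarrow> (\<forall>Q Q'. good Q s \<longrightarrow> good Q' s' \<longrightarrow>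
      X'.reach j Q (u s) (h (\<beta> s)) \<longrightarrow> X'.reach j Q' (u s') (h (\<beta> s')))"
  have "?P 0 1"
  proof (rule Bolzano[of 0 1 ?P])
    fix s1 s2 s3 :: real assume *: "?P s1 s2" "?P s2 s3" "s1 \<le> s2" "s2 \<le> s3"
    show "?P s1 s3"
    proof (intro impI allI)
      fix Q Q' assume s: "0 \<le> s1 \<and> s3 \<le> 1" and QQ: "good Q s1" "good Q' s3" "X'.reach j Q (u s1) (h (\<beta> s1))"
      have s2: "s2 \<in> {0..1}" using s * by auto
      obtain d R where "d > 0" "\<forall>s\<in>{0..1}. \<bar>s - s2\<bar> < d \<longrightarrow> good R s" using ex_good[OF s2] by blast
      then have R: "good R s2" using s2 by simp
      have "X'.reach j R (u s2) (h (\<beta> s2))" using *(1) s s2 QQ R by auto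
      then show "X'.reach j Q' (u s3) (h (\<beta> s3))" using *(2) s s2 QQ R by auto
    qed
  next
    fix t :: real assume "0 \<le> t" "t \<le> 1"
    then have "t \<in> {0..1}" by simp
    then obtain d R where d: "d > 0" "\<forall>s\<in>{0..1}. \<bar>s - t\<bar> < d \<longrightarrow> good R s"
      using ex_good by blast
    have "?P s s'" if ss: "s \<le> t \<and> t \<le> s' \<and> s' - s < d" for s s'
    proof (intro impI allI)
      fix Q Q' assume s: "0 \<le> s \<and> s' \<le> 1" and QQ: "good Q s" "good Q' s'" and Qs: "X'.reach j Q (u s) (h (\<beta> s))"
      have R: "good R r" if "s \<le> r" "r \<le> s'" for r
        using that s ss by (intro d(2)[rule_format]) auto
      have "X'.reach j R (u s) (u s')"
        using s ss R mem by (intro X'.reach_subpath[OF u]) auto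
      moreover have "X'.reach j R ((h \<circ> \<beta>) s) ((h \<circ> \<beta>) s')"
        using s ss R mem by (intro X'.reach_subpath[OF h_path[OF \<beta>]]) auto
      moreover have "X'.reach j R (u s) (h (\<beta> s))"
        using QQ(1) R[of s] Qs mem(1)[of R s] mem(2)[of R s] s ss
        by (intro \<Q>_change[of Q R]) (auto simp: good_def)
      ultimately have "X'.reach j R (u s') (h (\<beta> s'))"
        using X'.reach_sym X'.reach_trans by (metis comp_apply)
      then show "X'.reach j Q' (u s') (h (\<beta> s'))"
        using QQ(2) R[of s'] mem(1)[of Q' s'] mem(2)[of Q' s'] s ss
        by (intro \<Q>_change[of R Q']) (auto simp: good_def)
    qed
    then show "\<exists>d>0. \<forall>s s'. s \<le> t \<and> t \<le> s' \<and> s' - s < d \<longrightarrow> ?P s s'"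
      using d(1) by blast
  qed simp
  moreover have "good Q 0" "good Q' 1"
    using Q Q' by (simp_all add: good_def)
  ultimately show ?thesis using start by simp
qed

section \<open>The embedding of the fibre and its links\<close>

definition slide :: "(nat \<Rightarrow> 'a) \<Rightarrow> (nat \<Rightarrow> 'b) \<Rightarrow> bool" where
  "slide a v \<longleftrightarrow> X'.reach j Q0 (h a) v \<and> v j = h x1 j"

text \<open>\<open>c\<close> runs from \<open>x'\<close> to \<open>h x1\<close>, so
  \<open>s a\<close> is the source of the transport and the slid point its target. Slid points are
  unique and transport is injective, so the description is well defined on \<open>F\<close>.\<close>

definition s :: "(nat \<Rightarrow> 'a) \<Rightarrow> nat \<Rightarrow> 'b" where
  "s a = (THE w. \<exists>v. slide a v \<and> X'.transport (\<lambda>t. c t 0) w v)"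

lemma F_Q0: "a \<in> F \<Longrightarrow> h a j \<in> Q0"
  using Q0(2) O0(2) by (simp add: F)

lemma x1_F: "x1 \<in> F" using x1 by (simp add: F)

lemma x_F: "x \<in> F" using x by (simp add: F)

lemma slide_unique: "slide a v \<Longrightarrow> slide a w \<Longrightarrow> v = w"
  using \<Q>_unique[OF Q0(1), of v w] X'.reach_sym X'.reach_trans unfolding slide_def by metis

lemma ex_slide: "a \<in> F \<Longrightarrow> \<exists>v. slide a v"
proof -
  assume a: "a \<in> F"
  have pc: "path_connected Q0" using \<Q> Q0(1) by blast
  have haS: "h a \<in> X'.S" using a h_mem by (simp add: F)
  show ?thesis
    by (rule X'.ex_reach[OF pc \<Q>_subset[OF Q0(1)] haS F_Q0[OF a] F_Q0[OF x1_F]]) (auto simp: slide_def)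
qed

lemma transport_c: "X'.transport (\<lambda>t. c t 0) x' (h x1)"
  using X'.transportI[OF c(1)] c by simp

lemma c_path: "path (\<lambda>t. c t 0)" "path_image (\<lambda>t. c t 0) \<subseteq> M' 0"
  using X'.solenoid_path_coordinate[OF c(1)] by auto

lemma ex_transport_c:
  assumes "v \<in> X'.S" "v j = h x1 j"
  shows "\<exists>w. X'.transport (\<lambda>t. c t 0) w v"
proof -
  have "h x1 \<in> X'.S" using x1 h_mem by blast
  then have "v 0 = h x1 0" using X'.level_antimono[of v "h x1" 0 j] assms by simp
  then have "\<exists>w. X'.transport (reversepath (\<lambda>t. c t 0)) v w"
    by (intro X'.transport_total) (use assms c c_path in \<open>auto simp: pathfinish_def\<close>)
  then show ?thesis by (simp add: X'.transport_reverse_iff)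
qed

lemma s_eqI: "slide a v \<Longrightarrow> X'.transport (\<lambda>t. c t 0) w v \<Longrightarrow> s a = w"
  unfolding s_def using slide_unique X'.transport_unique' by (intro the_equality) blast+

lemma s_slide:
  assumes "a \<in> F"
  obtains v where "slide a v" "X'.transport (\<lambda>t. c t 0) (s a) v"
proof -
  obtain v where v: "slide a v" using ex_slide assms by blast
  then obtain w where "X'.transport (\<lambda>t. c t 0) w v"
    using ex_transport_c X'.reach_mem unfolding slide_def by blast
  then show ?thesis using that v s_eqI by metis
qed

lemma s_x1: "s x1 = x'"
proof (rule s_eqI)
  show "slide x1 (h x1)"
    unfolding slide_def using F_Q0[OF x1_F] h_mem[OF x1(1)] X'.reach_refl by blast
qed (rule transport_c)

lemma s_mem: "a \<in> F \<Longrightarrow> s a \<in> X'.S" "a \<in> F \<Longrightarrow> s a 0 = x' 0"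
proof -
  assume "a \<in> F"
  then obtain v where v: "X'.transport (\<lambda>t. c t 0) (s a) v" using s_slide by blast
  show "s a \<in> X'.S" "s a 0 = x' 0"
    using X'.transport_mem(1)[OF v] X'.transport_ends(1)[OF v] c(2) by simp_all
qed

text \<open>One path serves all \<open>d\<close> in \<open>F\<close> at once: from the point over
  \<open>h a j\<close> in the plaque of \<open>h d\<close>, the projection of
  \<open>\<kappa>\<close> leads to \<open>s d\<close>. This is what allows a single loop to realise
  an action on the whole embedded fibre.\<close>

lemma ex_link:
  assumes a: "a \<in> F"
  obtains \<kappa> where "X'.solenoid_path \<kappa>" "\<kappa> 0 = h a" "\<kappa> 1 = s a"
    "\<And>d e. d \<in> F \<Longrightarrow> e \<in> X'.S \<Longrightarrow> e j = h a j \<Longrightarrow> X'.reach j Q0 e (h d) \<Longrightarrow> X'.transport (\<lambda>t. \<kappa> t 0) e (s d)"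
proof -
  obtain v where v: "slide a v" "X'.transport (\<lambda>t. c t 0) (s a) v" using s_slide[OF a] by blast
  obtain \<sigma> where \<sigma>: "X'.solenoid_path \<sigma>" "\<sigma> 0 = h a" "\<sigma> 1 = v" "\<forall>t\<in>{0..1}. \<sigma> t j \<in> Q0"
    using v(1) unfolding slide_def X'.reach_def by blast
  obtain w where w: "X'.solenoid_path w" "w 0 = s a" "w 1 = v" "\<forall>t\<in>{0..1}. w t 0 = c t 0"
    using v(2) unfolding X'.transport_def by blast
  \<comment> \<open>The slide of \<open>h a\<close>, followed by the way back along the lift of
    \<open>c\<close> that ends at the slid point.\<close>
  define \<kappa> where "\<kappa> = \<sigma> +++ reversepath w"
  have "X'.solenoid_path \<kappa>"
    unfolding \<kappa>_def using \<sigma> w X'.solenoid_path_reverse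
    by (intro X'.solenoid_path_join) (auto simp: reversepath_def)
  moreover have "\<kappa> 0 = h a" "\<kappa> 1 = s a"
    using \<sigma> w by (simp_all add: \<kappa>_def joinpaths_def reversepath_def)
  moreover have "X'.transport (\<lambda>t. \<kappa> t 0) e (s d)"
    if d: "d \<in> F" and e: "e \<in> X'.S" "e j = h a j" "X'.reach j Q0 e (h d)" for d e
  proof -
    have "e j = \<sigma> 0 j" using e \<sigma> by simp
    then obtain e' where e': "X'.reach j Q0 e e'" "e' j = \<sigma> 1 j" "X'.transport (\<lambda>t. \<sigma> t 0) e e'"
      using X'.reach_lift[OF \<sigma>(1), of j Q0 e j] \<sigma>(4) e(1) by blast
    have "slide d e'"
      using e' e(3) X'.reach_sym X'.reach_trans v(1) \<sigma>(3) unfolding slide_def by metis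
    then have "X'.transport (\<lambda>t. c t 0) (s d) e'"
      using s_slide[OF d] slide_unique by metis
    then have "X'.transport (\<lambda>t. w t 0) (s d) e'"
      by (rule X'.transport_cong) (use w(4) in simp)
    then have "X'.transport ((\<lambda>t. \<sigma> t 0) +++ reversepath (\<lambda>t. w t 0)) e (s d)"
      using X'.transport_join[OF e'(3)] X'.transport_reverse by blast
    then show ?thesis
      by (rule X'.transport_cong) (simp add: \<kappa>_def joinpaths_def reversepath_def)
  qed
  ultimately show ?thesis using that by blast
qed

text \<open>Parallel motions on both sides run together: \<open>d\<close> moves with
  \<open>h' \<circ> \<rho>\<close> at level \<open>k\<close>, \<open>e\<close> moves with
  \<open>\<rho>\<close> at level \<open>j\<close>, and \<open>follow\<close> keeps \<open>e\<close>
  in the plaque of the moving image. Starting from a path \<open>\<rho>\<close> on the second side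
  makes the lemma usable in both directions of the transfer.\<close>

lemma follow_fibre:
  assumes ab: "a \<in> F" "b \<in> F" and \<rho>: "X'.solenoid_path \<rho>" "\<rho> 0 = h a" "\<rho> 1 = h b" and d: "d \<in> F"
  obtains d' where "d' \<in> F" "X.transport (\<lambda>t. h' (\<rho> t) 0) d d'"
    "\<And>e. X'.reach j Q0 e (h d) \<Longrightarrow> e j = h a j \<Longrightarrow>
        \<exists>f. X'.transport (\<lambda>t. \<rho> t 0) e f \<and> f j = h b j \<and> X'.reach j Q0 f (h d')"
proof -
  define \<sigma> where "\<sigma> = h' \<circ> \<rho>"
  have \<sigma>: "X.solenoid_path \<sigma>" "\<sigma> 0 = a" "\<sigma> 1 = b"
    unfolding \<sigma>_def using h'_path \<rho> ab h'_h by (simp_all add: F)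
  have h\<sigma>: "h (\<sigma> t) = \<rho> t" if "t \<in> {0..1}" for t
    unfolding \<sigma>_def using h_h' X'.solenoid_path_mem[OF \<rho>(1) that] by simp
  have dS: "d \<in> X.S" "d k = \<sigma> 0 k" using d ab \<sigma> by (simp_all add: F)
  obtain \<beta> where \<beta>: "X.solenoid_path \<beta>" "\<beta> 0 = d" "\<And>t. t \<in> {0..1} \<Longrightarrow> \<beta> t k = \<sigma> t k"
    using X.ex_solenoid_path_lift[OF dS(1), of "\<lambda>t. \<sigma> t k" k] X.solenoid_path_coordinate[OF \<sigma>(1)] dS(2)
    by (metis pathstart_def)
  have "\<beta> t 0 = \<sigma> t 0" if "t \<in> {0..1}" for t
    using X.level_antimono[of "\<beta> t" "\<sigma> t" 0 k] X.solenoid_path_mem \<beta> \<sigma> that by simp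
  then have "X.transport (\<lambda>t. h' (\<rho> t) 0) d (\<beta> 1)"
    unfolding X.transport_def using \<beta> by (intro exI[of _ \<beta>]) (simp add: \<sigma>_def)
  moreover have "\<beta> 1 \<in> F"
    using \<beta>(3)[of 1] \<sigma>(3) ab(2) X.solenoid_path_mem[OF \<beta>(1), of 1] by (simp add: F)
  moreover have "\<exists>f. X'.transport (\<lambda>t. \<rho> t 0) e f \<and> f j = h b j \<and> X'.reach j Q0 f (h (\<beta> 1))"
    if e: "X'.reach j Q0 e (h d)" "e j = h a j" for e
  proof -
    have eS: "e \<in> X'.S" using X'.reach_mem[OF e(1)] by blast
    obtain u where u: "X'.solenoid_path u" "u 0 = e" "\<And>t. t \<in> {0..1} \<Longrightarrow> u t j = \<rho> t j"
      using X'.ex_solenoid_path_lift[OF eS, of "\<lambda>t. \<rho> t j" j] X'.solenoid_path_coordinate[OF \<rho>(1)] e(2) \<rho>(2)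
      by (metis pathstart_def)
    have "X'.reach j Q0 (u 1) (h (\<beta> 1))"
    proof (rule follow[OF \<sigma>(1) \<beta>(1,3) u(1) _ Q0(1) _ Q0(1)])
      show "u t j = h (\<sigma> t) j" if "t \<in> {0..1}" for t using u(3) h\<sigma> that by simp
      show "h z j \<in> Q0" if "z \<in> X.S" "z k = \<sigma> 0 k" for z
        using that \<sigma> ab F_Q0[of z] by (simp add: F)
      show "h z j \<in> Q0" if "z \<in> X.S" "z k = \<sigma> 1 k" for z
        using that \<sigma> ab F_Q0[of z] by (simp add: F)
      show "X'.reach j Q0 (u 0) (h (\<beta> 0))" using e u \<beta> by simp
    qed auto
    moreover have "u t 0 = \<rho> t 0" if "t \<in> {0..1}" for t
      using X'.level_antimono[of "u t" "\<rho> t" 0 j] X'.solenoid_path_mem u \<rho> that by simp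
    then have "X'.transport (\<lambda>t. \<rho> t 0) e (u 1)"
      unfolding X'.transport_def using u by (intro exI[of _ u]) simp
    moreover have "u 1 j = h b j" using u(3)[of 1] \<rho>(3) by simp
    ultimately show ?thesis by blast
  qed
  ultimately show ?thesis using that by blast
qed

lemma F_0: "a \<in> F \<Longrightarrow> a 0 = x 0"
  using X.level_antimono[of a x 0 k] x by (simp add: F)

lemma ex_start:
  assumes "a \<in> F" "d \<in> F"
  obtains e where "e \<in> X'.S" "e j = h a j" "X'.reach j Q0 e (h d)"
proof -
  have pc: "path_connected Q0" using \<Q> Q0(1) by blast
  have hdS: "h d \<in> X'.S" using assms h_mem by (simp add: F)
  obtain e where "X'.reach j Q0 (h d) e" "e j = h a j"
    by (rule X'.ex_reach[OF pc \<Q>_subset[OF Q0(1)] hdS F_Q0[OF assms(2)] F_Q0[OF assms(1)]])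
  then show ?thesis using that X'.reach_mem X'.reach_sym by blast
qed

text \<open>The lift of the loop is carried by \<open>h\<close> to a path from \<open>h x1\<close>
  to \<open>h b\<close>, and links at both ends close it to a loop at \<open>x' 0\<close>. Each
  \<open>d\<close> is followed through the same three parts.\<close>

lemma transfer:
  assumes g: "g \<in> carrier (fundamental_group (M 0) (x 0))" and gF: "X.monodromy g x1 \<in> F"
  shows "\<exists>g'\<in>carrier (fundamental_group (M' 0) (x' 0)). \<forall>d\<in>F. s (X.monodromy g d) = X'.monodromy g' (s d)"
proof -
  obtain p where p: "p \<in> loops_at (M 0) (x 0)" "g = path_class (M 0) p"
    using g by (auto simp: carrier_fundamental_group)
  define b where "b = X.monodromy g x1"
  have bF: "b \<in> F" using gF by (simp add: b_def)
  have "X.transport p x1 b"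
    unfolding b_def p(2) by (rule X.transport_monodromy[OF p(1)]) (use x1 F_0[OF x1_F] in simp_all)
  then obtain \<sigma> where \<sigma>: "X.solenoid_path \<sigma>" "\<sigma> 0 = x1" "\<sigma> 1 = b" "\<forall>t\<in>{0..1}. \<sigma> t 0 = p t"
    unfolding X.transport_def by blast
  define \<rho> where "\<rho> = h \<circ> \<sigma>"
  have \<rho>: "X'.solenoid_path \<rho>" "\<rho> 0 = h x1" "\<rho> 1 = h b"
    unfolding \<rho>_def using h_path \<sigma> by simp_all
  obtain \<kappa> where \<kappa>: "X'.solenoid_path \<kappa>" "\<kappa> 0 = h x1" "\<kappa> 1 = s x1"
    "\<And>d e. d \<in> F \<Longrightarrow> e \<in> X'.S \<Longrightarrow> e j = h x1 j \<Longrightarrow> X'.reach j Q0 e (h d) \<Longrightarrow> X'.transport (\<lambda>t. \<kappa> t 0) e (s d)"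
    using ex_link[OF x1_F] by blast
  obtain \<mu> where \<mu>: "X'.solenoid_path \<mu>" "\<mu> 0 = h b" "\<mu> 1 = s b"
    "\<And>d e. d \<in> F \<Longrightarrow> e \<in> X'.S \<Longrightarrow> e j = h b j \<Longrightarrow> X'.reach j Q0 e (h d) \<Longrightarrow> X'.transport (\<lambda>t. \<mu> t 0) e (s d)"
    using ex_link[OF bF] by blast
  define \<tau> where "\<tau> = reversepath \<kappa> +++ \<rho> +++ \<mu>"
  have \<tau>: "X'.solenoid_path \<tau>"
    unfolding \<tau>_def using \<kappa> \<mu> \<rho> X'.solenoid_path_reverse
    by (intro X'.solenoid_path_join) (auto simp: reversepath_def joinpaths_def)
  have \<tau>0: "(\<lambda>t. \<tau> t 0) = reversepath (\<lambda>t. \<kappa> t 0) +++ (\<lambda>t. \<rho> t 0) +++ (\<lambda>t. \<mu> t 0)"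
    by (auto simp: \<tau>_def joinpaths_def reversepath_def)
  have loop: "(\<lambda>t. \<tau> t 0) \<in> loops_at (M' 0) (x' 0)"
    by (rule X'.solenoid_path_loop[OF \<tau>])
      (use \<kappa> \<mu> s_mem x1_F bF in \<open>simp_all add: \<tau>_def joinpaths_def reversepath_def\<close>)
  define g' where "g' = path_class (M' 0) (\<lambda>t. \<tau> t 0)"
  have "s (X.monodromy g d) = X'.monodromy g' (s d)" if d: "d \<in> F" for d
  proof -
    obtain d' where d': "d' \<in> F" "X.transport (\<lambda>t. h' (\<rho> t) 0) d d'"
      "\<And>e. X'.reach j Q0 e (h d) \<Longrightarrow> e j = h x1 j \<Longrightarrow>
        \<exists>f. X'.transport (\<lambda>t. \<rho> t 0) e f \<and> f j = h b j \<and> X'.reach j Q0 f (h d')"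
      using follow_fibre[OF x1_F bF \<rho> d] by blast
    have "h' (\<rho> t) 0 = p t" if "t \<in> {0..1}" for t
      using \<sigma>(4) that h'_h[OF X.solenoid_path_mem[OF \<sigma>(1) that]] by (simp add: \<rho>_def)
    then have "X.transport p d d'"
      using X.transport_cong[OF d'(2)] by blast
    then have gd: "X.monodromy g d = d'"
      unfolding p(2) by (rule X.monodromy_eqI[OF p(1)])
    obtain e where e: "e \<in> X'.S" "e j = h x1 j" "X'.reach j Q0 e (h d)"
      using ex_start[OF x1_F d] by blast
    obtain f where f: "X'.transport (\<lambda>t. \<rho> t 0) e f" "f j = h b j" "X'.reach j Q0 f (h d')"
      using d'(3)[OF e(3,2)] by blast
    have "f \<in> X'.S" using X'.reach_mem[OF f(3)] by blast
    then have "X'.transport (\<lambda>t. \<mu> t 0) f (s d')"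
      using \<mu>(4) d'(1) f by blast
    moreover have "X'.transport (reversepath (\<lambda>t. \<kappa> t 0)) (s d) e"
      using \<kappa>(4)[OF d e] X'.transport_reverse by blast
    ultimately have "X'.transport (\<lambda>t. \<tau> t 0) (s d) (s d')"
      unfolding \<tau>0 using f(1) X'.transport_join by blast
    then show ?thesis
      unfolding gd g'_def using X'.monodromy_eqI[OF loop] by simp
  qed
  then show ?thesis
    using loop by (intro bexI[of _ g']) (auto simp: carrier_fundamental_group g'_def)
qed

text \<open>The links turn a loop at \<open>x' 0\<close> into a path from \<open>h a\<close> to
  \<open>h b\<close>; its image under \<open>h'\<close> projects to a loop because \<open>a\<close>
  and \<open>b\<close> share coordinate \<open>0\<close>. One return to the embedded fibre, from
  \<open>s a\<close> to \<open>s b\<close>, thus forces all its points to return.\<close>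

lemma transfer':
  assumes g': "g' \<in> carrier (fundamental_group (M' 0) (x' 0))"
    and ab: "a \<in> F" "b \<in> F" "X'.monodromy g' (s a) = s b"
  shows "\<exists>g\<in>carrier (fundamental_group (M 0) (x 0)). \<forall>d\<in>F. X.monodromy g d \<in> F \<and>
    s (X.monodromy g d) = X'.monodromy g' (s d)"
proof -
  obtain p where p: "p \<in> loops_at (M' 0) (x' 0)" "g' = path_class (M' 0) p"
    using g' by (auto simp: carrier_fundamental_group)
  have tr: "X'.transport p (s d) (X'.monodromy g' (s d))" if "d \<in> F" for d
    unfolding p(2) by (rule X'.transport_monodromy[OF p(1)]) (use s_mem that in auto)
  obtain \<tau> where \<tau>: "X'.solenoid_path \<tau>" "\<tau> 0 = s a" "\<tau> 1 = s b" "\<forall>t\<in>{0..1}. \<tau> t 0 = p t"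
    using tr[OF ab(1)] ab(3) unfolding X'.transport_def by metis
  obtain \<kappa> where \<kappa>: "X'.solenoid_path \<kappa>" "\<kappa> 0 = h a" "\<kappa> 1 = s a"
    "\<And>d e. d \<in> F \<Longrightarrow> e \<in> X'.S \<Longrightarrow> e j = h a j \<Longrightarrow> X'.reach j Q0 e (h d) \<Longrightarrow> X'.transport (\<lambda>t. \<kappa> t 0) e (s d)"
    using ex_link[OF ab(1)] by blast
  obtain \<mu> where \<mu>: "X'.solenoid_path \<mu>" "\<mu> 0 = h b" "\<mu> 1 = s b"
    "\<And>d e. d \<in> F \<Longrightarrow> e \<in> X'.S \<Longrightarrow> e j = h b j \<Longrightarrow> X'.reach j Q0 e (h d) \<Longrightarrow> X'.transport (\<lambda>t. \<mu> t 0) e (s d)"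
    using ex_link[OF ab(2)] by blast
  define \<rho> where "\<rho> = \<kappa> +++ \<tau> +++ reversepath \<mu>"
  have \<rho>: "X'.solenoid_path \<rho>"
    unfolding \<rho>_def using \<kappa> \<mu> \<tau> X'.solenoid_path_reverse
    by (intro X'.solenoid_path_join) (auto simp: reversepath_def joinpaths_def)
  have \<rho>01: "\<rho> 0 = h a" "\<rho> 1 = h b"
    using \<kappa> \<mu> by (simp_all add: \<rho>_def joinpaths_def reversepath_def)
  have \<rho>0: "(\<lambda>t. \<rho> t 0) = (\<lambda>t. \<kappa> t 0) +++ (\<lambda>t. \<tau> t 0) +++ reversepath (\<lambda>t. \<mu> t 0)"
    by (auto simp: \<rho>_def joinpaths_def reversepath_def)
  have loop: "(\<lambda>t. (h' \<circ> \<rho>) t 0) \<in> loops_at (M 0) (x 0)"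
    by (rule X.solenoid_path_loop[OF h'_path[OF \<rho>]])
      (use \<rho>01 F_0[OF ab(1)] F_0[OF ab(2)] ab h'_h in \<open>simp_all add: F\<close>)
  define g where "g = path_class (M 0) (\<lambda>t. (h' \<circ> \<rho>) t 0)"
  have "X.monodromy g d \<in> F \<and> s (X.monodromy g d) = X'.monodromy g' (s d)" if d: "d \<in> F" for d
  proof -
    obtain d' where d': "d' \<in> F" "X.transport (\<lambda>t. h' (\<rho> t) 0) d d'"
      "\<And>e. X'.reach j Q0 e (h d) \<Longrightarrow> e j = h a j \<Longrightarrow>
        \<exists>f. X'.transport (\<lambda>t. \<rho> t 0) e f \<and> f j = h b j \<and> X'.reach j Q0 f (h d')"
      using follow_fibre[OF ab(1,2) \<rho> \<rho>01 d] by blast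
    have gd: "X.monodromy g d = d'"
      unfolding g_def by (rule X.monodromy_eqI[OF loop]) (use d'(2) in simp)
    obtain e where e: "e \<in> X'.S" "e j = h a j" "X'.reach j Q0 e (h d)"
      using ex_start[OF ab(1) d] by blast
    obtain f where f: "X'.transport (\<lambda>t. \<rho> t 0) e f" "f j = h b j" "X'.reach j Q0 f (h d')"
      using d'(3)[OF e(3,2)] by blast
    have "f \<in> X'.S" using X'.reach_mem[OF f(3)] by blast
    then have \<mu>f: "X'.transport (\<lambda>t. \<mu> t 0) f (s d')"
      using \<mu>(4) d'(1) f by blast
    \<comment> \<open>The end of the lift of \<open>\<rho>\<close> from \<open>e\<close> is computed
      twice, by \<open>follow_fibre\<close> and through the three parts of \<open>\<rho>\<close>;
      uniqueness of transport gives \<open>m = s d'\<close>.\<close>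
    define m where "m = X'.monodromy g' (s d)"
    have m: "X'.transport (\<lambda>t. \<tau> t 0) (s d) m"
      unfolding m_def by (rule X'.transport_cong[OF tr[OF d]]) (use \<tau>(4) in simp)
    have "m 0 = \<mu> 1 0"
      using X'.transport_ends(2)[OF m] \<tau>(3) \<mu>(3) by simp
    then have "\<exists>f'. X'.transport (reversepath (\<lambda>t. \<mu> t 0)) m f'"
      using X'.transport_mem(2)[OF m] X'.solenoid_path_coordinate[OF \<mu>(1)]
      by (intro X'.transport_total) (auto simp: pathfinish_def)
    then obtain f' where f': "X'.transport (reversepath (\<lambda>t. \<mu> t 0)) m f'" by blast
    then have "X'.transport (\<lambda>t. \<rho> t 0) e f'"
      unfolding \<rho>0 using \<kappa>(4)[OF d e] m X'.transport_join by blast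
    then have "f' = f" using f(1) X'.transport_unique by blast
    then have "X'.transport (\<lambda>t. \<mu> t 0) f m" using f' X'.transport_reverse_iff by blast
    then have "m = s d'" using \<mu>f X'.transport_unique by blast
    then show ?thesis using gd d'(1) by (simp add: m_def)
  qed
  then show ?thesis
    using loop by (intro bexI[of _ g]) (auto simp: carrier_fundamental_group g_def)
qed

section \<open>Levels under the embedding\<close>

text \<open>Transport along a path and back preserves equality of coordinates, so levels can be
  compared at the slid points.\<close>

lemma s_level_iff:
  assumes "slide a v" "X'.transport (\<lambda>t. c t 0) (s a) v" "slide b w" "X'.transport (\<lambda>t. c t 0) (s b) w"
  shows "s a l = s b l \<longleftrightarrow> v l = w l"
  using X'.transport_level[OF assms(2,4)] X'.transport_level[OF X'.transport_reverse[OF assms(2)] X'.transport_reverse[OF assms(4)]]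
  by blast

text \<open>If \<open>h b\<close> is near \<open>h a\<close> at level \<open>m\<close>, it moves
  within a small plaque to a point with coordinate \<open>m\<close> of \<open>h a\<close>, and from
  there parallel to the slide of \<open>h a\<close>. The end is the slid point of \<open>b\<close>
  and agrees with that of \<open>a\<close> up to level \<open>m\<close>.\<close>

lemma s_locally_constant:
  assumes a: "a \<in> F"
  shows "\<exists>W. openin (top_of_set X.S) W \<and> a \<in> W \<and> (\<forall>b\<in>W. b k = x k \<longrightarrow> s b l = s a l)"
proof -
  \<comment> \<open>Level \<open>j\<close> is needed to recognise a slid point, level
    \<open>l\<close> for the claim.\<close>
  define m where "m = max l j"
  have haS: "h a \<in> X'.S" and aS: "a \<in> X.S" using a h_mem by (simp_all add: F)
  have Qo: "openin (top_of_set (M' j)) Q0" using \<Q> Q0(1) by blast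
  obtain U' where U': "openin (top_of_set (M' m)) U'" "\<And>z. z \<in> X'.S \<Longrightarrow> z m \<in> U' \<longleftrightarrow> z j \<in> Q0"
    using X'.ex_higher_level_open[OF _ Qo, of m] unfolding m_def by (metis max.cobounded2)
  have "h a m \<in> U'" using U'(2)[OF haS] F_Q0[OF a] by simp
  then obtain D where D: "openin (top_of_set (M' m)) D" "h a m \<in> D" "D \<subseteq> U'" "path_connected D"
    using closed_manifold_inessential_neighbourhood[OF X'.manifold U'(1)] unfolding inessential_in_def by metis
  obtain v where v: "slide a v" "X'.transport (\<lambda>t. c t 0) (s a) v" using s_slide[OF a] by blast
  obtain \<sigma> where \<sigma>: "X'.solenoid_path \<sigma>" "\<sigma> 0 = h a" "\<sigma> 1 = v" "\<forall>t\<in>{0..1}. \<sigma> t j \<in> Q0"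
    using v(1) unfolding slide_def X'.reach_def by blast
  have *: "s b l = s a l" if b: "b \<in> F" "h b m \<in> D" for b
  proof -
    have hbS: "h b \<in> X'.S" using b h_mem by (simp add: F)
    obtain e where e: "X'.reach m D (h b) e" "e m = h a m"
      using X'.ex_reach[OF D(4) openin_imp_subset[OF D(1)] hbS b(2) D(2)] by blast
    have be: "X'.reach j Q0 (h b) e"
      using X'.reach_mono[OF e(1)] U'(2) D(3) by blast
    have eS: "e \<in> X'.S" using X'.reach_mem[OF be] by blast
    obtain w where w: "X'.reach j Q0 e w" "w m = \<sigma> 1 m"
      using X'.reach_lift[OF \<sigma>(1), of j Q0 e m] \<sigma>(2,4) e(2) eS unfolding m_def by (metis max.cobounded2)
    have wS: "w \<in> X'.S" "v \<in> X'.S" using X'.reach_mem[OF w(1)] X'.transport_mem(2)[OF v(2)] by blast+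
    have wv: "w m = v m" using w(2) \<sigma>(3) by simp
    then have "w j = v j" "w l = v l"
      using X'.level_antimono[OF wS _ wv] unfolding m_def by auto
    then have "slide b w"
      using X'.reach_trans[OF be w(1)] v(1) unfolding slide_def by simp
    then obtain w' where "slide b w'" "X'.transport (\<lambda>t. c t 0) (s b) w'" "w' = w"
      using s_slide[OF b(1)] slide_unique by metis
    then show ?thesis
      using s_level_iff v \<open>w l = v l\<close> by metis
  qed
  let ?W = "{z \<in> X.S. h z \<in> {z \<in> X'.S. z m \<in> D}}"
  have "openin (top_of_set X.S) (X.S \<inter> h -` {z \<in> X'.S. z m \<in> D})"
    using X'.openin_level_preimage[OF D(1)] h_mem by (intro openin_preimage[OF continuous_h]) auto
  moreover have "X.S \<inter> h -` {z \<in> X'.S. z m \<in> D} = ?W" by blast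
  ultimately have "openin (top_of_set X.S) ?W" by simp
  moreover have "a \<in> ?W" using D(2) haS aS by simp
  moreover have "\<forall>b\<in>?W. b k = x k \<longrightarrow> s b l = s a l"
    using * by (simp add: F)
  ultimately show ?thesis by blast
qed

lemma s_levels: "\<exists>l. \<forall>a\<in>F. \<forall>b\<in>F. a l = b l \<longrightarrow> s a l' = s b l'"
proof -
  have loc: "\<exists>W. openin (top_of_set X.S) W \<and> a \<in> W \<and> (\<forall>b\<in>W. b k = x k \<longrightarrow> s b l' = s a l')"
    if "a \<in> X.S" "a k = x k" for a
    using s_locally_constant[of a l'] that by (simp add: F)
  obtain l where "\<forall>a\<in>X.S. \<forall>b\<in>X.S. a k = x k \<longrightarrow> b k = x k \<longrightarrow> a l = b l \<longrightarrow> s a l' = s b l'"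
    using X.fibre_uniform_level[of k "x k" "\<lambda>a. s a l'", OF loc X.solenoid_mem[OF x]] ..
  then have "\<forall>a\<in>F. \<forall>b\<in>F. a l = b l \<longrightarrow> s a l' = s b l'"
    unfolding F_def by blast
  then show ?thesis by (rule exI[of _ l])
qed

text \<open>Continuity of \<open>h'\<close> at \<open>h a\<close> in terms of levels;
  \<open>j \<le> m\<close> prepares for lifting paths at level \<open>m\<close> that are controlled
  at level \<open>j\<close>.\<close>

lemma ex_inverse_neighbourhood:
  assumes "a \<in> X.S" "openin (top_of_set (M l)) D" "a l \<in> D"
  obtains m where "j \<le> m" "\<And>z. z \<in> X'.S \<Longrightarrow> z m = h a m \<Longrightarrow> h' z l \<in> D"
proof -
  let ?W = "X'.S \<inter> h' -` {z \<in> X.S. z l \<in> D}"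
  have haS: "h a \<in> X'.S" using assms h_mem by blast
  have W: "openin (top_of_set X'.S) ?W"
    using X.openin_level_preimage[OF assms(2)] h'_mem by (intro openin_preimage[OF continuous_h']) auto
  have aW: "h a \<in> ?W" using assms h_mem h'_h by simp
  obtain m0 U where U: "openin (top_of_set (M' m0)) U" "h a m0 \<in> U" "\<And>z. z \<in> X'.S \<Longrightarrow> z m0 \<in> U \<Longrightarrow> z \<in> ?W"
    using X'.solenoid_neighbourhood[OF W aW] by blast
  show ?thesis
  proof (rule that[of "max j m0"])
    fix z assume z: "z \<in> X'.S" "z (max j m0) = h a (max j m0)"
    then have "z m0 = h a m0" using X'.level_antimono[OF z(1) haS _ z(2), of m0] by simp
    then show "h' z l \<in> D" using U(2) U(3)[OF z(1)] by simp
  qed simp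
qed

text \<open>Retracing the slide of \<open>a\<close> from the slid point of \<open>b\<close> leads to
  a point \<open>e\<close> in the plaque of \<open>h b\<close> and near \<open>h a\<close>. Its
  image under \<open>h'\<close> moves slightly to a point \<open>f\<close> with coordinate
  \<open>l\<close> of \<open>a\<close>. By \<open>\<Q>_small\<close>, \<open>b\<close> and
  \<open>f\<close> lie in one plaque over an inessential set of \<open>M 0\<close>; their
  coordinates \<open>0\<close> agree, so they coincide.\<close>

lemma s_locally_injective:
  assumes a: "a \<in> F"
  shows "\<exists>m. \<forall>b\<in>F. s b m = s a m \<longrightarrow> b l = a l"
proof -
  have haS: "h a \<in> X'.S" and aS: "a \<in> X.S" using a h_mem by (simp_all add: F)
  obtain A where A: "openin (top_of_set (M 0)) A" "inessential_in (M 0) A" "\<forall>z\<in>X'.S. z j \<in> Q0 \<longrightarrow> h' z 0 \<in> A"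
    using \<Q>_small[OF Q0(1)] by blast
  obtain U' where U': "openin (top_of_set (M l)) U'" "\<And>z. z \<in> X.S \<Longrightarrow> z l \<in> U' \<longleftrightarrow> z 0 \<in> A"
    using X.ex_higher_level_open[OF _ A(1), of l] by blast
  have "a 0 \<in> A" using A(3) haS F_Q0[OF a] h'_h[OF aS] by metis
  then have "a l \<in> U'" using U'(2)[OF aS] by simp
  then obtain D where D: "openin (top_of_set (M l)) D" "a l \<in> D" "D \<subseteq> U'" "path_connected D"
    using closed_manifold_inessential_neighbourhood[OF X.manifold U'(1)] unfolding inessential_in_def by metis
  obtain m where m: "j \<le> m" "\<And>z. z \<in> X'.S \<Longrightarrow> z m = h a m \<Longrightarrow> h' z l \<in> D"
    using ex_inverse_neighbourhood[OF aS D(1,2)] by blast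
  obtain v where v: "slide a v" "X'.transport (\<lambda>t. c t 0) (s a) v" using s_slide[OF a] by blast
  have "X'.reach j Q0 v (h a)" using v(1) X'.reach_sym unfolding slide_def by blast
  then obtain \<sigma> where \<sigma>: "X'.solenoid_path \<sigma>" "\<sigma> 0 = v" "\<sigma> 1 = h a" "\<forall>t\<in>{0..1}. \<sigma> t j \<in> Q0"
    unfolding X'.reach_def by blast
  have "b l = a l" if b: "b \<in> F" "s b m = s a m" for b
  proof -
    have bS: "b \<in> X.S" using b by (simp add: F)
    obtain w where w: "slide b w" "X'.transport (\<lambda>t. c t 0) (s b) w" using s_slide[OF b(1)] by blast
    have "w m = \<sigma> 0 m" using s_level_iff[OF w v] b(2) \<sigma>(2) by simp
    moreover have wS: "w \<in> X'.S" using X'.transport_mem(2)[OF w(2)] .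
    ultimately obtain e where e: "X'.reach j Q0 w e" "e m = \<sigma> 1 m"
      using X'.reach_lift[OF \<sigma>(1), of j Q0 w m] \<sigma>(4) m(1) by blast
    have eS: "e \<in> X'.S" using X'.reach_mem[OF e(1)] by blast
    have eD: "h' e l \<in> D" using m(2)[OF eS] e(2) \<sigma>(3) by simp
    obtain f where f: "X.reach l D (h' e) f" "f l = a l"
      using X.ex_reach[OF D(4) openin_imp_subset[OF D(1)] h'_mem[OF eS] eD D(2)] by blast
    have 1: "X.reach 0 A (h' e) f"
      using X.reach_mono[OF f(1)] U'(2) D(3) by blast
    have "X'.reach j Q0 (h b) e"
      using X'.reach_trans e(1) w(1) unfolding slide_def by blast
    then have "X.reach 0 A (h' (h b)) (h' e)"
      using h'_reach A(3) by blast
    then have bf: "X.reach 0 A b f"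
      using 1 X.reach_trans h'_h[OF bS] by metis
    have fS: "f \<in> X.S" using X.reach_mem[OF f(1)] by blast
    have "f 0 = a 0" by (rule X.level_antimono[OF fS aS _ f(2)]) simp
    then have "b 0 = f 0" using F_0[OF a] F_0[OF b(1)] by simp
    then have "b = f" using X.reach_unique[OF A(2) bf] by simp
    then show ?thesis using f(2) by simp
  qed
  then show ?thesis by blast
qed

text \<open>The level \<open>m d\<close> from local injectivity depends on the point
  \<open>d\<close>. Near \<open>d\<close>, local constancy gives \<open>s a\<close> and
  \<open>s d\<close> the same coordinate at level \<open>m d\<close>, so finitely many
  \<open>d\<close> suffice.\<close>

lemma s_levels': "\<exists>l'. \<forall>a\<in>F. \<forall>b\<in>F. s a l' = s b l' \<longrightarrow> a l = b l"
proof -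
  have "\<forall>a\<in>F. \<exists>m. \<forall>b\<in>F. s b m = s a m \<longrightarrow> b l = a l"
    using s_locally_injective by blast
  from bchoice[OF this] obtain m where m: "b l = a l" if "a \<in> F" "b \<in> F" "s b (m a) = s a (m a)" for a b
    by blast
  have "\<exists>W. openin (top_of_set X.S) W \<and> a \<in> W \<and> (\<forall>b\<in>W. b k = x k \<longrightarrow> s b (m a) = s a (m a))"
    if "a \<in> X.S" "a k = x k" for a
    using s_locally_constant[of a "m a"] that by (simp add: F)
  then obtain W where W: "\<And>a. a \<in> X.S \<Longrightarrow> a k = x k \<Longrightarrow> openin (top_of_set X.S) (W a) \<and> a \<in> W a \<and>
      (\<forall>b\<in>W a. b k = x k \<longrightarrow> s b (m a) = s a (m a))"
    by metis
  obtain A where A: "finite A" "A \<subseteq> {z \<in> X.S. z k = x k}" "{z \<in> X.S. z k = x k} \<subseteq> \<Union>(W ` A)"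
  proof -
    have "openin (top_of_set X.S) (W a) \<and> a \<in> W a" if "a \<in> X.S" "a k = x k" for a
      using W[OF that] by blast
    from X.fibre_finite_subcover[of k "x k" W, OF this X.solenoid_mem[OF x]] that
    show thesis by blast
  qed
  have "a l = b l" if ab: "a \<in> F" "b \<in> F" and eq: "s a (Max (insert 0 (m ` A))) = s b (Max (insert 0 (m ` A)))" for a b
  proof -
    obtain d where d: "d \<in> A" "a \<in> W d" using A(3) ab by (auto simp: F)
    then have dF: "d \<in> F" using A(2) by (auto simp: F)
    have "m d \<le> Max (insert 0 (m ` A))" using A(1) d(1) by simp
    then have "s a (m d) = s b (m d)"
      using X'.level_antimono[OF s_mem(1)[OF ab(1)] s_mem(1)[OF ab(2)] _ eq] by blast
    moreover have "s a (m d) = s d (m d)"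
      using W[of d] dF d(2) ab(1) unfolding F by blast
    ultimately show ?thesis
      using m[OF dF ab(1)] m[OF dF ab(2)] by simp
  qed
  then show ?thesis by blast
qed

text \<open>A point near \<open>x'\<close> is transported along \<open>c\<close> to some
  \<open>w\<close> near \<open>h x1\<close>. Then \<open>h' w\<close> moves over \<open>O0\<close>
  to a point of \<open>F\<close>, and \<open>w\<close> is the slid point of that point.\<close>

lemma s_open: "\<exists>l. \<forall>z\<in>X'.S. z 0 = x' 0 \<longrightarrow> z l = x' l \<longrightarrow> z \<in> s ` F"
proof -
  have x1O: "x1 k \<in> O0" using x1 O0 by simp
  then obtain D where D: "openin (top_of_set (M k)) D" "x1 k \<in> D" "D \<subseteq> O0" "path_connected D"
    using closed_manifold_inessential_neighbourhood[OF X.manifold O0(1)] unfolding inessential_in_def by metis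
  obtain m where m: "j \<le> m" "\<And>z. z \<in> X'.S \<Longrightarrow> z m = h x1 m \<Longrightarrow> h' z k \<in> D"
    using ex_inverse_neighbourhood[OF x1(1) D(1,2)] by blast
  have "z \<in> s ` F" if z: "z \<in> X'.S" "z 0 = x' 0" "z m = x' m" for z
  proof -
    obtain w where w: "X'.transport (\<lambda>t. c t 0) z w"
      using X'.transport_total[OF z(1) c_path] z(2) c(2) by (auto simp: pathstart_def)
    have wS: "w \<in> X'.S" using X'.transport_mem(2)[OF w] .
    have wm: "w m = h x1 m" using X'.transport_level[OF w transport_c z(3)] .
    then have wj: "w j = h x1 j"
      using X'.level_antimono[OF wS h_mem[OF x1(1)] m(1)] by blast
    have wD: "h' w k \<in> D" using m(2)[OF wS wm] .
    obtain a where a: "X.reach k D (h' w) a" "a k = x1 k"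
      using X.ex_reach[OF D(4) openin_imp_subset[OF D(1)] h'_mem[OF wS] wD D(2)] by blast
    have aF: "a \<in> F" using X.reach_mem[OF a(1)] a(2) x1(2) by (simp add: F)
    have "X'.reach j Q0 (h (h' w)) (h a)"
      using h_reach[OF a(1)] Q0(2) D(3) by blast
    then have "X'.reach j Q0 (h a) w"
      using X'.reach_sym h_h'[OF wS] by metis
    then have "slide a w" using wj by (simp add: slide_def)
    then have "s a = z" using s_eqI w by blast
    then show ?thesis using aF by blast
  qed
  then show ?thesis by blast
qed

theorem commensurable:
  assumes x': "x' \<in> X'.S"
  shows "typesets_commensurable
           (fundamental_group (M 0) (x 0)) (presentation_chain M q x)
           (fundamental_group (M' 0) (x' 0)) (presentation_chain M' q' x')"
proof (rule typesets_commensurable_of_adapted_actions)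
  let ?G = "fundamental_group (M 0) (x 0)" and ?\<Phi> = "{z \<in> X.S. z 0 = x 0}"
  let ?G' = "fundamental_group (M' 0) (x' 0)" and ?\<Phi>' = "{z \<in> X'.S. z 0 = x' 0}"
  interpret A: chain_action ?G "presentation_chain M q x" ?\<Phi> X.monodromy x
    by (rule X.chain_action_monodromy[OF x])
  interpret A': chain_action ?G' "presentation_chain M' q' x'" ?\<Phi>' X'.monodromy x'
    by (rule X'.chain_action_monodromy[OF x'])
  have F\<Phi>: "F \<subseteq> ?\<Phi>" using F_0 by (auto simp: F)
  have F_transitive: "\<exists>g\<in>carrier ?G. X.monodromy g a \<in> F \<and> X.monodromy g a l = b l" if ab: "a \<in> F" "b \<in> F" for a b l
  proof -
    \<comment> \<open>Coordinate \<open>l\<close> is the one asked for, while coordinate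
      \<open>k\<close> keeps the image in \<open>F\<close>.\<close>
    obtain g where g: "g \<in> carrier ?G" "X.monodromy g a (max l k) = b (max l k)"
      using X.monodromy_transitive[of a b "x 0" "max l k"] F\<Phi> ab by blast
    have mem: "X.monodromy g a \<in> X.S" "b \<in> X.S" using A.act_closed[OF g(1)] F\<Phi> ab by auto
    have "X.monodromy g a l = b l" "X.monodromy g a k = b k"
      using X.level_antimono[OF mem _ g(2)] by auto
    then show ?thesis using g(1) mem ab(2) by (intro bexI[of _ g]) (auto simp: F)
  qed
  have F_adapted: "X.monodromy g b \<in> F" if "g \<in> carrier ?G" "a \<in> F" "b \<in> F" "X.monodromy g a \<in> F" for g a b
  proof -
    have \<Phi>: "a \<in> ?\<Phi>" "b \<in> ?\<Phi>" using that F\<Phi> by blast+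
    have "X.monodromy g b k = X.monodromy g a k"
      by (rule A.act_level[OF that(1) \<Phi>(2,1)]) (use that in \<open>simp add: F\<close>)
    then show ?thesis using A.act_closed[OF that(1) \<Phi>(2)] that(4) by (simp add: F)
  qed
  show "adapted_action ?G (presentation_chain M q x) ?\<Phi> X.monodromy x F"
  proof unfold_locales
    show "F \<subseteq> ?\<Phi>" by (rule F\<Phi>)
    show "x \<in> F" by (rule x_F)
    show "\<exists>l. \<forall>z\<in>?\<Phi>. z l = x l \<longrightarrow> z \<in> F" by (intro exI[of _ k]) (auto simp: F)
  qed (use F_adapted F_transitive x_F in blast)+
  have F'\<Phi>: "s ` F \<subseteq> ?\<Phi>'" using s_mem by auto
  show "adapted_action ?G' (presentation_chain M' q' x') ?\<Phi>' X'.monodromy x' (s ` F)"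
  proof unfold_locales
    show "s ` F \<subseteq> ?\<Phi>'" by (rule F'\<Phi>)
    show "x' \<in> s ` F" using s_x1 x1_F by (metis imageI)
    show "\<exists>l. \<forall>z\<in>?\<Phi>'. z l = x' l \<longrightarrow> z \<in> s ` F" using s_open by auto
  next
    \<comment> \<open>The image of \<open>F\<close> need not be a fibre of a coordinate, so its
      adaptedness is drawn from the return property in \<open>transfer'\<close>.\<close>
    fix g v w assume g: "g \<in> carrier ?G'" "v \<in> s ` F" "w \<in> s ` F" "X'.monodromy g v \<in> s ` F"
    obtain a where a: "a \<in> F" "v = s a" using g(2) by (rule imageE)
    obtain d where d: "d \<in> F" "w = s d" using g(3) by (rule imageE)
    obtain b where b: "b \<in> F" "X'.monodromy g v = s b" using g(4) by (rule imageE)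
    obtain g0 where "\<forall>d\<in>F. X.monodromy g0 d \<in> F \<and> s (X.monodromy g0 d) = X'.monodromy g (s d)"
      using transfer'[OF g(1) a(1) b(1)] a b by blast
    then show "X'.monodromy g w \<in> s ` F" using d by (metis imageI)
  next
    fix v l assume "v \<in> s ` F"
    then obtain b where b: "b \<in> F" "v = s b" by (rule imageE)
    obtain m where m: "\<forall>a\<in>F. \<forall>b\<in>F. a m = b m \<longrightarrow> s a l = s b l" using s_levels by blast
    \<comment> \<open>The orbit starts at \<open>x1\<close>, because
      \<open>s x1 = x'\<close>.\<close>
    obtain g where g: "g \<in> carrier ?G" "X.monodromy g x1 \<in> F" "X.monodromy g x1 m = b m"
      using F_transitive[OF x1_F b(1)] by blast
    obtain g' where g': "g' \<in> carrier ?G'" "\<forall>d\<in>F. s (X.monodromy g d) = X'.monodromy g' (s d)"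
      using transfer[OF g(1,2)] by blast
    have eq: "X'.monodromy g' x' = s (X.monodromy g x1)" using g'(2) x1_F s_x1 by metis
    then have "X'.monodromy g' x' l = v l" using m g(2,3) b by metis
    moreover have "X'.monodromy g' x' \<in> s ` F" using eq g(2) by simp
    ultimately show "\<exists>g\<in>carrier ?G'. X'.monodromy g x' \<in> s ` F \<and> X'.monodromy g x' l = v l"
      using g'(1) by blast
  qed
  show "\<exists>l. \<forall>a\<in>F. \<forall>b\<in>F. a l = b l \<longrightarrow> s a l' = s b l'" for l' by (rule s_levels)
  show "\<exists>l'. \<forall>a\<in>F. \<forall>b\<in>F. s a l' = s b l' \<longrightarrow> a l = b l" for l by (rule s_levels')
  show "\<exists>g'\<in>carrier ?G'. \<forall>a\<in>F. s (X.monodromy g a) = X'.monodromy g' (s a)"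
    if "g \<in> carrier ?G" "\<forall>a\<in>F. X.monodromy g a \<in> F" for g
    using transfer[OF that(1)] that(2) x1_F by blast
  show "\<exists>g\<in>carrier ?G. \<forall>a\<in>F. X.monodromy g a \<in> F \<and> s (X.monodromy g a) = X'.monodromy g' (s a)"
    if g': "g' \<in> carrier ?G'" "\<forall>a\<in>F. X'.monodromy g' (s a) \<in> s ` F" for g'
  proof -
    obtain b where "b \<in> F" "X'.monodromy g' (s x1) = s b" using g'(2) x1_F by blast
    then show ?thesis using transfer'[OF g'(1) x1_F] by blast
  qed
qed

end

theorem theorem1p16:
  fixes M :: "nat \<Rightarrow> 'a::topological_space set" and q :: "nat \<Rightarrow> 'a \<Rightarrow> 'a"
    and M' :: "nat \<Rightarrow> 'b::topological_space set" and q' :: "nat \<Rightarrow> 'b \<Rightarrow> 'b"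
    and n n' :: nat and x :: "nat \<Rightarrow> 'a" and x' :: "nat \<Rightarrow> 'b"
  assumes "presentation n M q"
    and "presentation n' M' q'"
    and "solenoidal_manifold M q homeomorphic solenoidal_manifold M' q'"
    and "x \<in> solenoidal_manifold M q"
    and "x' \<in> solenoidal_manifold M' q'"
  shows "typesets_commensurable
           (fundamental_group (M 0) (x 0)) (presentation_chain M q x)
           (fundamental_group (M' 0) (x' 0)) (presentation_chain M' q' x')"
proof -
  interpret X: solenoid n M q by unfold_locales fact
  interpret X': solenoid n' M' q' by unfold_locales fact
  have x: "x \<in> X.S" and x': "x' \<in> X'.S" by fact+
  obtain h h' where homeo: "homeomorphism X.S X'.S h h'"
    using assms(3) unfolding homeomorphic_def by blast
  then have h: "h z \<in> X'.S" "h' (h z) = z" if "z \<in> X.S" for z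
    using that by (auto simp: homeomorphism_def)
  have h': "h' w \<in> X.S" "h (h' w) = w" if "w \<in> X'.S" for w
    using homeo that by (auto simp: homeomorphism_def)
  have ch: "continuous_on X.S h" "continuous_on X'.S h'"
    using homeo by (auto simp: homeomorphism_def)
  define \<A> where "\<A> = {A. openin (top_of_set (M 0)) A \<and> inessential_in (M 0) A}"
  have cover: "\<exists>A\<in>\<A>. openin (top_of_set X'.S) (X'.S \<inter> h' -` {z \<in> X.S. z 0 \<in> A}) \<and>
      w \<in> X'.S \<inter> h' -` {z \<in> X.S. z 0 \<in> A}" if w: "w \<in> X'.S" for w
  proof -
    have "h' w 0 \<in> M 0" using h'[OF w] X.solenoid_mem by blast
    then obtain A where A: "A \<in> \<A>" "h' w 0 \<in> A"
      using closed_manifold_inessential_neighbourhood[OF X.manifold openin_subtopology_self] unfolding \<A>_def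
      by (metis (mono_tags, lifting) mem_Collect_eq)
    then have "openin (top_of_set X'.S) (X'.S \<inter> h' -` {z \<in> X.S. z 0 \<in> A})"
      using h' by (intro openin_preimage[OF ch(2) _ X.openin_level_preimage]) (auto simp: \<A>_def)
    then show ?thesis using A w h' by (intro bexI[OF _ A(1)]) simp
  qed
  have "X'.S \<noteq> {}" using x' by blast
  \<comment> \<open>\<open>j\<close> is the Lebesgue level of the cover by sets that
    \<open>h'\<close> maps over inessential sets of \<open>M 0\<close>.\<close>
  from X'.level_Lebesgue[OF this cover]
  obtain j where j: "\<forall>y\<in>M' j. \<exists>U. openin (top_of_set (M' j)) U \<and> y \<in> U \<and>
      (\<exists>A\<in>\<A>. \<forall>z\<in>X'.S. z j \<in> U \<longrightarrow> z \<in> X'.S \<inter> h' -` {z \<in> X.S. z 0 \<in> A})"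
    by (rule exE)
  define \<U> where "\<U> = {U. openin (top_of_set (M' j)) U \<and> (\<exists>A\<in>\<A>. \<forall>z\<in>X'.S. z j \<in> U \<longrightarrow> h' z 0 \<in> A)}"
  have \<U>: "\<exists>U\<in>\<U>. openin (top_of_set (M' j)) U \<and> y \<in> U" if "y \<in> M' j" for y
    using bspec[OF j that] unfolding \<U>_def by auto
  obtain \<Q> where \<Q>: "\<forall>Q\<in>\<Q>. openin (top_of_set (M' j)) Q \<and> path_connected Q \<and> (\<exists>U\<in>\<U>. Q \<subseteq> U)"
    "\<Union>\<Q> = M' j"
    "\<forall>Q\<in>\<Q>. \<forall>Q'\<in>\<Q>. Q \<inter> Q' \<noteq> {} \<longrightarrow> (\<exists>B. inessential_in (M' j) B \<and> Q \<union> Q' \<subseteq> B)"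
    by (rule closed_manifold_star_refinement[OF X'.manifold \<U>])
  have cover': "\<exists>Q\<in>\<Q>. openin (top_of_set X.S) (X.S \<inter> h -` {z \<in> X'.S. z j \<in> Q}) \<and>
      z \<in> X.S \<inter> h -` {z \<in> X'.S. z j \<in> Q}" if z: "z \<in> X.S" for z
  proof -
    have "h z j \<in> M' j" using h[OF z] X'.solenoid_mem by blast
    then obtain Q where Q: "Q \<in> \<Q>" "h z j \<in> Q" using \<Q>(2) by blast
    then have "openin (top_of_set X.S) (X.S \<inter> h -` {z \<in> X'.S. z j \<in> Q})"
      using h \<Q>(1) by (intro openin_preimage[OF ch(1) _ X'.openin_level_preimage]) auto
    then show ?thesis using Q z h by (intro bexI[OF _ Q(1)]) simp
  qed
  have "X.S \<noteq> {}" using x by blast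
  \<comment> \<open>\<open>k\<close> is the Lebesgue level of the cover by preimages under
    \<open>h\<close> of the sets over members of \<open>\<Q>\<close>.\<close>
  from X.level_Lebesgue[OF this cover']
  obtain k where k: "\<forall>y\<in>M k. \<exists>U. openin (top_of_set (M k)) U \<and> y \<in> U \<and>
      (\<exists>Q\<in>\<Q>. \<forall>z\<in>X.S. z k \<in> U \<longrightarrow> z \<in> X.S \<inter> h -` {z \<in> X'.S. z j \<in> Q})"
    by (rule exE)
  have k': "\<exists>U. openin (top_of_set (M k)) U \<and> y \<in> U \<and> (\<exists>Q\<in>\<Q>. \<forall>z\<in>X.S. z k \<in> U \<longrightarrow> h z j \<in> Q)"
    if "y \<in> M k" for y
    using bspec[OF k that] by auto
  obtain O0 Q0 where O0: "openin (top_of_set (M k)) O0" "x k \<in> O0" "Q0 \<in> \<Q>" "\<forall>z\<in>X.S. z k \<in> O0 \<longrightarrow> h z j \<in> Q0"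
    using k'[OF X.solenoid_mem[OF x]] by blast
  \<comment> \<open>The given basepoints need not correspond under \<open>h\<close>. A path of
    \<open>M k\<close> from \<open>h' x' k\<close> to \<open>x k\<close> is lifted from
    \<open>h' x'\<close>; its end becomes \<open>x1\<close>, and its image under \<open>h\<close>
    becomes \<open>c\<close>.\<close>
  obtain p where p: "path p" "path_image p \<subseteq> M k" "pathstart p = h' x' k" "pathfinish p = x k"
    using X.path_connected_level[of k] X.solenoid_mem h'(1)[OF x'] x unfolding path_connected_def by metis
  obtain u where u: "X.solenoid_path u" "u 0 = h' x'" "\<And>t. t \<in> {0..1} \<Longrightarrow> u t k = p t"
    using X.ex_solenoid_path_lift[OF h'(1)[OF x'] p(1-3)] by blast
  have u1: "u 1 \<in> X.S" "u 1 k = x k"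
    using X.solenoid_path_mem[OF u(1), of 1] u(3)[of 1] p(4) by (simp_all add: pathfinish_def)
  interpret solenoid_comparison n n' M q M' q' h h' j k \<Q> Q0 O0 x "u 1" x' "h \<circ> u"
  proof unfold_locales
    show "homeomorphism X.S X'.S h h'" by (rule homeo)
    show "X'.solenoid_path (h \<circ> u)"
      using u(1) h(1) continuous_on_subset[OF ch(1)] unfolding X.solenoid_path_def X'.solenoid_path_def
      by (auto intro!: path_continuous_image simp: path_image_compose)
    show "openin (top_of_set (M' j)) Q \<and> path_connected Q" if "Q \<in> \<Q>" for Q
      using \<Q>(1) that by blast
    show "\<exists>B. inessential_in (M' j) B \<and> Q \<union> Q' \<subseteq> B" if "Q \<in> \<Q>" "Q' \<in> \<Q>" "Q \<inter> Q' \<noteq> {}" for Q Q'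
      using \<Q>(3) that by blast
    show "\<exists>U. openin (top_of_set (M k)) U \<and> y \<in> U \<and> (\<exists>Q\<in>\<Q>. \<forall>z\<in>X.S. z k \<in> U \<longrightarrow> h z j \<in> Q)"
      if "y \<in> M k" for y
      by (rule k'[OF that])
    show "h z j \<in> Q0" if "z \<in> X.S" "z k \<in> O0" for z
      using O0(4) that by blast
    show "\<exists>A. openin (top_of_set (M 0)) A \<and> inessential_in (M 0) A \<and> (\<forall>z\<in>X'.S. z j \<in> Q \<longrightarrow> h' z 0 \<in> A)"
      if Q: "Q \<in> \<Q>" for Q
    proof -
      obtain U where U: "U \<in> \<U>" "Q \<subseteq> U" using \<Q>(1) Q by blast
      then obtain A where "A \<in> \<A>" "\<forall>z\<in>X'.S. z j \<in> U \<longrightarrow> h' z 0 \<in> A" unfolding \<U>_def by blast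
      then show ?thesis using U(2) unfolding \<A>_def by blast
    qed
    show "(h \<circ> u) 0 = x'" "(h \<circ> u) 1 = h (u 1)"
      using u(2) h'(2)[OF x'] by simp_all
  qed (rule x u1 O0)+
  show ?thesis by (rule commensurable[OF x'])
qed

end
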